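(* Let $K$ be $\mathbb Z$ or any field of characteristic zero. In both cases S and L described in the context, the algebra $\mathcal A^K_{m,n}$ satisfies the ascending chain condition on radical ideals. Hence any radical ideal $I$ of $\mathcal A^K_{m,n}$ is a finite intersection of prime ideals, and these prime ideals can be taken to be the prime ideals minimal over $I$.
   Context: Let $m,n\ge 0$ be integers and let $W=\mathcal S_m\times \mathcal S_n$ (product of symmetric groups) act on polynomials or Laurent polynomials in $x_1,\dots,x_m,y_1,\dots,y_n$ by permuting the $x_i$ and the $y_j$ separately. Case S: $\mathcal A_{m,n}$ is the ring of supersymmetric polynomials over $\mathbb Z$: all $f\in \mathbb Z[x_1,\dots,x_m,y_1,\dots,y_n]^{W}$ such that the polynomial obtained by substituting $x_1=t$, $y_1=-t$ is independent of $t$. Case L: $\mathcal A_{m,n}$ is the ring of Laurent supersymmetric polynomials: all $f\in \mathbb Z[x_1^{\pm1},\dots,x_m^{\pm1},y_1^{\pm1},\dots,y_n^{\pm1}]^{W}$ such that $x_i\frac{\partial f}{\partial x_i}+y_j\frac{\partial f}{\partial y_j}$ lies in the ideal $(x_i-y_j)$ of the Laurent polynomial ring for all $i,j$. If $mn=0$ the supersymmetry condition is vacuous. Put $\mathcal A^K_{m,n}=\mathcal A_{m,n}\otimes_{\mathbb Z}K$. An ideal $I$ of a commutative ring $A$ is radical if $I=\{f\in A: f^N\in I\text{ for some }N>0\}$. A ring satisfies the ascending chain condition on radical ideals if every ascending chain $R^1\subseteq R^2\subseteq\cdots$ of radical ideals is eventually constant. *)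

theory Defs
  imports "HOL-Algebra.Algebra" "HOL-Algebra.Algebraic_Closure_Type"
    "HOL-Library.Poly_Mapping" "HOL-Combinatorics.Permutations"
begin

section \<open>Polynomials and Laurent polynomials in $x_1,\dots,x_m,y_1,\dots,y_n$\<close>

text \<open>
  The variables are indexed from 0: \<open>Inl i\<close> with \<open>i < m\<close> stands for $x_{i+1}$ and
  \<open>Inr j\<close> with \<open>j < n\<close> for $y_{j+1}$.  A monomial is its exponent vector, so that
  exponents in \<^typ>\<open>nat\<close> give polynomials and exponents in \<^typ>\<open>int\<close> give Laurent
  polynomials; the product on the outer \<^type>\<open>poly_mapping\<close> is the convolution product.
\<close>

type_synonym 'e gpoly = "((nat + nat) \<Rightarrow>\<^sub>0 'e) \<Rightarrow>\<^sub>0 int"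
type_synonym zpoly = "nat gpoly"
type_synonym zlaurent = "int gpoly"

definition Var :: "nat + nat \<Rightarrow> ('e::zero_neq_one) gpoly" where
  "Var v = Poly_Mapping.single (Poly_Mapping.single v 1) 1"

definition vars :: "nat \<Rightarrow> nat \<Rightarrow> (nat + nat) set" where
  "vars m n = Inl ` {..<m} \<union> Inr ` {..<n}"

definition gpoly_in :: "nat \<Rightarrow> nat \<Rightarrow> ('e::zero) gpoly set" where
  "gpoly_in m n = {f. \<forall>\<mu> \<in> Poly_Mapping.keys f. Poly_Mapping.keys \<mu> \<subseteq> vars m n}"

text \<open>
  For a bijection \<open>\<pi>\<close> of the variables, \<open>permute_vars \<pi> f\<close> is the result of substituting
  \<open>Var (inv \<pi> v)\<close> for every variable \<open>v\<close> (\<^const>\<open>Poly_Mapping.map_key\<close> precomposes with its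
  argument, once on coefficient functions and once on exponent vectors).
\<close>

definition permute_vars :: "(nat + nat \<Rightarrow> nat + nat) \<Rightarrow> ('e::zero) gpoly \<Rightarrow> 'e gpoly" where
  "permute_vars \<pi> f = Poly_Mapping.map_key (Poly_Mapping.map_key \<pi>) f"

definition W_invariants :: "nat \<Rightarrow> nat \<Rightarrow> ('e::zero) gpoly set" where
  "W_invariants m n = {f \<in> gpoly_in m n. \<forall>\<sigma> \<tau>. \<sigma> permutes {..<m} \<longrightarrow> \<tau> permutes {..<n} \<longrightarrow>
     permute_vars (map_sum \<sigma> \<tau>) f = f}"

text \<open>The subring of a type-class ring with underlying set \<open>A\<close>, as a record.\<close>

abbreviation ring_on :: "('a::ring_1) set \<Rightarrow> 'a ring" where
  "ring_on A \<equiv> ring_of_type_algebra\<lparr>carrier := A\<rparr>"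

section \<open>Case S: supersymmetric polynomials\<close>

definition subst_poly :: "(nat + nat \<Rightarrow> 'b::comm_ring_1) \<Rightarrow> zpoly \<Rightarrow> 'b" where
  "subst_poly \<phi> f = (\<Sum>\<mu> \<in> Poly_Mapping.keys f. of_int (Poly_Mapping.lookup f \<mu>) *
     (\<Prod>v \<in> Poly_Mapping.keys \<mu>. \<phi> v ^ Poly_Mapping.lookup \<mu> v))"

text \<open>
  The result of the substitution $x_1 = t$, $y_1 = -t$, as a polynomial in $t$ whose
  coefficients are polynomials in the remaining variables.
\<close>

definition subst_t :: "zpoly \<Rightarrow> zpoly poly" where
  "subst_t = subst_poly (\<lambda>v. if v = Inl 0 then [:0, 1:]
     else if v = Inr 0 then - [:0, 1:] else [:Var v:])"

definition supersym_polys :: "nat \<Rightarrow> nat \<Rightarrow> zpoly ring" where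
  "supersym_polys m n =
     ring_on {f \<in> W_invariants m n. m > 0 \<and> n > 0 \<longrightarrow> Polynomial.degree (subst_t f) = 0}"

section \<open>Case L: Laurent supersymmetric polynomials\<close>

definition partial_deriv :: "nat + nat \<Rightarrow> zlaurent \<Rightarrow> zlaurent" where
  "partial_deriv v f = (\<Sum>\<mu> \<in> Poly_Mapping.keys f.
     Poly_Mapping.single (\<mu> - Poly_Mapping.single v 1)
       (Poly_Mapping.lookup \<mu> v * Poly_Mapping.lookup f \<mu>))"

definition laurent_ring :: "nat \<Rightarrow> nat \<Rightarrow> zlaurent ring" where
  "laurent_ring m n = ring_on (gpoly_in m n)"

definition supersym_laurent :: "nat \<Rightarrow> nat \<Rightarrow> zlaurent ring" where
  "supersym_laurent m n = ring_on {f \<in> W_invariants m n. \<forall>i<m. \<forall>j<n.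
     Var (Inl i) * partial_deriv (Inl i) f + Var (Inr j) * partial_deriv (Inr j) f
       \<in> PIdl\<^bsub>laurent_ring m n\<^esub> (Var (Inl i) - Var (Inr j))}"

section \<open>Tensor product of commutative rings over the integers\<close>

text \<open>
  The tensor product is the free abelian group on \<open>carrier R \<times> carrier S\<close>, with product
  \<open>(r, s) (r', s') = (r r', s s')\<close>, modulo the biadditivity relations.  (The subgroup
  generated by these relations is stable under multiplication by the pairs, so it is the ideal
  they generate.)
\<close>

definition pair_ring ::
  "('a, 'c) ring_scheme \<Rightarrow> ('b, 'd) ring_scheme \<Rightarrow> ('a \<times> 'b \<Rightarrow>\<^sub>0 int) ring" where
  "pair_ring R S =
     \<lparr>carrier = {c. Poly_Mapping.keys c \<subseteq> carrier R \<times> carrier S},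
      monoid.mult = (\<lambda>c d. frag_extend (\<lambda>(r, s). frag_extend (\<lambda>(r', s').
        frag_of (r \<otimes>\<^bsub>R\<^esub> r', s \<otimes>\<^bsub>S\<^esub> s')) d) c),
      one = frag_of (\<one>\<^bsub>R\<^esub>, \<one>\<^bsub>S\<^esub>), ring.zero = 0, add = (+)\<rparr>"

definition biadditivity_relations ::
  "('a, 'c) ring_scheme \<Rightarrow> ('b, 'd) ring_scheme \<Rightarrow> ('a \<times> 'b \<Rightarrow>\<^sub>0 int) set" where
  "biadditivity_relations R S =
     {frag_of (r \<oplus>\<^bsub>R\<^esub> r', s) - frag_of (r, s) - frag_of (r', s) | r r' s.
        r \<in> carrier R \<and> r' \<in> carrier R \<and> s \<in> carrier S} \<union>
     {frag_of (r, s \<oplus>\<^bsub>S\<^esub> s') - frag_of (r, s) - frag_of (r, s') | r s s'.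
        r \<in> carrier R \<and> s \<in> carrier S \<and> s' \<in> carrier S}"

definition tensor_ring ::
  "('a, 'c) ring_scheme \<Rightarrow> ('b, 'd) ring_scheme \<Rightarrow> ('a \<times> 'b \<Rightarrow>\<^sub>0 int) set ring"
  (infixl \<open>\<otimes>\<^sub>\<int>\<close> 70) where
  "R \<otimes>\<^sub>\<int> S = pair_ring R S Quot (Idl\<^bsub>pair_ring R S\<^esub> (biadditivity_relations R S))"

section \<open>Radical ideals and minimal primes\<close>

definition radical_ideal :: "'a set \<Rightarrow> ('a, 'c) ring_scheme \<Rightarrow> bool" where
  "radical_ideal I A \<longleftrightarrow> ideal I A \<and> I = {f \<in> carrier A. \<exists>N::nat. N > 0 \<and> f [^]\<^bsub>A\<^esub> N \<in> I}"

definition acc_radical_ideals :: "('a, 'c) ring_scheme \<Rightarrow> bool" where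
  "acc_radical_ideals A \<longleftrightarrow>
     (\<forall>R :: nat \<Rightarrow> 'a set. (\<forall>k. radical_ideal (R k) A) \<and> (\<forall>k. R k \<subseteq> R (Suc k)) \<longrightarrow>
        (\<exists>N. \<forall>k\<ge>N. R k = R N))"

definition minimal_primes :: "('a, 'c) ring_scheme \<Rightarrow> 'a set \<Rightarrow> 'a set set" where
  "minimal_primes A I = {P. primeideal P A \<and> I \<subseteq> P \<and>
     (\<forall>Q. primeideal Q A \<and> I \<subseteq> Q \<and> Q \<subseteq> P \<longrightarrow> Q = P)}"

text \<open>
  Intersections are taken inside \<^term>\<open>carrier A\<close>, so that the intersection of the empty family
  is the unit ideal.
\<close>

definition finite_prime_intersection ::
  "('a, 'c) ring_scheme \<Rightarrow> 'a set \<Rightarrow> 'a set set \<Rightarrow> bool" where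
  "finite_prime_intersection A I \<P> \<longleftrightarrow>
     finite \<P> \<and> (\<forall>P\<in>\<P>. primeideal P A) \<and> I = carrier A \<inter> \<Inter>\<P>"

end

theory Submission
  imports Defs "HOL-Library.Function_Algebras" "Jordan_Normal_Form.Char_Poly"
begin

text \<open>
  Elements of the rings are treated as functions on a torus.  Specialising the last \<open>k\<close> pairs
  \<open>x\<^sub>i, y\<^sub>j\<close> to 1 (which, by supersymmetry, equals specialising them to arbitrary values
  \<open>x\<^sub>i = y\<^sub>j\<close>) maps \<open>A\<close> into the Noetherian ring \<open>B\<^sub>k\<close> of (Laurent) polynomials in the
  remaining variables, and the kernels of these maps \<open>\<phi>\<^sub>k\<close> filter \<open>A\<close>.  An element of the kernel
  of \<open>\<phi>\<^bsub>k+1\<^esub>\<close> is sent by \<open>\<phi>\<^sub>k\<close> to a multiple of \<open>\<Delta> = \<Prod>(x\<^sub>i - y\<^sub>j)\<close>.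

  The function \<open>g\<^sub>a = \<Sum>\<^sub>i x\<^sub>i\<^sup>a \<Prod>\<^sub>j (x\<^sub>i - y\<^sub>j) / \<Prod>\<^bsub>l \<noteq> i\<^esub> (x\<^sub>i - x\<^sub>l)\<close> is a divided
  difference, hence a (Laurent) polynomial, it is supersymmetric, and it specialises to the
  function of the same shape in fewer variables.  The determinant of the \<open>g\<close> with indices
  \<open>i + \<alpha>\<^sub>j\<close> is \<open>\<plusminus> \<Delta>\<close> times the quotient of alternants \<open>det (x\<^sub>j ^ \<alpha>\<^sub>i) / det (x\<^sub>j ^ i)\<close>.  Doing the same
  in the \<open>y\<^sub>j\<close>, the operator that antisymmetrises \<open>u \<in> B\<^sub>k\<close>, divides by both Vandermonde determinants
  and multiplies by \<open>\<Delta>\<^sup>2\<close> takes values in \<open>\<phi>\<^sub>k(A)\<close>, and it is linear over symmetric functions.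

  For a chain \<open>R\<^sup>1 \<subseteq> R\<^sup>2 \<subseteq> \<dots>\<close> of radical ideals the ideals \<open>\<phi>\<^sub>k(R\<^sup>j) B\<^sub>k\<close> become stationary.
  Applying the operator to a relation \<open>\<phi>\<^sub>k(f) = \<Sum> \<phi>\<^sub>k(\<rho>) b\<^sub>\<rho>\<close> with \<open>f \<in> R\<^sup>j\<close> and \<open>\<rho> \<in> R\<^sup>N\<close> gives
  \<open>e\<^sup>2 f \<in> R\<^sup>N + ker \<phi>\<^sub>k\<close> for \<open>e \<in> ker \<phi>\<^bsub>k+1\<^esub>\<close>, and induction on \<open>k\<close> yields \<open>e f \<in> R\<^sup>N\<close> for some
  \<open>N\<close>, all \<open>j\<close> and all \<open>e \<in> ker \<phi>\<^bsub>k+1\<^esub>\<close>; the last step allows \<open>e = 1\<close>.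
\<close>

text \<open>Finite generation is available only in \<open>B\<^sub>k\<close>, and the coefficients
  \<open>b\<^sub>\<rho>\<close> found there are in general not restrictions of elements of
  \<open>A\<close>. Antisymmetrisation in both groups of variables makes such restrictions out of
  them; each of the two determinants contributes one factor \<Delta> up to sign, hence the square.
  If e restricts to \<Delta> b, the operator is applied to b^2 \<open>b\<^sub>\<rho>\<close> times
  the staircase monomial, whose antisymmetrisation is exactly the product of Vandermonde
  determinants that is divided out; what remains is e^2 f up to sign. Radicality enters once per
  level: this congruence is multiplied by f, the induction hypothesis takes the kernel part into the
  ideal, and from (e f)^2 one passes to e f. The induction starts because
  \<open>\<phi>\<^sub>0\<close> is injective on \<open>A\<close>, and it ends after min(m,n) pairs
  because \<Delta> is then an empty product. Functions may replace tensors because finitely many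
  elements of K lie in the integral span of a Z-independent finite set, and monomials are linearly
  independent functions on a torus in characteristic 0. For K = Z the values are rational.\<close>

abbreviation "keys \<equiv> Poly_Mapping.keys"
abbreviation "lookup \<equiv> Poly_Mapping.lookup"

section \<open>Noetherian subrings and the Hilbert basis theorem\<close>

definition is_subring :: "'r::comm_ring_1 set \<Rightarrow> bool" where
  "is_subring C \<longleftrightarrow> 1 \<in> C \<and> (\<forall>a\<in>C. \<forall>b\<in>C. a - b \<in> C \<and> a * b \<in> C)"

lemma is_subringD:
  assumes "is_subring C"
  shows "1 \<in> C" "0 \<in> C" "a \<in> C \<Longrightarrow> b \<in> C \<Longrightarrow> a - b \<in> C" "a \<in> C \<Longrightarrow> b \<in> C \<Longrightarrow> a * b \<in> C"
    "a \<in> C \<Longrightarrow> - a \<in> C" "a \<in> C \<Longrightarrow> b \<in> C \<Longrightarrow> a + b \<in> C"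
proof -
  show 1: "1 \<in> C" and d: "\<And>a b. a \<in> C \<Longrightarrow> b \<in> C \<Longrightarrow> a - b \<in> C"
    and "a \<in> C \<Longrightarrow> b \<in> C \<Longrightarrow> a * b \<in> C"
    using assms by (auto simp: is_subring_def)
  show 0: "0 \<in> C" using d[OF 1 1] by simp
  show m: "\<And>a. a \<in> C \<Longrightarrow> - a \<in> C" using d[OF 0] by fastforce
  show "a \<in> C \<Longrightarrow> b \<in> C \<Longrightarrow> a + b \<in> C" using d[of a "- b"] m[of b] by simp
qed

lemma is_subring_sum: "is_subring C \<Longrightarrow> (\<And>i. i \<in> I \<Longrightarrow> f i \<in> C) \<Longrightarrow> sum f I \<in> C"
  by (induction I rule: infinite_finite_induct) (auto simp: is_subringD)

lemma is_subring_prod: "is_subring C \<Longrightarrow> (\<And>i. i \<in> I \<Longrightarrow> f i \<in> C) \<Longrightarrow> prod f I \<in> C"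
  by (induction I rule: infinite_finite_induct) (auto simp: is_subringD)

lemma is_subring_power: "is_subring C \<Longrightarrow> a \<in> C \<Longrightarrow> a ^ n \<in> C"
  by (induction n) (auto simp: is_subringD)

text \<open>Serves both for ideals (\<open>C\<close> a ring, \<open>S\<close> generators inside it)
  and for the span of a ring over the constants. Adding one term at a time lets inclusions and
  homomorphisms be handled by rule induction.\<close>

inductive_set lspan :: "'r::comm_ring_1 set \<Rightarrow> 'r set \<Rightarrow> 'r set" for C S where
  lspan_zero: "0 \<in> lspan C S"
| lspan_step: "v \<in> lspan C S \<Longrightarrow> c \<in> C \<Longrightarrow> s \<in> S \<Longrightarrow> v + c * s \<in> lspan C S"

lemma lspan_add: "u \<in> lspan C S \<Longrightarrow> v \<in> lspan C S \<Longrightarrow> u + v \<in> lspan C S"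
proof (induction u rule: lspan.induct)
  case (lspan_step u c s)
  from lspan.lspan_step[OF lspan_step.IH[OF lspan_step.prems] lspan_step.hyps(2,3)]
  show ?case by (simp add: algebra_simps)
qed simp

lemma lspan_base: "c \<in> C \<Longrightarrow> s \<in> S \<Longrightarrow> c * s \<in> lspan C S"
  using lspan_step[OF lspan_zero] by fastforce

lemma lspan_sum: "(\<And>i. i \<in> I \<Longrightarrow> f i \<in> lspan C S) \<Longrightarrow> sum f I \<in> lspan C S"
  by (induction I rule: infinite_finite_induct) (auto intro: lspan_add lspan_zero)

lemma lspan_smult:
  assumes "is_subring C" "v \<in> lspan C S" "a \<in> C" shows "a * v \<in> lspan C S"
  using assms(2)
proof (induction v rule: lspan.induct)
  case (lspan_step v c s)
  have "a * v + (a * c) * s \<in> lspan C S"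
    using lspan_step.IH is_subringD(4)[OF assms(1,3) lspan_step.hyps(2)] lspan_step.hyps(3)
    by (rule lspan.lspan_step)
  then show ?case by (simp add: algebra_simps)
qed (auto intro: lspan.intros)

lemma lspan_incl: "is_subring C \<Longrightarrow> s \<in> S \<Longrightarrow> s \<in> lspan C S"
  using lspan_base[of 1 C s S] is_subringD(1) by auto

lemma lspan_closed:
  assumes C: "is_subring C" and "S \<subseteq> lspan C T" and "v \<in> lspan C S" shows "v \<in> lspan C T"
  using assms(3) by (induction rule: lspan.induct) (use assms in \<open>auto intro!: lspan_zero lspan_add lspan_smult\<close>)

lemma lspan_mono: "S \<subseteq> T \<Longrightarrow> v \<in> lspan C S \<Longrightarrow> v \<in> lspan C T"
  by (rotate_tac, induction rule: lspan.induct) (auto intro: lspan.intros)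

lemma lspan_mono_set: "S \<subseteq> T \<Longrightarrow> lspan C S \<subseteq> lspan C T"
  using lspan_mono by blast

lemma lspan_finite_support:
  assumes "v \<in> lspan C S" shows "\<exists>T\<subseteq>S. finite T \<and> v \<in> lspan C T"
  using assms
proof (induction rule: lspan.induct)
  case (lspan_step v c s)
  then obtain T where T: "T \<subseteq> S" "finite T" "v \<in> lspan C T" by auto
  from T(3) have "v \<in> lspan C (insert s T)" by (rule lspan_mono[rotated]) auto
  then have "v + c * s \<in> lspan C (insert s T)" using lspan_step by (intro lspan.lspan_step) auto
  with T lspan_step show ?case by (intro exI[of _ "insert s T"]) auto
qed (auto intro: lspan.intros)

lemma lspan_uminus: "is_subring C \<Longrightarrow> v \<in> lspan C S \<Longrightarrow> - v \<in> lspan C S"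
  using lspan_smult[of C v S "- 1"] is_subringD[of C] by auto

lemma lspan_image:
  assumes "v \<in> lspan C (a ` I)" "finite I" "is_subring C"
  shows "\<exists>u. (\<forall>i. u i \<in> C) \<and> v = (\<Sum>i\<in>I. u i * a i)"
  using assms(1)
proof (induction rule: lspan.induct)
  case lspan_zero
  then show ?case using assms(3) by (intro exI[of _ "\<lambda>_. 0"]) (auto simp: is_subringD)
next
  case (lspan_step v c s)
  then obtain u where u: "\<And>i. u i \<in> C" "v = (\<Sum>i\<in>I. u i * a i)" by auto
  from lspan_step obtain k where k: "k \<in> I" "s = a k" by auto
  have eq: "(u(k := u k + c)) i * a i = u i * a i + (if i = k then c * a k else 0)" for i
    by (auto simp: algebra_simps)
  have "(\<Sum>i\<in>I. (u(k := u k + c)) i * a i) = v + c * s"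
    unfolding eq using u(2) k assms(2) by (simp add: sum.distrib)
  moreover have "\<forall>i. (u(k := u k + c)) i \<in> C"
    using u(1) lspan_step.hyps assms(3) by (auto simp: is_subringD)
  ultimately show ?case by metis
qed

text \<open>The ascending chain condition on ideals in sequence form: no sequence can leave for ever
  the ideal generated by its earlier terms.\<close>

definition noeth :: "'r::comm_ring_1 set \<Rightarrow> bool" where
  "noeth C \<longleftrightarrow> (\<forall>a::nat \<Rightarrow> 'r. range a \<subseteq> C \<longrightarrow> (\<exists>N. a N \<in> lspan C (a ` {..<N})))"

lemma noethE:
  fixes a :: "nat \<Rightarrow> 'r::comm_ring_1"
  assumes "noeth C" "\<And>i. a i \<in> C" obtains N where "a N \<in> lspan C (a ` {..<N})"
  using assms unfolding noeth_def by blast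

lemma noeth_hom:
  fixes h :: "'r::comm_ring_1 \<Rightarrow> 's::comm_ring_1"
  assumes "noeth C" "h 0 = 0" "\<And>x y. h (x + y) = h x + h y" "\<And>x y. h (x * y) = h x * h y"
  shows "noeth (h ` C)"
  unfolding noeth_def
proof (intro allI impI)
  fix a :: "nat \<Rightarrow> 's" assume "range a \<subseteq> h ` C"
  then have "\<forall>i. \<exists>c. c \<in> C \<and> a i = h c" by (auto simp: image_iff subset_eq)
  then obtain c where c: "\<And>i. c i \<in> C" "\<And>i. a i = h (c i)" by metis
  obtain N where "c N \<in> lspan C (c ` {..<N})" using noethE[OF assms(1) c(1)] .
  then have "h (c N) \<in> lspan (h ` C) (a ` {..<N})"
  proof (induction rule: lspan.induct)
    case lspan_zero
    then show ?case by (simp add: assms(2) lspan.lspan_zero)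
  next
    case (lspan_step v d s)
    then obtain i where "i < N" "s = c i" by auto
    with lspan.lspan_step[OF lspan_step.IH, of "h d" "a i"] lspan_step.hyps
    show ?case by (simp add: c assms)
  qed
  then show "\<exists>N. a N \<in> lspan (h ` C) (a ` {..<N})" by (intro exI[of _ N]) (simp add: c)
qed

text \<open>Dependent choice, each time of a \<open>\<delta>\<close>-minimal element outside the
  span of the earlier ones. With the degree as \<open>\<delta>\<close> this is Hilbert's minimal bad
  sequence; a constant \<open>\<delta>\<close> gives a plain bad sequence.\<close>

lemma escaping_sequence:
  fixes S :: "'r set" and L :: "'r set \<Rightarrow> 'r set" and \<delta> :: "'r \<Rightarrow> nat"
  assumes "\<And>F. finite F \<Longrightarrow> F \<subseteq> S \<Longrightarrow> \<not> S \<subseteq> L F"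
  shows "\<exists>q::nat \<Rightarrow> 'r. \<forall>N. q N \<in> S \<and> q N \<notin> L (q ` {..<N}) \<and>
           (\<forall>s\<in>S. s \<notin> L (q ` {..<N}) \<longrightarrow> \<delta> (q N) \<le> \<delta> s)"
proof -
  define P where "P = (\<lambda>q (N::nat) r. r \<in> S \<and> r \<notin> L (q ` {..<N}) \<and>
           (\<forall>s\<in>S. s \<notin> L (q ` {..<N}) \<longrightarrow> \<delta> r \<le> \<delta> s))"
  have "\<exists>q. \<forall>N. P q N (q N)"
  proof (rule dependent_wf_choice[where R = less_than])
    show "wf less_than" by simp
  next
    fix f g :: "nat \<Rightarrow> 'r" and x r assume eq: "\<And>z. (z, x) \<in> less_than \<Longrightarrow> f z = g z"
    have "f ` {..<x} = g ` {..<x}" using eq by (intro image_cong) auto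
    then show "P f x r = P g x r" by (simp add: P_def)
  next
    fix x and f :: "nat \<Rightarrow> 'r" assume h: "\<And>y. (y, x) \<in> less_than \<Longrightarrow> P f y (f y)"
    have "f ` {..<x} \<subseteq> S" using h by (auto simp: P_def)
    then obtain s where s: "s \<in> S" "s \<notin> L (f ` {..<x})" using assms[of "f ` {..<x}"] by auto
    show "\<exists>r. P f x r"
      using ex_has_least_nat[of "\<lambda>s. s \<in> S \<and> s \<notin> L (f ` {..<x})" s \<delta>] s
      by (auto simp: P_def)
  qed
  then show ?thesis by (simp add: P_def)
qed

lemma noeth_finitely_generated:
  assumes "noeth C" "S \<subseteq> C"
  shows "\<exists>F\<subseteq>S. finite F \<and> S \<subseteq> lspan C F"
proof (rule ccontr)
  assume "\<not> ?thesis"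
  then have "\<And>F. finite F \<Longrightarrow> F \<subseteq> S \<Longrightarrow> \<not> S \<subseteq> lspan C F" by auto
  from escaping_sequence[where L = "lspan C" and \<delta> = "\<lambda>_. 0", OF this]
  obtain q :: "nat \<Rightarrow> 'a" where q: "\<And>N. q N \<in> S \<and> q N \<notin> lspan C (q ` {..<N})" by auto
  with assms noethE[of C q] show False by blast
qed

definition adjoin :: "'r::comm_ring_1 set \<Rightarrow> 'r \<Rightarrow> 'r set" where
  "adjoin C x = {poly P x | P. \<forall>i. coeff P i \<in> C}"

lemma is_subring_polys:
  assumes "is_subring C" shows "is_subring {P. \<forall>i. coeff P i \<in> C}"
  using assms by (auto simp: is_subring_def coeff_mult coeff_1 is_subringD[OF assms]
      intro!: is_subring_sum[OF assms])

text \<open>In a bad sequence of polynomials chosen with minimal degrees, a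
  relation between the leading coefficients produces a remainder of smaller degree.\<close>

lemma noeth_polys:
  fixes C :: "'r::comm_ring_1 set"
  assumes C: "is_subring C" and "noeth C"
  shows "noeth {P. \<forall>i. coeff P i \<in> C}"
proof -
  define D where "D = {P. \<forall>i. coeff P i \<in> C}"
  have mem: "P \<in> D \<longleftrightarrow> (\<forall>i. coeff P i \<in> C)" for P by (simp add: D_def)
  note DR = is_subring_polys[OF C, folded D_def]
  have False if p: "range p \<subseteq> D" and bad: "\<nexists>N. p N \<in> lspan D (p ` {..<N})" for p :: "nat \<Rightarrow> 'r poly"
  proof -
  define I where "I = lspan D (range p)"
  have ID: "q \<in> D" if "q \<in> I" for q
    using that unfolding I_def
  proof (induction rule: lspan.induct)
    case (lspan_step v c s)
    have "s \<in> D" by (rule subsetD[OF p lspan_step.hyps(3)])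
    then show ?case by (rule is_subringD(6)[OF DR lspan_step.IH is_subringD(4)[OF DR lspan_step.hyps(2)]])
  qed (rule is_subringD(2)[OF DR])
  \<comment> \<open>Finitely many elements of \<open>I\<close> involve only finitely many terms of
    \<open>p\<close>; if they generated \<open>I\<close>, some \<open>p N\<close> would lie in the
    span of its predecessors.\<close>
  have nfg: "\<not> I \<subseteq> lspan D F" if F: "finite F" "F \<subseteq> I" for F
  proof
    assume sub: "I \<subseteq> lspan D F"
    have "\<exists>N. F \<subseteq> lspan D (p ` {..<N})" using F
    proof (induction F rule: finite_induct)
      case (insert q F)
      then obtain N where N: "F \<subseteq> lspan D (p ` {..<N})" by auto
      from insert have "q \<in> lspan D (range p)" by (auto simp: I_def)
      from lspan_finite_support[OF this] obtain T where
        T: "T \<subseteq> range p" "finite T" "q \<in> lspan D T" by blast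
      from finite_subset_image[OF T(2,1)] obtain J where J: "finite J" "T = p ` J" by auto
      obtain M where "J \<subseteq> {..<M}" using finite_nat_bounded[OF J(1)] by auto
      then have "T \<subseteq> p ` {..<max N M}" using J(2) by fastforce
      then have "q \<in> lspan D (p ` {..<max N M})" using T(3) by (rule lspan_mono)
      moreover have "p ` {..<N} \<subseteq> p ` {..<max N M}" by auto
      then have "F \<subseteq> lspan D (p ` {..<max N M})" using N lspan_mono_set by blast
      ultimately have "insert q F \<subseteq> lspan D (p ` {..<max N M})" by simp
      then show ?case by (rule exI)
    qed simp
    then obtain N where N: "F \<subseteq> lspan D (p ` {..<N})" by blast
    have "p N \<in> I" unfolding I_def using DR by (intro lspan_incl) auto
    then have "p N \<in> lspan D (p ` {..<N})"
      using lspan_closed[OF DR N] sub by blast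
    with bad show False by blast
  qed
  from escaping_sequence[where L = "lspan D" and \<delta> = degree, OF nfg]
  obtain q :: "nat \<Rightarrow> 'r poly" where q: "\<And>N. q N \<in> I" "\<And>N. q N \<notin> lspan D (q ` {..<N})"
    "\<And>N s. s \<in> I \<Longrightarrow> s \<notin> lspan D (q ` {..<N}) \<Longrightarrow> degree (q N) \<le> degree s" by blast
  define a where "a = (\<lambda>i. lead_coeff (q i))"
  have "a i \<in> C" for i using ID[OF q(1)] by (auto simp: a_def mem)
  from noethE[OF \<open>noeth C\<close> this] obtain N where N: "a N \<in> lspan C (a ` {..<N})" .
  from lspan_image[OF this _ C] obtain u where
    u: "\<And>i. u i \<in> C" "a N = (\<Sum>i<N. u i * a i)" by auto
  \<comment> \<open>\<open>q N\<close> also escapes the smaller span at stage \<open>i\<close>, so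
    it was a candidate there and minimality compares the degrees.\<close>
  have deg: "degree (q i) \<le> degree (q N)" if "i < N" for i
  proof (rule q(3)[OF q(1)])
    show "q N \<notin> lspan D (q ` {..<i})"
      using q(2)[of N] lspan_mono_set[of "q ` {..<i}" "q ` {..<N}" D] that by (meson image_mono lessThan_subset_iff less_imp_le subsetD)
  qed
  define h where "h = (\<Sum>i<N. monom (u i) (degree (q N) - degree (q i)) * q i)"
  have h: "h \<in> lspan D (q ` {..<N})"
    unfolding h_def by (intro lspan_sum lspan_base) (use u C in \<open>auto simp: is_subringD mem\<close>)
  have hI: "h \<in> I" using h lspan_closed[OF DR, of "q ` {..<N}" "range p" h] q(1) by (auto simp: I_def)
  have gI: "q N - h \<in> I"
    using lspan_add[OF q(1)[of N, unfolded I_def] lspan_uminus[OF DR hI[unfolded I_def]]] by (simp add: I_def)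
  have gn: "q N - h \<notin> lspan D (q ` {..<N})"
    using lspan_add[OF _ h, of "q N - h"] q(2)[of N] by auto
  have "degree (q N - h) \<ge> degree (q N)" by (rule q(3)[OF gI gn])
  moreover have "degree h \<le> degree (q N)"
    unfolding h_def using deg
    by (intro degree_sum_le) (auto intro!: order.trans[OF degree_mult_le] order.trans[OF add_mono[OF degree_monom_le order_refl]])
  moreover have "coeff h (degree (q N)) = lead_coeff (q N)"
  proof -
    have "coeff h (degree (q N)) = (\<Sum>i<N. u i * a i)"
      unfolding h_def coeff_sum a_def using deg by (intro sum.cong) (auto simp: coeff_monom_mult)
    then show ?thesis using u(2) by (simp add: a_def)
  qed
  \<comment> \<open>By minimality the degree cannot drop, yet the coefficient in that degree
    cancels. Only the zero polynomial allows this, also in degree 0.\<close>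
  ultimately have "q N - h = 0"
    by (metis coeff_diff degree_diff_le diff_self le_antisym leading_coeff_0_iff order_refl)
  with gn show False by (simp add: lspan.intros)
  qed
  then show ?thesis unfolding noeth_def D_def[symmetric] by blast
qed

lemma noeth_adjoin:
  fixes C :: "'r::comm_ring_1 set"
  assumes C: "is_subring C" and "noeth C" shows "noeth (adjoin C x)"
  unfolding noeth_def
proof (intro allI impI)
  let ?D = "{P. \<forall>i. coeff P i \<in> C}"
  fix a :: "nat \<Rightarrow> 'r" assume "range a \<subseteq> adjoin C x"
  then have "\<forall>i. \<exists>P. P \<in> ?D \<and> a i = poly P x" by (fastforce simp: adjoin_def)
  then obtain P where P: "\<And>i. P i \<in> ?D" "\<And>i. a i = poly (P i) x" by metis
  from noethE[OF noeth_polys[OF assms] P(1)] obtain N where "P N \<in> lspan ?D (P ` {..<N})" .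
  then have "poly (P N) x \<in> lspan (adjoin C x) (a ` {..<N})"
  proof (induction rule: lspan.induct)
    case (lspan_step v c s)
    then obtain i where "i < N" "s = P i" by auto
    moreover have "poly c x \<in> adjoin C x" using lspan_step.hyps(2) by (auto simp: adjoin_def)
    ultimately show ?case using lspan.lspan_step[OF lspan_step.IH, of "poly c x" "a i"] P(2) by auto
  qed (auto intro: lspan.intros)
  then show "\<exists>N. a N \<in> lspan (adjoin C x) (a ` {..<N})" using P(2) by auto
qed

lemma adjoin_subset:
  assumes D: "is_subring D" "C \<subseteq> D" "x \<in> D" shows "adjoin C x \<subseteq> D"
proof
  fix y assume "y \<in> adjoin C x"
  then obtain P where P: "y = poly P x" "\<And>i. coeff P i \<in> C" by (auto simp: adjoin_def)
  show "y \<in> D" unfolding P(1) poly_altdef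
    using P(2) D by (intro is_subring_sum) (auto intro!: is_subringD(4) is_subring_power)
qed

lemma adjoin_incl:
  assumes "is_subring C" shows "C \<subseteq> adjoin C x" "x \<in> adjoin C x" "is_subring (adjoin C x)"
proof -
  note D = is_subringD[OF assms] and DP = is_subringD[OF is_subring_polys[OF assms]]
  show "C \<subseteq> adjoin C x"
  proof
    fix c assume "c \<in> C"
    then show "c \<in> adjoin C x"
      unfolding adjoin_def by (auto intro!: exI[of _ "[:c:]"] simp: coeff_pCons D split: nat.split)
  qed
  show "x \<in> adjoin C x"
    unfolding adjoin_def by (auto intro!: exI[of _ "[:0, 1:]"] simp: coeff_pCons D split: nat.split)
  show "is_subring (adjoin C x)"
    unfolding is_subring_def
  proof (intro conjI ballI)
    show "1 \<in> adjoin C x" unfolding adjoin_def using DP(1) by (force intro!: exI[of _ 1])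
  next
    fix a b assume "a \<in> adjoin C x" "b \<in> adjoin C x"
    then obtain P Q where PQ: "P \<in> {P. \<forall>i. coeff P i \<in> C}" "Q \<in> {P. \<forall>i. coeff P i \<in> C}"
      "a = poly P x" "b = poly Q x" by (fastforce simp: adjoin_def)
    from DP(3)[OF PQ(1,2)] show "a - b \<in> adjoin C x" unfolding adjoin_def PQ(3,4)
      by (metis (mono_tags, lifting) mem_Collect_eq poly_diff)
    from DP(4)[OF PQ(1,2)] show "a * b \<in> adjoin C x" unfolding adjoin_def PQ(3,4)
      by (metis (mono_tags, lifting) mem_Collect_eq poly_mult)
  qed
qed

section \<open>Laurent polynomial functions\<close>

text \<open>\<open>nz (p v)\<close>, not \<open>p v\<close>, is the coordinate \<open>v\<close> of a point \<open>p\<close>.  It never vanishes, so that every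
  function \<open>p\<close> is a point of the torus and no partiality arises for negative exponents.\<close>

definition nz :: "'l::field \<Rightarrow> 'l" where "nz t = (if t = 0 then 1 else t)"

lemma nz_nonzero [simp]: "nz t \<noteq> 0" by (simp add: nz_def)
lemma nz_id [simp]: "t \<noteq> 0 \<Longrightarrow> nz t = t" by (simp add: nz_def)
lemma nz_1 [simp]: "nz 1 = 1" by (simp add: nz_def)
lemma nz_nz [simp]: "nz (nz t) = nz t" by (simp add: nz_def)

definition Mon :: "'v set \<Rightarrow> ('v \<Rightarrow> int) \<Rightarrow> ('v \<Rightarrow> 'l::field) \<Rightarrow> 'l" where
  "Mon V \<alpha> p = (\<Prod>v\<in>V. nz (p v) powi \<alpha> v)"

text \<open>Polynomial functions in the variables \<open>V\<close> with coefficients in \<open>C\<close> for \<open>E = {0..}\<close> (case S), Laurent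
  polynomial functions for \<open>E = UNIV\<close> (case L).\<close>

inductive_set Bset :: "'l::field set \<Rightarrow> int set \<Rightarrow> 'v set \<Rightarrow> (('v \<Rightarrow> 'l) \<Rightarrow> 'l) set"
  for C E V where
  Bset_zero: "0 \<in> Bset C E V"
| Bset_step: "f \<in> Bset C E V \<Longrightarrow> c \<in> C \<Longrightarrow> \<alpha> ` V \<subseteq> E \<Longrightarrow> (\<lambda>p. f p + c * Mon V \<alpha> p) \<in> Bset C E V"

lemma Bset_zero' [simp]: "(\<lambda>_. 0) \<in> Bset C E V"
  using Bset_zero[of C E V] by (simp add: zero_fun_def)

definition exponents :: "int set \<Rightarrow> bool" where "exponents E \<longleftrightarrow> E = UNIV \<or> E = {0..}"

lemma exponentsD:
  assumes "exponents E" shows "0 \<in> E" "1 \<in> E" "a \<in> E \<Longrightarrow> b \<in> E \<Longrightarrow> a + b \<in> E"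
    "0 \<le> a \<Longrightarrow> a \<in> E"
  using assms by (auto simp: exponents_def)

lemma Mon_add: "Mon V \<alpha> p * Mon V \<beta> p = Mon V (\<lambda>v. \<alpha> v + \<beta> v) p"
  by (simp add: Mon_def power_int_add prod.distrib)

lemma Mon_0 [simp]: "Mon V (\<lambda>_. 0) p = 1" by (simp add: Mon_def)

lemma Bset_add: "f \<in> Bset C E V \<Longrightarrow> g \<in> Bset C E V \<Longrightarrow> f + g \<in> Bset C E V"
proof (induction f rule: Bset.induct)
  case (Bset_step f c \<alpha>)
  from Bset.Bset_step[OF Bset_step.IH[OF Bset_step.prems] Bset_step.hyps(2,3)]
  show ?case by (simp add: plus_fun_def algebra_simps)
qed simp

lemma Bset_Mon: "c \<in> C \<Longrightarrow> \<alpha> ` V \<subseteq> E \<Longrightarrow> (\<lambda>p. c * Mon V \<alpha> p) \<in> Bset C E V"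
  using Bset_step[OF Bset_zero, of c C \<alpha> V E] by simp

lemma Bset_cMon_mult:
  assumes "is_subring C" "exponents E" "f \<in> Bset C E V" "c \<in> C" "\<alpha> ` V \<subseteq> E"
  shows "(\<lambda>p. c * Mon V \<alpha> p) * f \<in> Bset C E V"
  using assms(3)
proof (induction rule: Bset.induct)
  case (Bset_step f d \<beta>)
  have "(\<lambda>p. ((\<lambda>p. c * Mon V \<alpha> p) * f) p + (c * d) * Mon V (\<lambda>v. \<alpha> v + \<beta> v) p) \<in> Bset C E V"
    using Bset_step assms
    by (intro Bset.Bset_step) (auto simp: is_subringD(4) intro!: exponentsD(3))
  then show ?case by (simp add: times_fun_def Mon_add[symmetric] algebra_simps)
qed (auto intro: Bset.intros)

lemma Bset_const: "exponents E \<Longrightarrow> c \<in> C \<Longrightarrow> (\<lambda>_. c) \<in> Bset C E V"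
  using Bset_Mon[of c C "\<lambda>_. 0" V E] by (simp add: exponentsD(1) image_subset_iff)

lemma is_subring_Bset:
  assumes C: "is_subring C" and E: "exponents E" shows "is_subring (Bset C E V)"
proof -
  have m: "f * g \<in> Bset C E V" if "f \<in> Bset C E V" "g \<in> Bset C E V" for f g
    using that
  proof (induction f rule: Bset.induct)
    case Bset_zero
    then show ?case using Bset.Bset_zero by (simp only: mult_zero_left)
  next
    case (Bset_step f c \<alpha>)
    have "f * g + (\<lambda>p. c * Mon V \<alpha> p) * g \<in> Bset C E V"
      using Bset_step.IH[OF Bset_step.prems] Bset_step.prems Bset_step.hyps(2,3)
      by (intro Bset_add Bset_cMon_mult C E)
    also have "f * g + (\<lambda>p. c * Mon V \<alpha> p) * g = (\<lambda>p. f p + c * Mon V \<alpha> p) * g"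
      by (auto simp: algebra_simps)
    finally show ?case .
  qed
  have c: "(\<lambda>_. c) \<in> Bset C E V" if "c \<in> C" for c using Bset_const[OF E that] .
  have "f - g \<in> Bset C E V" if "f \<in> Bset C E V" "g \<in> Bset C E V" for f g
  proof -
    have "f + (\<lambda>_. -1) * g \<in> Bset C E V" using that
      by (intro Bset_add m c) (use is_subringD[OF C] in auto)
    also have "f + (\<lambda>_. -1) * g = f - g" by auto
    finally show ?thesis .
  qed
  with m c[of 1] show ?thesis by (auto simp: is_subring_def one_fun_def is_subringD(1)[OF C])
qed

lemma Bset_Xpow:
  assumes "is_subring C" "exponents E" "finite V" "v \<in> V" "a \<in> E"
  shows "(\<lambda>p. nz (p v) powi a) \<in> Bset C E V"
proof -
  have "(\<lambda>p. 1 * Mon V (\<lambda>w. if w = v then a else 0) p) \<in> Bset C E V"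
    using assms by (intro Bset_Mon) (auto simp: is_subringD exponentsD)
  moreover have "Mon V (\<lambda>w. if w = v then a else 0) p = nz (p v) powi a" for p :: "'b \<Rightarrow> 'a"
    using assms by (simp add: Mon_def if_distrib prod.delta cong: if_cong)
  ultimately show ?thesis by simp
qed

lemma Bset_X:
  assumes "is_subring C" "exponents E" "finite V" "v \<in> V"
  shows "(\<lambda>p. nz (p v)) \<in> Bset C E V"
  using Bset_Xpow[OF assms, of 1] exponentsD[OF assms(2)] by simp

text \<open>Covers renaming of variables, identification of two coordinates and specialisation to 1:
  each coordinate goes to a coordinate or to 1, so monomials go to monomials with exponents still in
  \<open>E\<close>.\<close>

lemma Bset_subst:
  fixes T :: "('w \<Rightarrow> 'l::field) \<Rightarrow> ('v \<Rightarrow> 'l)"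
  assumes C: "is_subring C" "exponents E" "finite V'" and f: "f \<in> Bset C E V"
    and T: "\<And>v. v \<in> V \<Longrightarrow> (\<exists>w\<in>V'. \<forall>p. nz (T p v) = nz (p w)) \<or> (\<forall>p. nz (T p v) = 1)"
  shows "(\<lambda>p. f (T p)) \<in> Bset C E V'"
  using f
proof (induction rule: Bset.induct)
  case Bset_zero
  then show ?case by (simp add: zero_fun_def[symmetric] Bset.intros)
next
  case (Bset_step f c \<alpha>)
  note R = is_subring_Bset[OF C(1,2), of V']
  have "(\<lambda>p. nz (T p v) powi \<alpha> v) \<in> Bset C E V'" if "v \<in> V" for v
    using T[OF that]
  proof
    assume "\<exists>w\<in>V'. \<forall>p. nz (T p v) = nz (p w)"
    then show ?thesis using Bset_Xpow[OF C, of _ "\<alpha> v"] Bset_step.hyps(3) that by auto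
  next
    assume "\<forall>p. nz (T p v) = 1"
    then show ?thesis using is_subringD(1)[OF R] by (simp add: one_fun_def)
  qed
  then have "(\<Prod>v\<in>V. (\<lambda>p. nz (T p v) powi \<alpha> v)) \<in> Bset C E V'"
    by (intro is_subring_prod R)
  moreover have "(\<Prod>v\<in>V. (\<lambda>p. nz (T p v) powi \<alpha> v)) = (\<lambda>p. Mon V \<alpha> (T p))"
  proof -
    have "(\<Prod>v\<in>A. (\<lambda>p. nz (T p v) powi \<alpha> v)) = (\<lambda>p. \<Prod>v\<in>A. nz (T p v) powi \<alpha> v)" for A
      by (induction A rule: infinite_finite_induct) (auto simp: one_fun_def times_fun_def)
    then show ?thesis by (simp add: Mon_def)
  qed
  ultimately have "(\<lambda>p. f (T p)) + (\<lambda>_. c) * (\<lambda>p. Mon V \<alpha> (T p)) \<in> Bset C E V'"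
    using Bset_step.IH Bset_const[OF C(2) Bset_step.hyps(2)] by (intro Bset_add is_subringD(4)[OF R]) auto
  then show ?case by (simp add: plus_fun_def times_fun_def)
qed

lemma Bset_coeff_mono: "C \<subseteq> C' \<Longrightarrow> f \<in> Bset C E V \<Longrightarrow> f \<in> Bset C' E V"
  by (rotate_tac, induction rule: Bset.induct) (auto intro: Bset.intros)

lemma Bset_mono:
  assumes "is_subring C" "exponents E" "finite V'" "V \<subseteq> V'" "f \<in> Bset C E V"
  shows "f \<in> Bset C E V'"
  using Bset_subst[OF assms(1-3,5), of "\<lambda>p. p"] assms(4) by auto

lemma Bset_local:
  assumes "f \<in> Bset C E V" "\<And>v. v \<in> V \<Longrightarrow> nz (p v) = nz (q v)" shows "f p = f q"
  using assms(1)
proof (induction rule: Bset.induct)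
  case (Bset_step f c \<alpha>)
  have "Mon V \<alpha> p = Mon V \<alpha> q" unfolding Mon_def using assms(2) by (intro prod.cong) auto
  with Bset_step show ?case by simp
qed simp

section \<open>Vanishing at generic points\<close>

lemma power_int_poly: "\<exists>N P. \<forall>t::'l::field. t \<noteq> 0 \<longrightarrow> t ^ N * (t powi a) = poly P t"
proof (cases "a \<ge> 0")
  case True
  then show ?thesis by (intro exI[of _ 0] exI[of _ "monom 1 (nat a)"]) (simp add: poly_monom power_int_def)
next
  case False
  then show ?thesis
    by (intro exI[of _ "nat (- a)"] exI[of _ 1]) (simp add: power_int_def power_inverse)
qed

text \<open>A power of \<open>t\<close> clears the negative exponents, which makes root counting for
  polynomials available in each coordinate separately.\<close>

lemma Bset_one_variable:
  fixes f :: "('v \<Rightarrow> 'l::field) \<Rightarrow> 'l"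
  assumes "f \<in> Bset C E V" "finite V"
  shows "\<exists>N P. \<forall>t. t \<noteq> 0 \<longrightarrow> t ^ N * f (p(v := t)) = poly P t"
  using assms(1)
proof (induction rule: Bset.induct)
  case Bset_zero
  then show ?case by (intro exI[of _ 0]) auto
next
  case (Bset_step f c \<alpha>)
  then obtain N P where NP: "\<And>t. t \<noteq> 0 \<Longrightarrow> t ^ N * f (p(v := t)) = poly P t" by blast
  obtain M Q where MQ: "\<And>t::'l. t \<noteq> 0 \<Longrightarrow> t ^ M * (t powi \<alpha> v) = poly Q t"
    using power_int_poly[of "\<alpha> v"] by auto
  define d where "d = Mon (V - {v}) \<alpha> p"
  have Mon: "Mon V \<alpha> (p(v := t)) = d * (if v \<in> V then t powi \<alpha> v else 1)" if "t \<noteq> 0" for t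
  proof -
    have "(\<Prod>w\<in>V - {v}. nz ((p(v := t)) w) powi \<alpha> w) = d"
      unfolding d_def Mon_def by (intro prod.cong) auto
    then show ?thesis using that assms(2)
      by (cases "v \<in> V") (simp_all add: Mon_def prod.remove del: fun_upd_apply, simp_all)
  qed
  let ?R = "monom 1 M * P + monom 1 N * smult (c * d) (if v \<in> V then Q else monom 1 M)"
  have "t ^ (M + N) * (f (p(v := t)) + c * Mon V \<alpha> (p(v := t))) = poly ?R t" if "t \<noteq> 0" for t
  proof -
    have "t ^ (M + N) * (f (p(v := t)) + c * Mon V \<alpha> (p(v := t))) =
       t ^ M * (t ^ N * f (p(v := t))) + t ^ N * (c * d * (t ^ M * (if v \<in> V then t powi \<alpha> v else 1)))"
      using Mon[OF that] by (simp add: algebra_simps power_add)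
    also have "\<dots> = poly ?R t" using that by (auto simp: NP MQ poly_monom)
    finally show ?thesis .
  qed
  then show ?case by blast
qed

lemma Bset_cofinite_zero:
  fixes f :: "('v \<Rightarrow> 'l::field_char_0) \<Rightarrow> 'l"
  assumes f: "f \<in> Bset C E V" "finite V" and "finite F"
    and z: "\<And>t. t \<noteq> 0 \<Longrightarrow> t \<notin> F \<Longrightarrow> f (p(v := t)) = 0" and "t \<noteq> 0"
  shows "f (p(v := t)) = 0"
proof -
  obtain N P where NP: "\<And>t. t \<noteq> 0 \<Longrightarrow> t ^ N * f (p(v := t)) = poly P t"
    using Bset_one_variable[OF f] by blast
  have "infinite (UNIV - ({0} \<union> F))"
    using \<open>finite F\<close> infinite_UNIV_char_0 by (metis Diff_infinite_finite finite.emptyI finite.insertI finite_UnI)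
  moreover have "UNIV - ({0} \<union> F) \<subseteq> {t. poly P t = 0}" using z NP by force
  ultimately have "P = 0" using poly_roots_finite[of P] finite_subset by blast
  with NP[OF \<open>t \<noteq> 0\<close>] \<open>t \<noteq> 0\<close> show ?thesis by simp
qed

text \<open>The requirement of distinct coordinates is dropped one variable at a time: for fixed
  other coordinates it excludes only finitely many values. Identities with denominators such as
  \<open>x\<^sub>i - x\<^sub>l\<close> can thus be checked where the denominators are
  nonzero.\<close>

lemma Bset_density:
  fixes f :: "('v \<Rightarrow> 'l::field_char_0) \<Rightarrow> 'l"
  assumes f: "f \<in> Bset C E V" "finite V" and U: "finite U"
    and z: "\<And>p. inj_on (\<lambda>v. nz (p v)) U \<Longrightarrow> f p = 0"
  shows "f p = 0"
proof -
  have "\<forall>p. inj_on (\<lambda>v. nz (p v)) U \<longrightarrow> f p = 0" using z by blast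
  with U have "\<forall>p. f p = 0"
  proof (induction U rule: finite_induct)
    case (insert v U)
    have "f p = 0" if inj: "inj_on (\<lambda>v. nz (p v)) U" for p
    proof -
      have "f (p(v := t)) = 0" if "t \<noteq> 0" "t \<notin> (\<lambda>v. nz (p v)) ` U" for t
      proof -
        have "inj_on (\<lambda>w. nz ((p(v := t)) w)) (insert v U)"
          using that insert.hyps(2) inj by (auto simp: inj_on_def)
        with insert.prems show ?thesis by blast
      qed
      from Bset_cofinite_zero[OF f _ this, of "(\<lambda>v. nz (p v)) ` U" "nz (p v)"]
      have "f (p(v := nz (p v))) = 0" using insert.hyps(1) by (simp del: fun_upd_apply)
      also have "f (p(v := nz (p v))) = f p" by (rule Bset_local[OF f(1)]) auto
      finally show ?thesis .
    qed
    with insert.IH show ?case by blast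
  qed auto
  then show ?thesis by blast
qed

section \<open>Division by differences of variables\<close>

lemma power_int_diff_factor:
  assumes C: "is_subring C" "exponents E" "finite V" "v \<in> V" "w \<in> V" "a \<in> E"
  shows "\<exists>q\<in>Bset C E V. \<forall>p. nz (p v) powi a - nz (p w) powi a = (nz (p v) - nz (p w)) * q p"
proof -
  note R = is_subring_Bset[OF C(1,2), of V] and X = Bset_Xpow[OF C(1-3)]
  have nat: "\<exists>q\<in>Bset C E V. \<forall>p. nz (p v) ^ k - nz (p w) ^ k = (nz (p v) - nz (p w)) * q p" for k
  proof (induction k)
    case 0
    then show ?case by (intro bexI[of _ 0] is_subringD(2)[OF R]) auto
  next
    case (Suc k)
    then obtain q where q: "q \<in> Bset C E V"
      "\<And>p. nz (p v) ^ k - nz (p w) ^ k = (nz (p v) - nz (p w)) * q p" by blast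
    have "(\<lambda>p. nz (p v) powi 1) * q + (\<lambda>p. nz (p w) powi int k) \<in> Bset C E V"
      using C by (intro is_subringD(4,6)[OF R] q X) (auto intro: exponentsD)
    moreover have "nz (p v) ^ Suc k - nz (p w) ^ Suc k = (nz (p v) - nz (p w)) *
        ((\<lambda>p. nz (p v) powi 1) * q + (\<lambda>p. nz (p w) powi int k)) p" for p
    proof -
      have "nz (p v) ^ Suc k - nz (p w) ^ Suc k =
        nz (p v) * (nz (p v) ^ k - nz (p w) ^ k) + (nz (p v) - nz (p w)) * nz (p w) ^ k"
        by (simp add: algebra_simps)
      then show ?thesis unfolding q(2) by (simp add: algebra_simps)
    qed
    ultimately show ?case by blast
  qed
  show ?thesis
  proof (cases "a \<ge> 0")
    case True
    then show ?thesis using nat[of "nat a"] by (simp add: power_int_def)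
  next
    case False
    with C have E: "E = UNIV" by (auto simp: exponents_def)
    obtain q where q: "q \<in> Bset C E V"
      "\<And>p. nz (p v) ^ nat (-a) - nz (p w) ^ nat (-a) = (nz (p v) - nz (p w)) * q p"
      using nat by blast
    \<comment> \<open>With k = -a this is x^(-k) - y^(-k) = -(x^k - y^k) x^(-k) y^(-k); the negative
      powers are available because \<open>E = UNIV\<close> here.\<close>
    have "- (q * ((\<lambda>p. nz (p v) powi a) * (\<lambda>p. nz (p w) powi a))) \<in> Bset C E V"
      using C by (intro is_subringD(4,5)[OF R] q X) (auto simp: E)
    moreover have "nz (p v) powi a - nz (p w) powi a = (nz (p v) - nz (p w)) *
        (- (q * ((\<lambda>p. nz (p v) powi a) * (\<lambda>p. nz (p w) powi a)))) p" for p
    proof -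
      have i: "nz (p v) powi a = inverse (nz (p v) ^ nat (-a))" "nz (p w) powi a = inverse (nz (p w) ^ nat (-a))"
        using False by (simp_all add: power_int_def power_inverse)
      have "nz (p v) powi a - nz (p w) powi a =
        - ((nz (p v) ^ nat (-a) - nz (p w) ^ nat (-a)) * (nz (p v) powi a * nz (p w) powi a))"
        unfolding i by (simp add: field_simps)
      then show ?thesis unfolding q(2) by simp
    qed
    ultimately show ?thesis by blast
  qed
qed

lemma Bset_diff_factor:
  fixes f :: "('v \<Rightarrow> 'l::field) \<Rightarrow> 'l"
  assumes C: "is_subring C" "exponents E" "finite V" "v \<in> V" "w \<in> V" and f: "f \<in> Bset C E V"
  shows "\<exists>q\<in>Bset C E V. \<forall>p. f p - f (p(v := p w)) = (nz (p v) - nz (p w)) * q p"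
  using f
proof (induction rule: Bset.induct)
  case Bset_zero
  then show ?case by (intro bexI[of _ 0] Bset.Bset_zero) auto
next
  case (Bset_step f c \<alpha>)
  note R = is_subring_Bset[OF C(1,2), of V]
  obtain q where q: "q \<in> Bset C E V" "\<And>p. f p - f (p(v := p w)) = (nz (p v) - nz (p w)) * q p"
    using Bset_step.IH by blast
  obtain r where r: "r \<in> Bset C E V"
    "\<And>p. nz (p v) powi \<alpha> v - nz (p w) powi \<alpha> v = (nz (p v) - nz (p w)) * r p"
    using power_int_diff_factor[OF C, of "\<alpha> v"] Bset_step.hyps(3) C(4) by blast
  have M: "(\<lambda>p. c * Mon (V - {v}) \<alpha> p) \<in> Bset C E V"
    using Bset_step.hyps C by (intro Bset_mono[of C E V "V - {v}"] Bset_Mon) auto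
  have Mon: "Mon V \<alpha> p = nz (p v) powi \<alpha> v * Mon (V - {v}) \<alpha> p" for p :: "'v \<Rightarrow> 'l"
    unfolding Mon_def using C by (subst prod.remove[of V v]) auto
  have Mon': "Mon (V - {v}) \<alpha> (p(v := t)) = Mon (V - {v}) \<alpha> p" for p :: "'v \<Rightarrow> 'l" and t
    unfolding Mon_def by (intro prod.cong) auto
  have "q + (\<lambda>p. c * Mon (V - {v}) \<alpha> p) * r \<in> Bset C E V"
    using q(1) r(1) M by (intro is_subringD(4,6)[OF R])
  moreover have "f p + c * Mon V \<alpha> p - (f (p(v := p w)) + c * Mon V \<alpha> (p(v := p w))) =
    (nz (p v) - nz (p w)) * (q + (\<lambda>p. c * Mon (V - {v}) \<alpha> p) * r) p" for p
  proof -
    have "f p + c * Mon V \<alpha> p - (f (p(v := p w)) + c * Mon V \<alpha> (p(v := p w))) =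
      (f p - f (p(v := p w))) + c * Mon (V - {v}) \<alpha> p * (nz (p v) powi \<alpha> v - nz (p w) powi \<alpha> v)"
      by (simp add: Mon Mon' algebra_simps)
    also have "\<dots> = (nz (p v) - nz (p w)) * (q + (\<lambda>p. c * Mon (V - {v}) \<alpha> p) * r) p"
      unfolding q(2) r(2) by (simp add: algebra_simps)
    finally show ?thesis .
  qed
  ultimately show ?case by blast
qed

text \<open>The factors are split off one at a time. On the locus where \<open>v\<close> and
  \<open>w\<close> agree, \<open>f\<close> vanishes while the factors already removed are
  generically nonzero, so by density the current quotient vanishes there, and
  \<open>Bset_diff_factor\<close> extracts the next factor.\<close>

lemma Bset_divide:
  fixes f :: "('v \<Rightarrow> 'l::field_char_0) \<Rightarrow> 'l"
  assumes C: "is_subring C" "exponents E" "finite V" and f: "f \<in> Bset C E V"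
    and S: "finite S" "S \<subseteq> I \<times> J" "I \<subseteq> V" "J \<subseteq> V" "I \<inter> J = {}"
    and z: "\<And>p v w. (v, w) \<in> S \<Longrightarrow> nz (p v) = nz (p w) \<Longrightarrow> f p = 0"
  shows "\<exists>b\<in>Bset C E V. \<forall>p. f p = (\<Prod>(v,w)\<in>S. nz (p v) - nz (p w)) * b p"
  using S(1,2) z
proof (induction S rule: finite_induct)
  case empty
  then show ?case using f by auto
next
  case (insert e S)
  obtain v w where e: "e = (v, w)" by force
  from insert obtain b where b: "b \<in> Bset C E V"
    "\<And>p. f p = (\<Prod>(v,w)\<in>S. nz (p v) - nz (p w)) * b p"
    by (metis insertCI insert_subset)
  have vw: "v \<in> I" "w \<in> J" "v \<in> V" "w \<in> V" using insert.prems(1) S e by auto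
  let ?b' = "\<lambda>p. b (p(v := p w))"
  have "?b' \<in> Bset C E V"
    using vw by (intro Bset_subst[OF C b(1)]) auto
  then have b0: "b (p(v := p w)) = 0" for p
  proof (rule Bset_density[OF _ C(3) C(3)])
    fix p :: "'v \<Rightarrow> 'l" assume inj: "inj_on (\<lambda>v. nz (p v)) V"
    let ?p = "p(v := p w)"
    have "f ?p = 0" by (rule insert.prems(2)[of v w]) (use e in auto)
    moreover have "(\<Prod>(v,w)\<in>S. nz (?p v) - nz (?p w)) \<noteq> 0"
    proof -
      \<comment> \<open>Overwriting coordinate \<open>v\<close> leaves \<open>w'\<close> alone
        because \<open>I\<close> and \<open>J\<close> are disjoint; it affects \<open>v'\<close>
        only if \<open>v' = v\<close>, and then \<open>w'\<close> differs from \<open>w\<close>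
        since \<open>(v, w)\<close> is not in \<open>S\<close>.\<close>
      have "nz (?p v') - nz (?p w') \<noteq> 0" if "(v', w') \<in> S" for v' w'
      proof -
        have vw': "v' \<in> I" "w' \<in> J" using that insert.prems(1) by auto
        have "w' \<noteq> v" using vw vw' S by auto
        moreover have "v' = v \<Longrightarrow> w \<noteq> w'" using that insert.hyps e by auto
        moreover have "v' \<noteq> w'" using vw' S by auto
        ultimately show ?thesis using inj vw vw' S by (auto simp: inj_on_def subset_eq)
      qed
      then show ?thesis using insert.hyps(1) by auto
    qed
    ultimately show "b ?p = 0" using b(2) by simp
  qed
  obtain q where q: "q \<in> Bset C E V" "\<And>p. b p - b (p(v := p w)) = (nz (p v) - nz (p w)) * q p"
    using Bset_diff_factor[OF C _ _ b(1)] vw by blast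
  have "f p = (\<Prod>(v,w)\<in>insert e S. nz (p v) - nz (p w)) * q p" for p
    using insert.hyps e b(2)[of p] q(2)[of p] b0[of p] by simp
  with q(1) show ?case by blast
qed

text \<open>A new variable amounts to adjoining its coordinate function, and in the Laurent case
  also the inverse of it, so the Hilbert basis theorem is applied once or twice per
  variable.\<close>

lemma noeth_Bset:
  fixes C :: "'l::field_char_0 set" and V :: "'v set"
  assumes C: "is_subring C" "noeth C" and E: "exponents E" and V: "finite V"
  shows "noeth (Bset C E V)"
  using V
proof (induction V rule: finite_induct)
  case empty
  have "Bset C E {} = (\<lambda>c (_::'v \<Rightarrow> 'l). c) ` C"
  proof (intro equalityI subsetI)
    fix f :: "('v \<Rightarrow> 'l) \<Rightarrow> 'l" assume "f \<in> Bset C E {}"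
    then show "f \<in> (\<lambda>c _. c) ` C"
    proof (induction rule: Bset.induct)
      case Bset_zero
      then show ?case using C by (auto simp: is_subringD zero_fun_def image_iff)
    next
      case (Bset_step f c \<alpha>)
      then obtain d where "d \<in> C" "f = (\<lambda>_. d)" by auto
      then show ?case using C Bset_step.hyps by (auto simp: is_subringD Mon_def image_iff)
    qed
  qed (use Bset_const[OF E] in auto)
  then show ?case using noeth_hom[OF C(2), of "\<lambda>c (_::'v \<Rightarrow> 'l). c"] by (simp add: fun_eq_iff)
next
  case (insert v V)
  let ?D = "Bset C E V" and ?X = "\<lambda>p::'v \<Rightarrow> 'l. nz (p v)" and ?Y = "\<lambda>p::'v \<Rightarrow> 'l. nz (p v) powi (-1)"
  note R = is_subring_Bset[OF C(1) E]
  have RV: "is_subring ?D" by (rule R)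
  define D' where "D' = (if E = UNIV then adjoin (adjoin ?D ?X) ?Y else adjoin ?D ?X)"
  have R': "is_subring D'" and N': "noeth D'" and DD': "?D \<subseteq> D'" and XD: "?X \<in> D'"
    using adjoin_incl[OF RV, of ?X] adjoin_incl[OF adjoin_incl(3)[OF RV, of ?X], of ?Y]
      noeth_adjoin[OF RV insert.IH, of ?X] noeth_adjoin[OF adjoin_incl(3)[OF RV], of ?X ?Y]
    by (auto simp: D'_def)
  have YD: "?Y \<in> D'" if "E = UNIV" using that adjoin_incl(2)[OF adjoin_incl(3)[OF RV]] by (simp add: D'_def)
  have pw: "(\<lambda>p. nz (p v) powi a) \<in> D'" if "a \<in> E" for a
  proof (cases "a \<ge> 0")
    case True
    have "?X ^ k = (\<lambda>p::'v \<Rightarrow> 'l. nz (p v) ^ k)" for k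
      by (induction k) (simp_all add: fun_eq_iff)
    then show ?thesis using True is_subring_power[OF R' XD, of "nat a"] by (simp add: power_int_def)
  next
    case False
    with that E have "E = UNIV" by (auto simp: exponents_def)
    moreover have "?Y ^ k = (\<lambda>p::'v \<Rightarrow> 'l. inverse (nz (p v) ^ k))" for k
      by (induction k) (simp_all add: fun_eq_iff power_int_minus)
    ultimately show ?thesis using is_subring_power[OF R' YD, of "nat (-a)"] False
      by (simp add: power_int_def power_inverse)
  qed
  have "D' = Bset C E (insert v V)"
  proof (intro equalityI subsetI)
    fix f assume "f \<in> Bset C E (insert v V)"
    then show "f \<in> D'"
    proof (induction rule: Bset.induct)
      case (Bset_step f c \<alpha>)
      have "f + (\<lambda>p. c * Mon V \<alpha> p) * (\<lambda>p. nz (p v) powi \<alpha> v) \<in> D'"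
        using Bset_step DD' Bset_Mon[of c C \<alpha> V E] by (intro is_subringD(4,6)[OF R'] pw) auto
      then show ?case using insert.hyps
        by (simp add: Mon_def plus_fun_def times_fun_def mult_ac)
    qed (simp add: zero_fun_def[symmetric] is_subringD(2)[OF R'])
  next
    have R1: "is_subring (Bset C E (insert v V))" by (rule R)
    have 1: "?D \<subseteq> Bset C E (insert v V)" 
      by (intro subsetI, rule Bset_mono[OF C(1) E, where V = V]) (use insert.hyps in auto)
    have 2: "?X \<in> Bset C E (insert v V)" 
      by (rule Bset_X[OF C(1) E]) (use insert.hyps in auto)
    have 3: "E = UNIV \<Longrightarrow> ?Y \<in> Bset C E (insert v V)"
      by (rule Bset_Xpow[OF C(1) E]) (use insert.hyps in auto)
    fix f assume "f \<in> D'"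
    then show "f \<in> Bset C E (insert v V)"
      using adjoin_subset[OF R1 1 2] adjoin_subset[OF R1 adjoin_subset[OF R1 1 2] 3]
      by (auto simp: D'_def split: if_splits)
  qed
  with N' show ?case by simp
qed

section \<open>Divided differences and Vandermonde determinants\<close>

text \<open>Lagrange form of the divided difference of the function t^a times the product of all t -
  \<open>r j\<close>, at the nodes \<open>r i\<close>. The index sets are parameters because the x
  and y variables also occur with exchanged roles.\<close>

definition gsum :: "'v set \<Rightarrow> 'v set \<Rightarrow> int \<Rightarrow> ('v \<Rightarrow> 'l::field) \<Rightarrow> 'l" where
  "gsum I J a r = (\<Sum>i\<in>I. r i powi a * (\<Prod>j\<in>J. r i - r j) / (\<Prod>l\<in>I - {i}. r i - r l))"

lemma gsum_cong: "(\<And>v. v \<in> I \<union> J \<Longrightarrow> r v = r' v) \<Longrightarrow> gsum I J a r = gsum I J a r'"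
  unfolding gsum_def
  by (intro sum.cong arg_cong2[where f = "(/)"] arg_cong2[where f = "(*)"] prod.cong) auto

lemma gsum_permute:
  assumes "bij_betw \<pi> I I" "bij_betw \<pi> J J"
  shows "gsum I J a (\<lambda>v. r (\<pi> v)) = gsum I J a r"
proof -
  have "gsum I J a r = (\<Sum>i\<in>I. r (\<pi> i) powi a * (\<Prod>j\<in>J. r (\<pi> i) - r j) / (\<Prod>l\<in>I - {\<pi> i}. r (\<pi> i) - r l))"
    unfolding gsum_def by (rule sum.reindex_bij_betw[OF assms(1), symmetric])
  also have "\<dots> = gsum I J a (\<lambda>v. r (\<pi> v))"
    unfolding gsum_def
  proof (intro sum.cong refl arg_cong2[where f = "(/)"] arg_cong2[where f = "(*)"])
    fix i assume "i \<in> I"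
    show "(\<Prod>j\<in>J. r (\<pi> i) - r j) = (\<Prod>j\<in>J. r (\<pi> i) - r (\<pi> j))"
      by (rule prod.reindex_bij_betw[OF assms(2), symmetric])
    have "bij_betw \<pi> (I - {i}) (I - {\<pi> i})"
      using assms(1) \<open>i \<in> I\<close> by (auto simp: bij_betw_def inj_on_def)
    from prod.reindex_bij_betw[OF this, of "\<lambda>l. r (\<pi> i) - r l", symmetric]
    show "(\<Prod>l\<in>I - {\<pi> i}. r (\<pi> i) - r l) = (\<Prod>l\<in>I - {i}. r (\<pi> i) - r (\<pi> l))" .
  qed
  finally show ?thesis by simp
qed

text \<open>The summand of a node in \<open>I'\<close> contains the zero factor
  \<open>r i - r (h i)\<close>; in the other summands the factors from \<open>J'\<close> cancel the
  denominators from \<open>I'\<close>. This is why the function is supersymmetric and stable under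
  specialisation of pairs.\<close>

lemma gsum_cancel:
  fixes r :: "'v \<Rightarrow> 'l::field"
  assumes fin: "finite I" "finite J" "finite I'" "finite J'"
    and disj: "I \<inter> I' = {}" "J \<inter> J' = {}"
    and h: "bij_betw h I' J'" "\<And>i. i \<in> I' \<Longrightarrow> r (h i) = r i" and inj: "inj_on r (I \<union> I')"
  shows "gsum (I \<union> I') (J \<union> J') a r = gsum I J a r"
proof -
  have "gsum (I \<union> I') (J \<union> J') a r =
    (\<Sum>i\<in>I. r i powi a * (\<Prod>j\<in>J \<union> J'. r i - r j) / (\<Prod>l\<in>I \<union> I' - {i}. r i - r l))"
    unfolding gsum_def
  proof (intro sum.mono_neutral_right ballI)
    fix i assume "i \<in> I \<union> I' - I"
    then have i: "i \<in> I'" by auto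
    then have "h i \<in> J \<union> J'" "r i - r (h i) = 0" using h bij_betwE by fastforce+
    then have "(\<Prod>j\<in>J \<union> J'. r i - r j) = 0" using fin by (metis finite_UnI prod_zero)
    then show "r i powi a * (\<Prod>j\<in>J \<union> J'. r i - r j) / (\<Prod>l\<in>I \<union> I' - {i}. r i - r l) = 0" by simp
  qed (use fin in auto)
  also have "\<dots> = gsum I J a r"
    unfolding gsum_def
  proof (intro sum.cong refl)
    fix i assume i: "i \<in> I"
    have 1: "(\<Prod>j\<in>J \<union> J'. r i - r j) = (\<Prod>j\<in>J. r i - r j) * (\<Prod>l\<in>I'. r i - r l)"
    proof -
      have "(\<Prod>j\<in>J'. r i - r j) = (\<Prod>l\<in>I'. r i - r (h l))"
        by (rule prod.reindex_bij_betw[OF h(1), symmetric])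
      also have "\<dots> = (\<Prod>l\<in>I'. r i - r l)" using h(2) by (intro prod.cong) auto
      finally show ?thesis using fin disj by (simp add: prod.union_disjoint)
    qed
    have e: "I \<union> I' - {i} = (I - {i}) \<union> I'" using i disj by auto
    have 2: "(\<Prod>l\<in>I \<union> I' - {i}. r i - r l) = (\<Prod>l\<in>I - {i}. r i - r l) * (\<Prod>l\<in>I'. r i - r l)"
      unfolding e using fin disj by (intro prod.union_disjoint) auto
    have "(\<Prod>l\<in>I'. r i - r l) \<noteq> 0"
      using inj i disj fin by (auto simp: inj_on_def)
    then show "r i powi a * (\<Prod>j\<in>J \<union> J'. r i - r j) / (\<Prod>l\<in>I \<union> I' - {i}. r i - r l) =
        r i powi a * (\<Prod>j\<in>J. r i - r j) / (\<Prod>l\<in>I - {i}. r i - r l)"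
      unfolding 1 2 by simp
  qed
  finally show ?thesis .
qed

lemma partial_fraction_step:
  fixes x :: "'l::field"
  assumes "x \<noteq> u" "x \<noteq> v" "u \<noteq> v"
  shows "(F / (P * (x - u)) - F / (P * (x - v))) = (u - v) * (F / (P * ((x - u) * (x - v))))"
proof (cases "P = 0")
  case False
  with assms show ?thesis by (simp add: divide_simps) (simp add: algebra_simps)
qed simp

text \<open>The recursion of divided differences. The node \<open>v\<close> is simulated by
  overwriting the value at \<open>u\<close>, which gives the left side the shape that
  \<open>Bset_diff_factor\<close> divides by the difference of two coordinates.\<close>

lemma gsum_divided_difference:
  fixes r :: "'v \<Rightarrow> 'l::field"
  assumes fin: "finite I" and uv: "u \<notin> I" "v \<notin> I" "u \<noteq> v" "u \<notin> J" "v \<notin> J" and J: "J \<inter> I = {}"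
    and inj: "inj_on r (insert u (insert v I))"
  shows "gsum (insert u I) J a r - gsum (insert u I) J a (r(u := r v)) =
     (r u - r v) * gsum (insert u (insert v I)) J a r"
proof -
  define F where "F = (\<lambda>i. r i powi a * (\<Prod>j\<in>J. r i - r j))"
  define P where "P = (\<lambda>i. \<Prod>l\<in>I - {i}. r i - r l)"
  have neq: "r u \<noteq> r v" "\<And>i. i \<in> I \<Longrightarrow> r i \<noteq> r u" "\<And>i. i \<in> I \<Longrightarrow> r i \<noteq> r v"
    using inj uv by (auto simp: inj_on_def)
  have iu: "insert u I - {i} = insert u (I - {i})" "insert u (insert v I) - {i} = insert u (insert v (I - {i}))"
    if "i \<in> I" for i using that uv by auto
  have A: "gsum (insert u I) J a r = F u / P u + (\<Sum>i\<in>I. F i / (P i * (r i - r u)))"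
  proof -
    have "gsum (insert u I) J a r = F u / P u + (\<Sum>i\<in>I. F i / (\<Prod>l\<in>insert u I - {i}. r i - r l))"
      unfolding gsum_def F_def P_def using fin uv by (simp add: insert_Diff_if)
    also have "(\<Sum>i\<in>I. F i / (\<Prod>l\<in>insert u I - {i}. r i - r l)) = (\<Sum>i\<in>I. F i / (P i * (r i - r u)))"
      unfolding P_def using fin uv by (intro sum.cong refl) (simp add: iu mult.commute)
    finally show ?thesis .
  qed
  have B: "gsum (insert u I) J a (r(u := r v)) = F v / P v + (\<Sum>i\<in>I. F i / (P i * (r i - r v)))"
  proof -
    let ?r = "r(u := r v)"
    have J': "(\<Prod>j\<in>J. c - ?r j) = (\<Prod>j\<in>J. c - r j)" for c using uv by (intro prod.cong) auto
    have I': "(\<Prod>l\<in>I - A. c - ?r l) = (\<Prod>l\<in>I - A. c - r l)" for c A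
      using uv by (intro prod.cong) auto
    have r: "?r i = r i" if "i \<in> I" for i using that uv by auto
    have "gsum (insert u I) J a ?r = F v / P v + (\<Sum>i\<in>I. F i / (\<Prod>l\<in>insert u I - {i}. r i - ?r l))"
    proof -
      have "insert u I - {u} = I" "?r u = r v" and Iv: "I - {v} = I" using uv by auto
      moreover have "(\<Prod>j\<in>I. r v - ?r j) = (\<Prod>j\<in>I. r v - r j)" using I'[of _ "{}"] by simp
      moreover have "(\<Sum>i\<in>I. ?r i powi a * (\<Prod>j\<in>J. ?r i - ?r j) / (\<Prod>l\<in>insert u I - {i}. ?r i - ?r l))
        = (\<Sum>i\<in>I. F i / (\<Prod>l\<in>insert u I - {i}. r i - ?r l))"
        by (intro sum.cong refl) (simp only: r J' F_def)
      ultimately show ?thesis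
        unfolding gsum_def F_def P_def using fin uv by (subst sum.insert) (simp_all only: J' Iv Diff_insert_absorb not_False_eq_True)
    qed
    also have "(\<Sum>i\<in>I. F i / (\<Prod>l\<in>insert u I - {i}. r i - ?r l)) = (\<Sum>i\<in>I. F i / (P i * (r i - r v)))"
      unfolding P_def using fin uv by (intro sum.cong refl) (simp add: iu I' mult.commute fun_upd_same del: fun_upd_apply)
    finally show ?thesis .
  qed
  have D: "gsum (insert u (insert v I)) J a r = F u / ((r u - r v) * P u) + F v / ((r v - r u) * P v) +
      (\<Sum>i\<in>I. F i / (P i * ((r i - r u) * (r i - r v))))"
  proof -
    have "insert u (insert v I) - {v} = insert u I" "insert u (insert v I) - {u} = insert v I" using uv by auto
    then have "gsum (insert u (insert v I)) J a r = F u / ((r u - r v) * P u) + F v / ((r v - r u) * P v) +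
       (\<Sum>i\<in>I. F i / (\<Prod>l\<in>insert u (insert v I) - {i}. r i - r l))"
      unfolding gsum_def F_def P_def using fin uv by simp
    also have "(\<Sum>i\<in>I. F i / (\<Prod>l\<in>insert u (insert v I) - {i}. r i - r l)) =
       (\<Sum>i\<in>I. F i / (P i * ((r i - r u) * (r i - r v))))"
      unfolding P_def using fin uv by (intro sum.cong refl) (simp add: iu mult_ac)
    finally show ?thesis .
  qed
  have "(\<Sum>i\<in>I. F i / (P i * (r i - r u))) - (\<Sum>i\<in>I. F i / (P i * (r i - r v))) =
    (r u - r v) * (\<Sum>i\<in>I. F i / (P i * ((r i - r u) * (r i - r v))))"
    unfolding sum_subtractf[symmetric] sum_distrib_left
    using neq by (intro sum.cong refl partial_fraction_step) auto
  moreover have "(r u - r v) * (F u / ((r u - r v) * P u)) = F u / P u"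
    "(r u - r v) * (F v / ((r v - r u) * P v)) = - (F v / P v)"
  proof -
    show "(r u - r v) * (F u / ((r u - r v) * P u)) = F u / P u" using neq by simp
    have "F v / ((r v - r u) * P v) = - (F v / ((r u - r v) * P v))"
      by (metis minus_diff_eq minus_divide_right mult_minus_left)
    then show "(r u - r v) * (F v / ((r v - r u) * P v)) = - (F v / P v)" using neq by simp
  qed
  ultimately show ?thesis unfolding A B D by (simp add: algebra_simps)
qed

text \<open>Each step of the divided difference recursion is an exact division in
  \<open>Bset\<close>. At points with repeated nodes \<open>gsum\<close> contains divisions by zero
  and has no meaning; there \<open>G\<close> is its continuation.\<close>

lemma gsum_polynomial:
  assumes C: "is_subring C" "exponents E" "finite V" and "a \<in> E"
    and IJ: "I \<subseteq> V" "J \<subseteq> V" "I \<inter> J = {}"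
  shows "\<exists>G\<in>Bset C E V. \<forall>p :: 'v \<Rightarrow> 'l::field. inj_on (\<lambda>v. nz (p v)) I \<longrightarrow> G p = gsum I J a (\<lambda>v. nz (p v))"
  using IJ
proof (induction "card I" arbitrary: I rule: less_induct)
  case less
  note R = is_subring_Bset[OF C(1,2), of V]
  have fin: "finite I" using less.prems C(3) finite_subset by blast
  consider "I = {}" | u where "I = {u}" | u v I' where "I = insert u (insert v I')" "u \<noteq> v" "u \<notin> I'" "v \<notin> I'"
    by (metis insertCI mk_disjoint_insert all_not_in_conv)
  then show ?case
  proof cases
    case 1
    then show ?thesis by (intro bexI[of _ 0] Bset_zero) (auto simp: gsum_def)
  next
    case (2 u)
    have "(\<lambda>p. nz (p u) powi a) * (\<Prod>j\<in>J. (\<lambda>p. nz (p u)) - (\<lambda>p. nz (p j))) \<in> Bset C E V"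
      using less.prems 2 assms
      by (intro is_subringD(3,4)[OF R] is_subring_prod[OF R] Bset_X Bset_Xpow) auto
    moreover have "((\<lambda>p. nz (p u) powi a) * (\<Prod>j\<in>J. (\<lambda>p. nz (p u)) - (\<lambda>p. nz (p j)))) p = gsum I J a (\<lambda>v. nz (p v))"
      for p :: "'v \<Rightarrow> 'l"
    proof -
      have "(\<Prod>j\<in>J. (\<lambda>p. nz (p u)) - (\<lambda>p. nz (p j))) p = (\<Prod>j\<in>J. nz (p u) - nz (p j))"
        by (induction J rule: infinite_finite_induct) auto
      then show ?thesis by (simp add: gsum_def 2)
    qed
    ultimately show ?thesis by blast
  next
    case (3 u v I')
    have "card (insert u I') < card I" using 3 fin by simp
    moreover have "insert u I' \<subseteq> V" "insert u I' \<inter> J = {}" using less.prems 3 by auto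
    ultimately have "\<exists>G\<in>Bset C E V. \<forall>p :: 'v \<Rightarrow> 'l. inj_on (\<lambda>v. nz (p v)) (insert u I') \<longrightarrow>
        G p = gsum (insert u I') J a (\<lambda>v. nz (p v))"
      using less.hyps less.prems(2) by blast
    then obtain G where G: "G \<in> Bset C E V"
      "\<And>p :: 'v \<Rightarrow> 'l. inj_on (\<lambda>v. nz (p v)) (insert u I') \<Longrightarrow> G p = gsum (insert u I') J a (\<lambda>v. nz (p v))" by blast
    have "u \<in> V" "v \<in> V" using less.prems 3 by auto
    from Bset_diff_factor[OF C this G(1)] obtain Q where Q: "Q \<in> Bset C E V"
      "\<And>p. G p - G (p(u := p v)) = (nz (p u) - nz (p v)) * Q p" by blast
    have "Q p = gsum I J a (\<lambda>v. nz (p v))" if inj: "inj_on (\<lambda>v. nz (p v)) I" for p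
    proof -
      define r where "r = (\<lambda>v. nz (p v))"
      have r: "inj_on r (insert u (insert v I'))" using inj 3 by (simp add: r_def)
      have 1: "G p = gsum (insert u I') J a r"
        unfolding r_def by (rule G(2)) (use inj 3 in \<open>auto simp: inj_on_def\<close>)
      have "(\<lambda>w. nz ((p(u := p v)) w)) = r(u := r v)" by (auto simp: r_def)
      moreover have "inj_on (r(u := r v)) (insert u I')"
        using r 3 by (auto simp: inj_on_def)
      ultimately have 2: "G (p(u := p v)) = gsum (insert u I') J a (r(u := r v))"
        using G(2)[of "p(u := p v)"] by simp
      have "(r u - r v) * Q p = (r u - r v) * gsum I J a r"
        using Q(2)[of p] gsum_divided_difference[of I' u v J r a] 1 2 3 fin less.prems r
        by (auto simp: r_def)
      moreover have "r u \<noteq> r v" using r 3 by (auto simp: inj_on_def)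
      ultimately show ?thesis by (simp add: r_def)
    qed
    with Q(1) show ?thesis by blast
  qed
qed

definition vdm :: "nat \<Rightarrow> (nat \<Rightarrow> 'l::comm_ring_1) \<Rightarrow> 'l" where
  "vdm M a = (\<Prod>i<M. \<Prod>k<i. a i - a k)"

text \<open>The sign (-1)^(M(M-1)/2) between the product of the differences over all ordered pairs
  and the square of \<open>vdm\<close>.\<close>

definition vsign :: "nat \<Rightarrow> 'l::comm_ring_1" where "vsign M = (\<Prod>i<M. \<Prod>k<i. - 1)"

lemma vsign_cases: "vsign M = (1::'l::comm_ring_1) \<or> vsign M = (- 1::'l)"
proof -
  have "(\<Prod>i<M. (- 1::'l) ^ i) = 1 \<or> (\<Prod>i<M. (- 1::'l) ^ i) = - 1"
    by (induction M) (auto simp: minus_one_power_iff)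
  then show ?thesis by (simp add: vsign_def)
qed

text \<open>Passing from powers to the monic Newton polynomials \<open>N i\<close> is a
  unitriangular row operation; since \<open>N i\<close> vanishes at the nodes before the i-th, the
  resulting matrix is upper triangular.\<close>

lemma det_vandermonde:
  fixes a :: "nat \<Rightarrow> 'l::idom"
  shows "det (mat M M (\<lambda>(i,j). a j ^ i)) = vdm M a"
proof -
  define N where "N = (\<lambda>i. \<Prod>k<i. [:- a k, 1:])"
  have degN: "degree (N i) = i" for i
    unfolding N_def by (subst degree_prod_eq_sum_degree) auto
  have lcN: "coeff (N i) i = 1" for i
    using lead_coeff_prod[of "\<lambda>k. [:- a k, 1:]" "{..<i}"] degN[of i] by (simp add: N_def)
  let ?U = "mat M M (\<lambda>(i,r). coeff (N i) r)" and ?A = "mat M M (\<lambda>(i,j). a j ^ i)"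
  let ?B = "mat M M (\<lambda>(i,j). poly (N i) (a j))"
  have "?U * ?A = ?B"
  proof (rule eq_matI)
    fix i j assume ij: "i < dim_row ?B" "j < dim_col ?B"
    have "(?U * ?A) $$ (i,j) = (\<Sum>r = 0..<M. coeff (N i) r * a j ^ r)"
      using ij by (simp add: scalar_prod_def)
    also have "\<dots> = (\<Sum>r\<le>degree (N i). coeff (N i) r * a j ^ r)"
      using ij degN[of i] by (intro sum.mono_neutral_right) (auto simp: coeff_eq_0)
    finally show "(?U * ?A) $$ (i,j) = ?B $$ (i,j)" using ij by (simp add: poly_altdef)
  qed auto
  then have "det ?B = det ?U * det ?A"
    using det_mult[of ?U M ?A] by simp
  moreover have "det ?U = 1"
  proof -
    have "det ?U = prod_list (diag_mat ?U)"
      by (rule det_lower_triangular[where n = M]) (auto simp: coeff_eq_0 degN)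
    then show ?thesis by (simp add: prod_list_diag_prod lcN)
  qed
  moreover have "det ?B = vdm M a"
  proof -
    have "det ?B = prod_list (diag_mat ?B)"
      by (rule det_upper_triangular[where n = M]) (auto simp: upper_triangular_def N_def poly_prod intro!: prod_zero)
    then show ?thesis by (simp add: prod_list_diag_prod N_def poly_prod vdm_def atLeast0LessThan)
  qed
  ultimately show ?thesis by simp
qed

lemma prod_diff_vdm:
  fixes a :: "nat \<Rightarrow> 'l::comm_ring_1"
  shows "(\<Prod>l<M. \<Prod>k\<in>{..<M} - {l}. a l - a k) = vsign M * (vdm M a) ^ 2"
proof -
  have "(\<Prod>l<M. \<Prod>k\<in>{..<M} - {l}. a l - a k) = (\<Prod>l<M. (\<Prod>k<l. a l - a k) * (\<Prod>k\<in>{l<..<M}. a l - a k))"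
  proof (intro prod.cong refl)
    fix l assume "l \<in> {..<M}"
    then have "{..<M} - {l} = {..<l} \<union> {l<..<M}" by auto
    moreover have "(\<Prod>k\<in>{..<l} \<union> {l<..<M}. a l - a k) = (\<Prod>k<l. a l - a k) * (\<Prod>k\<in>{l<..<M}. a l - a k)"
      by (rule prod.union_disjoint) auto
    ultimately show "(\<Prod>k\<in>{..<M} - {l}. a l - a k) = (\<Prod>k<l. a l - a k) * (\<Prod>k\<in>{l<..<M}. a l - a k)" by simp
  qed
  also have "\<dots> = vdm M a * (\<Prod>l<M. \<Prod>k\<in>{l<..<M}. a l - a k)" by (simp add: prod.distrib vdm_def)
  also have "(\<Prod>l<M. \<Prod>k\<in>{l<..<M}. a l - a k) = (\<Prod>k<M. \<Prod>l<k. a l - a k)"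
    unfolding prod.Sigma[OF finite_lessThan, simplified]
    by (subst prod.Sigma, simp, simp, subst prod.Sigma, simp, simp)
       (rule prod.reindex_bij_witness[of _ prod.swap prod.swap], auto)
  also have "\<dots> = (\<Prod>k<M. \<Prod>l<k. (- 1) * (a k - a l))" by (intro prod.cong) auto
  also have "\<dots> = vsign M * vdm M a" by (simp only: prod.distrib vsign_def vdm_def)
  finally show ?thesis by (simp add: power2_eq_square mult_ac)
qed

text \<open>The matrix factors into a Vandermonde matrix, the diagonal matrix of the weights
  \<open>w\<close> and a transposed alternant matrix, all square of size \<open>M\<close>.\<close>

lemma det_gsum:
  fixes a w :: "nat \<Rightarrow> 'l::field"
  assumes nz: "\<And>l. l < M \<Longrightarrow> a l \<noteq> 0"
    and g: "\<And>i j. i < M \<Longrightarrow> j < M \<Longrightarrow> g i j = (\<Sum>l<M. a l powi (int i + \<alpha> j) * w l)"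
  shows "det (mat M M (\<lambda>(i,j). g i j)) = vdm M a * (\<Prod>l<M. w l) * det (mat M M (\<lambda>(i,j). a j powi \<alpha> i))"
proof -
  let ?A = "mat M M (\<lambda>(i,j). a j ^ i)" and ?B = "mat M M (\<lambda>(l,j). w l * a l powi \<alpha> j)"
    and ?D = "mat M M (\<lambda>(l,j). a l powi \<alpha> j)"
  have "mat M M (\<lambda>(i,j). g i j) = ?A * ?B"
  proof (rule eq_matI)
    fix i j assume "i < dim_row (?A * ?B)" "j < dim_col (?A * ?B)"
    then have ij: "i < M" "j < M" by auto
    have "(?A * ?B) $$ (i,j) = (\<Sum>l = 0..<M. a l ^ i * (w l * a l powi \<alpha> j))"
      using ij by (simp add: scalar_prod_def)
    also have "\<dots> = g i j"
      unfolding g[OF ij] atLeast0LessThan using nz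
      by (intro sum.cong refl) (simp add: power_int_add)
    finally show "mat M M (\<lambda>(i,j). g i j) $$ (i,j) = (?A * ?B) $$ (i,j)" using ij by simp
  qed auto
  then have "det (mat M M (\<lambda>(i,j). g i j)) = det ?A * det ?B"
    using det_mult[of ?A M ?B] by simp
  moreover have "det ?B = (\<Prod>l<M. w l) * det ?D"
  proof -
    have "(\<Prod>i = 0..<M. ?B $$ (i, p i)) = (\<Prod>l<M. w l) * (\<Prod>i = 0..<M. ?D $$ (i, p i))"
      if "p permutes {0..<M}" for p
    proof -
      have "(\<Prod>i = 0..<M. ?B $$ (i, p i)) = (\<Prod>i = 0..<M. w i * ?D $$ (i, p i))"
        using that by (intro prod.cong) auto
      then show ?thesis by (simp add: prod.distrib atLeast0LessThan)
    qed
    then show ?thesis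
      unfolding det_def'[OF mat_carrier] sum_distrib_left by (intro sum.cong) (auto simp: mult_ac)
  qed
  moreover have "det ?D = det (mat M M (\<lambda>(i,j). a j powi \<alpha> i))"
  proof -
    have "transpose_mat ?D = mat M M (\<lambda>(i,j). a j powi \<alpha> i)" by (rule eq_matI) auto
    then show ?thesis using det_transpose[of ?D M] by simp
  qed
  ultimately show ?thesis by (simp add: det_vandermonde)
qed

text \<open>The denominators of the weights multiply to \<open>vsign M * (vdm M a)^2\<close>. One
  \<open>vdm\<close> cancels against the Vandermonde factor of \<open>det_gsum\<close>, the other is
  moved to the left side.\<close>

lemma det_gsum_weights:
  fixes a c :: "nat \<Rightarrow> 'l::field"
  assumes nz: "\<And>l. l < M \<Longrightarrow> a l \<noteq> 0" and inj: "inj_on a {..<M}"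
    and g: "\<And>i j. i < M \<Longrightarrow> j < M \<Longrightarrow> g i j =
      (\<Sum>l<M. a l powi (int i + \<alpha> j) * (\<Prod>j<N. a l - c j) / (\<Prod>k\<in>{..<M} - {l}. a l - a k))"
  shows "vsign M * det (mat M M (\<lambda>(i,j). g i j)) * vdm M a =
     (\<Prod>l<M. \<Prod>j<N. a l - c j) * det (mat M M (\<lambda>(i,j). a j powi \<alpha> i))"
proof -
  define w where "w = (\<lambda>l. (\<Prod>j<N. a l - c j) / (\<Prod>k\<in>{..<M} - {l}. a l - a k))"
  have v: "vdm M a \<noteq> 0" using inj by (force simp: vdm_def inj_on_def)
  have s: "vsign M * vsign M = (1::'l)" using vsign_cases[of M, where 'l = 'l] by auto
  have s0: "vsign M \<noteq> (0::'l)" using s by auto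
  have "(\<Prod>l<M. w l) = (\<Prod>l<M. \<Prod>j<N. a l - c j) / (vsign M * (vdm M a) ^ 2)"
    unfolding w_def prod_dividef prod_diff_vdm ..
  moreover have "det (mat M M (\<lambda>(i,j). g i j)) = vdm M a * (\<Prod>l<M. w l) * det (mat M M (\<lambda>(i,j). a j powi \<alpha> i))"
    using nz g by (intro det_gsum) (auto simp: w_def)
  ultimately show ?thesis using v s s0 by (simp add: power2_eq_square)
qed

section \<open>Supersymmetric functions\<close>

definition Winv :: "nat \<Rightarrow> nat \<Rightarrow> ((nat + nat \<Rightarrow> 'l) \<Rightarrow> 'l) \<Rightarrow> bool" where
  "Winv m n f \<longleftrightarrow> (\<forall>\<sigma> \<tau>. \<sigma> permutes {..<m} \<longrightarrow> \<tau> permutes {..<n} \<longrightarrow> (\<forall>p. f (\<lambda>v. p (map_sum \<sigma> \<tau> v)) = f p))"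

text \<open>Common form of both supersymmetry conditions: where the coordinates
  \<open>x\<^sub>i\<close> and \<open>y\<^sub>j\<close> agree, their common value is irrelevant.
  Coordinates are compared through \<open>nz\<close> since these are the actual coordinates of a
  point.\<close>

definition ssym :: "nat \<Rightarrow> nat \<Rightarrow> ((nat + nat \<Rightarrow> 'l::field) \<Rightarrow> 'l) \<Rightarrow> bool" where
  "ssym m n f \<longleftrightarrow> (\<forall>i<m. \<forall>j<n. \<forall>p q. nz (p (Inl i)) = nz (p (Inr j)) \<longrightarrow> nz (q (Inl i)) = nz (q (Inr j)) \<longrightarrow>
     (\<forall>v. v \<noteq> Inl i \<longrightarrow> v \<noteq> Inr j \<longrightarrow> nz (p v) = nz (q v)) \<longrightarrow> f p = f q)"

lemma ssymI:
  assumes "\<And>i j p q. i < m \<Longrightarrow> j < n \<Longrightarrow> nz (p (Inl i)) = nz (p (Inr j)) \<Longrightarrow> nz (q (Inl i)) = nz (q (Inr j)) \<Longrightarrow>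
     (\<And>v. v \<noteq> Inl i \<Longrightarrow> v \<noteq> Inr j \<Longrightarrow> nz (p v) = nz (q v)) \<Longrightarrow> f p = f q"
  shows "ssym m n f"
  using assms unfolding ssym_def by blast

lemma ssymD:
  assumes "ssym m n f" "i < m" "j < n" "nz (p (Inl i)) = nz (p (Inr j))" "nz (q (Inl i)) = nz (q (Inr j))"
    "\<And>v. v \<noteq> Inl i \<Longrightarrow> v \<noteq> Inr j \<Longrightarrow> nz (p v) = nz (q v)"
  shows "f p = f q"
  using assms unfolding ssym_def by blast

definition SS :: "'l::field set \<Rightarrow> int set \<Rightarrow> nat \<Rightarrow> nat \<Rightarrow> ((nat + nat \<Rightarrow> 'l) \<Rightarrow> 'l) set" where
  "SS C E m n = {f \<in> Bset C E (vars m n). Winv m n f \<and> ssym m n f}"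

abbreviation cnst :: "'l set \<Rightarrow> ('p \<Rightarrow> 'l) set" where "cnst C \<equiv> (\<lambda>c _. c) ` C"

text \<open>The model of \<open>A\<^bsub>m,n\<^esub> \<otimes> K\<close>, where \<open>C\<close> is the image of \<open>K\<close> in the field of values.\<close>

definition AK :: "'l::field set \<Rightarrow> int set \<Rightarrow> nat \<Rightarrow> nat \<Rightarrow> ((nat + nat \<Rightarrow> 'l) \<Rightarrow> 'l) set" where
  "AK C E m n = lspan (cnst C) (SS \<int> E m n)"

lemma finite_vars [simp]: "finite (vars m n)" by (simp add: vars_def)

lemma in_vars [simp]: "Inl i \<in> vars m n \<longleftrightarrow> i < m" "Inr j \<in> vars m n \<longleftrightarrow> j < n"
  by (auto simp: vars_def)

lemma vars_cases: "v \<in> vars m n \<Longrightarrow> (\<And>i. v = Inl i \<Longrightarrow> i < m \<Longrightarrow> P) \<Longrightarrow> (\<And>j. v = Inr j \<Longrightarrow> j < n \<Longrightarrow> P) \<Longrightarrow> P"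
  by (auto simp: vars_def)

lemma is_subring_Ints: "is_subring (\<int> :: 'l::comm_ring_1 set)"
  by (auto simp: is_subring_def)

lemma is_subring_cnst: "is_subring C \<Longrightarrow> is_subring (cnst C)"
  by (force simp: is_subring_def one_fun_def times_fun_def fun_diff_def)

lemma is_subring_SS:
  assumes "is_subring C" "exponents E" shows "is_subring (SS C E m n)"
  unfolding is_subring_def
proof (intro conjI ballI)
  note R = is_subring_Bset[OF assms, of "vars m n"]
  show "1 \<in> SS C E m n" using is_subringD(1)[OF R] by (auto simp: SS_def Winv_def ssym_def)
  fix f g assume fg: "f \<in> SS C E m n" "g \<in> SS C E m n"
  have ss: "ssym m n f" "ssym m n g" using fg by (auto simp: SS_def)
  have "ssym m n (f - g)"
    by (rule ssymI) (simp only: fun_diff_def, rule arg_cong2[where f = "(-)"]; rule ssymD, rule ss; assumption)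
  moreover have "ssym m n (f * g)"
    by (rule ssymI) (simp only: times_fun_def, rule arg_cong2[where f = "(*)"]; rule ssymD, rule ss; assumption)
  moreover have "Winv m n (f - g)" "Winv m n (f * g)"
    using fg by (auto simp: SS_def Winv_def)
  ultimately show "f - g \<in> SS C E m n" "f * g \<in> SS C E m n"
    using fg is_subringD(3,4)[OF R] by (auto simp: SS_def)
qed

lemma is_subring_lspan:
  assumes C: "is_subring C" and S: "is_subring S"
  shows "is_subring (lspan C S)"
proof -
  have sm: "s * v \<in> lspan C S" if "v \<in> lspan C S" "s \<in> S" for s v
    using that(1)
  proof (induction rule: lspan.induct)
    case (lspan_step v c t)
    have "s * v + c * (s * t) \<in> lspan C S"
      using lspan_step S that by (intro lspan.lspan_step) (auto simp: is_subringD)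
    then show ?case by (simp add: algebra_simps)
  qed (simp add: lspan_zero)
  have "u * v \<in> lspan C S" if "u \<in> lspan C S" "v \<in> lspan C S" for u v
    using that(1)
  proof (induction rule: lspan.induct)
    case (lspan_step u c s)
    have "u * v + c * (s * v) \<in> lspan C S"
      by (rule lspan_add[OF lspan_step.IH lspan_smult[OF C sm[OF that(2) lspan_step.hyps(3)] lspan_step.hyps(2)]])
    then show ?case by (simp add: algebra_simps)
  qed (simp add: lspan_zero)
  moreover have "u - v \<in> lspan C S" if "u \<in> lspan C S" "v \<in> lspan C S" for u v
    using lspan_add[OF that(1) lspan_uminus[OF C that(2)]] by simp
  ultimately show ?thesis
    using lspan_incl[OF C, of 1 S] is_subringD(1)[OF S] by (auto simp: is_subring_def)
qed

lemma is_subring_AK: "is_subring C \<Longrightarrow> exponents E \<Longrightarrow> is_subring (AK C E m n)"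
  unfolding AK_def by (intro is_subring_lspan is_subring_cnst is_subring_SS is_subring_Ints)

lemma cnst_SS: "exponents E \<Longrightarrow> c \<in> C \<Longrightarrow> (\<lambda>_. c) \<in> SS C E m n"
  by (auto simp: SS_def Winv_def ssym_def intro: Bset_const)

lemma AK_subset_SS:
  assumes C: "is_subring C" "\<int> \<subseteq> C" and E: "exponents E"
  shows "AK C E m n \<subseteq> SS C E m n"
proof
  note R = is_subring_SS[OF C(1) E, of m n]
  fix f assume "f \<in> AK C E m n"
  then show "f \<in> SS C E m n"
    unfolding AK_def
  proof (induction rule: lspan.induct)
    case (lspan_step v c s)
    have "s \<in> SS C E m n"
      using lspan_step.hyps(3) Bset_coeff_mono[OF C(2)] by (auto simp: SS_def)
    with lspan_step cnst_SS[OF E, of _ C m n] show ?case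
      by (intro is_subringD(4,6)[OF R]) auto
  qed (rule is_subringD(2)[OF R])
qed

lemma SS_in_AK: "is_subring C \<Longrightarrow> f \<in> SS \<int> E m n \<Longrightarrow> f \<in> AK C E m n"
  unfolding AK_def by (intro lspan_incl is_subring_cnst)

lemma cnst_AK: "is_subring C \<Longrightarrow> exponents E \<Longrightarrow> c \<in> C \<Longrightarrow> (\<lambda>_. c) \<in> AK C E m n"
  using lspan_base[of "\<lambda>_. c" "cnst C" 1 "SS \<int> E m n"]
    is_subringD(1)[OF is_subring_SS[OF is_subring_Ints, of E m n]]
  by (fastforce simp: AK_def)

lemma Bset_rename:
  assumes "is_subring C" "exponents E" "finite V'" "f \<in> Bset C E V" "s ` V \<subseteq> V'"
  shows "(\<lambda>p. f (\<lambda>v. p (s v))) \<in> Bset C E V'"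
proof (rule Bset_subst[OF assms(1-4)])
  fix v assume "v \<in> V"
  with assms(5) show "(\<exists>w\<in>V'. \<forall>p. nz (p (s v)) = nz (p w)) \<or> (\<forall>p. nz (p (s v)) = 1)"
    by (intro disjI1 bexI[of _ "s v"]) auto
qed

text \<open>The sum is visibly symmetric, but \<open>G\<close> is known only at points with distinct
  nodes; density carries the invariance to all points.\<close>

lemma gsum_invariant:
  fixes G :: "('v \<Rightarrow> 'l::field_char_0) \<Rightarrow> 'l"
  assumes C: "is_subring C" "exponents E" "finite V" and G: "G \<in> Bset C E V"
    and IJ: "I \<subseteq> V" "J \<subseteq> V" and \<pi>: "bij_betw \<pi> I I" "bij_betw \<pi> J J" "\<pi> ` V \<subseteq> V"
    and g: "\<And>p. inj_on (\<lambda>v. nz (p v)) I \<Longrightarrow> G p = gsum I J a (\<lambda>v. nz (p v))"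
  shows "G (\<lambda>v. p (\<pi> v)) = G p"
proof -
  have "(\<lambda>p. G (\<lambda>v. p (\<pi> v))) \<in> Bset C E V"
    by (rule Bset_rename[OF C G \<pi>(3)])
  then have "(\<lambda>p. G (\<lambda>v. p (\<pi> v))) - G \<in> Bset C E V"
    by (rule is_subringD(3)[OF is_subring_Bset[OF C(1,2)] _ G])
  then have "((\<lambda>p. G (\<lambda>v. p (\<pi> v))) - G) p = 0"
  proof (rule Bset_density[where U = I])
    fix p :: "'v \<Rightarrow> 'l" assume inj: "inj_on (\<lambda>v. nz (p v)) I"
    have "inj_on (\<lambda>v. nz (p (\<pi> v))) I"
      using comp_inj_on[of \<pi> I "\<lambda>v. nz (p v)"] inj \<pi>(1) by (simp add: bij_betw_def comp_def)
    then show "((\<lambda>p. G (\<lambda>v. p (\<pi> v))) - G) p = 0"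
      using g[of "\<lambda>v. p (\<pi> v)"] g[OF inj] gsum_permute[OF \<pi>(1,2), of a "\<lambda>v. nz (p v)"] by simp
  qed (use C IJ finite_subset in auto)
  then show ?thesis by simp
qed

text \<open>Density speaks about free coordinates, so the locus where coordinates \<open>i\<close>
  and \<open>j\<close> agree is parametrised: \<open>?T1\<close> copies \<open>i\<close> to
  \<open>j\<close>, and \<open>?T2\<close> gives both the value of a fresh coordinate
  \<open>z\<close>. At generic points both sides equal the sum with the pair removed.\<close>

lemma gsum_supersymmetric:
  fixes G :: "('v \<Rightarrow> 'l::field_char_0) \<Rightarrow> 'l"
  assumes inf: "infinite (UNIV :: 'v set)"
    and C: "is_subring C" "exponents E" "finite V" and G: "G \<in> Bset C E V"
    and IJ: "I \<subseteq> V" "J \<subseteq> V" "I \<inter> J = {}" and ij: "i \<in> I" "j \<in> J"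
    and g: "\<And>p. inj_on (\<lambda>v. nz (p v)) I \<Longrightarrow> G p = gsum I J a (\<lambda>v. nz (p v))"
    and pq: "nz (p i) = nz (p j)" "nz (q i) = nz (q j)" "\<And>v. v \<noteq> i \<Longrightarrow> v \<noteq> j \<Longrightarrow> nz (p v) = nz (q v)"
  shows "G p = G q"
proof -
  obtain z where z: "z \<notin> V" using ex_new_if_finite[OF inf C(3)] by blast
  have fin: "finite I" "finite J" by (rule finite_subset[OF _ C(3)], rule IJ)+
  have nij: "i \<noteq> j" using ij IJ by auto
  let ?s1 = "\<lambda>v. if v = j then i else v" and ?s2 = "\<lambda>v. if v = i \<or> v = j then z else v"
  let ?T1 = "\<lambda>p v. p (?s1 v)" and ?T2 = "\<lambda>(p::'v \<Rightarrow> 'l) v. p (?s2 v)"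
  let ?H = "(\<lambda>p. G (?T1 p)) - (\<lambda>p. G (?T2 p))"
  have cancel: "G p = gsum (I - {i}) (J - {j}) a (\<lambda>v. nz (p v))"
    if "inj_on (\<lambda>v. nz (p v)) I" "nz (p i) = nz (p j)" for p
  proof -
    have "gsum ((I - {i}) \<union> {i}) ((J - {j}) \<union> {j}) a (\<lambda>v. nz (p v)) = gsum (I - {i}) (J - {j}) a (\<lambda>v. nz (p v))"
      by (rule gsum_cancel[where h = "\<lambda>_. j"]) (use fin that ij in \<open>auto simp: bij_betw_def insert_absorb\<close>)
    moreover have "(I - {i}) \<union> {i} = I" "(J - {j}) \<union> {j} = J" using ij by auto
    ultimately show ?thesis using g[OF that(1)] by simp
  qed
  have fz: "finite (insert z V)" using C by simp
  have "(\<lambda>p. G (?T1 p)) \<in> Bset C E (insert z V)"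
    by (rule Bset_rename[OF C(1,2) fz G]) (use IJ ij in auto)
  moreover have "(\<lambda>p. G (?T2 p)) \<in> Bset C E (insert z V)"
    by (rule Bset_rename[OF C(1,2) fz G]) auto
  ultimately have "?H \<in> Bset C E (insert z V)"
    by (rule is_subringD(3)[OF is_subring_Bset[OF C(1,2)]])
  then have H: "?H p = 0" for p
  proof (rule Bset_density[where U = "insert z I"])
    fix p :: "'v \<Rightarrow> 'l" assume inj: "inj_on (\<lambda>v. nz (p v)) (insert z I)"
    have zI: "z \<notin> I" "z \<noteq> j" using z IJ ij by auto
    have "j \<notin> I" using ij IJ by auto
    then have 1: "inj_on (\<lambda>v. nz (?T1 p v)) I"
      using inj by (auto simp: inj_on_def)
    have 2: "inj_on (\<lambda>v. nz (?T2 p v)) I"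
      using inj \<open>j \<notin> I\<close> zI by (auto simp: inj_on_def)
    have "gsum (I - {i}) (J - {j}) a (\<lambda>v. nz (?T1 p v)) = gsum (I - {i}) (J - {j}) a (\<lambda>v. nz (?T2 p v))"
      using IJ ij by (intro gsum_cong) auto
    then show "?H p = 0" using cancel[OF 1] cancel[OF 2] nij by simp
  qed (use C fin in auto)
  \<comment> \<open>One point carries both given points: on \<open>V\<close>, \<open>?T1\<close>
    recovers the coordinates of \<open>p\<close> from it and \<open>?T2\<close> those of
    \<open>q\<close>.\<close>
  define r where "r = p(z := q i)"
  have zij: "z \<noteq> i" "z \<noteq> j" using z IJ ij by auto
  have "G p = G (?T1 r)"
    by (rule Bset_local[OF G]) (use pq z zij in \<open>auto simp: r_def\<close>)
  also have "\<dots> = G (?T2 r)" using H[of r] by simp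
  also have "\<dots> = G q"
    by (rule Bset_local[OF G]) (use pq z zij in \<open>auto simp: r_def\<close>)
  finally show ?thesis .
qed

lemma map_sum_bij:
  assumes "\<sigma> permutes {..<m}" "\<tau> permutes {..<n}"
  shows "bij_betw (map_sum \<sigma> \<tau>) (Inl ` {..<m}) (Inl ` {..<m})"
    "bij_betw (map_sum \<sigma> \<tau>) (Inr ` {..<n}) (Inr ` {..<n})" "map_sum \<sigma> \<tau> ` vars m n \<subseteq> vars m n"
proof -
  have "inj_on (map_sum \<sigma> \<tau>) (Inl ` {..<m})" "inj_on (map_sum \<sigma> \<tau>) (Inr ` {..<n})"
    by (auto simp: inj_on_def inj_eq[OF permutes_inj[OF assms(1)]] inj_eq[OF permutes_inj[OF assms(2)]])
  moreover have "map_sum \<sigma> \<tau> ` Inl ` {..<m} = Inl ` (\<sigma> ` {..<m})" "map_sum \<sigma> \<tau> ` Inr ` {..<n} = Inr ` (\<tau> ` {..<n})"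
    by (auto simp: image_image)
  ultimately show 1: "bij_betw (map_sum \<sigma> \<tau>) (Inl ` {..<m}) (Inl ` {..<m})"
    "bij_betw (map_sum \<sigma> \<tau>) (Inr ` {..<n}) (Inr ` {..<n})"
    using permutes_image[OF assms(1)] permutes_image[OF assms(2)] by (auto simp: bij_betw_def)
  show "map_sum \<sigma> \<tau> ` vars m n \<subseteq> vars m n"
  proof
    fix v assume "v \<in> map_sum \<sigma> \<tau> ` vars m n"
    then obtain w where w: "w \<in> vars m n" "v = map_sum \<sigma> \<tau> w" by blast
    show "v \<in> vars m n"
    proof (rule vars_cases[OF w(1)])
      fix i assume "w = Inl i" "i < m"
      then show ?thesis using w(2) permutes_in_image[OF assms(1), of i] by simp
    next
      fix j assume "w = Inr j" "j < n"
      then show ?thesis using w(2) permutes_in_image[OF assms(2), of j] by simp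
    qed
  qed
qed

lemma infinite_nat_plus_nat: "infinite (UNIV :: (nat + nat) set)"
  by (metis UNIV_Plus_UNIV finite_Plus_iff infinite_UNIV_nat)

lemma gsum_SS:
  assumes E: "exponents E" "a \<in> E" and IJ: "I = Inl ` {..<m} \<and> J = Inr ` {..<n} \<or> I = Inr ` {..<n} \<and> J = Inl ` {..<m}"
  shows "\<exists>G\<in>SS \<int> E m n. \<forall>p :: nat + nat \<Rightarrow> 'l::field_char_0. inj_on (\<lambda>v. nz (p v)) I \<longrightarrow>
     G p = gsum I J a (\<lambda>v. nz (p v))"
proof -
  have sub: "I \<subseteq> vars m n" "J \<subseteq> vars m n" "I \<inter> J = {}" using IJ by (auto simp: vars_def)
  obtain G where G: "G \<in> Bset \<int> E (vars m n)"
    "\<And>p :: nat + nat \<Rightarrow> 'l. inj_on (\<lambda>v. nz (p v)) I \<Longrightarrow> G p = gsum I J a (\<lambda>v. nz (p v))"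
    using gsum_polynomial[OF is_subring_Ints E(1) finite_vars E(2) sub, where 'l = 'l] by blast
  have "Winv m n G"
    unfolding Winv_def
  proof (intro allI impI)
    fix \<sigma> \<tau> p assume st: "\<sigma> permutes {..<m}" "\<tau> permutes {..<n}"
    show "G (\<lambda>v. p (map_sum \<sigma> \<tau> v)) = G p"
      by (rule gsum_invariant[OF is_subring_Ints E(1) finite_vars G(1) sub(1,2) _ _ _ G(2)])
         (use IJ map_sum_bij[OF st] in auto)
  qed
  moreover have "ssym m n G"
    unfolding ssym_def
  proof (intro allI impI)
    fix i j and p q :: "nat + nat \<Rightarrow> 'l"
    assume h: "i < m" "j < n" "nz (p (Inl i)) = nz (p (Inr j))" "nz (q (Inl i)) = nz (q (Inr j))"
      "\<forall>v. v \<noteq> Inl i \<longrightarrow> v \<noteq> Inr j \<longrightarrow> nz (p v) = nz (q v)"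
    note ss = gsum_supersymmetric[OF infinite_nat_plus_nat is_subring_Ints E(1) finite_vars G(1) sub _ _ G(2)]
    from IJ show "G p = G q"
    proof
      assume IJ: "I = Inl ` {..<m} \<and> J = Inr ` {..<n}"
      show ?thesis
      proof (rule ss[of "Inl i" "Inr j"])
        show "Inl i \<in> I" "Inr j \<in> J" using IJ h(1,2) by auto
        show "nz (p v) = nz (q v)" if "v \<noteq> Inl i" "v \<noteq> Inr j" for v using h(5) that by blast
      qed (assumption, rule h(3), rule h(4))
    next
      assume IJ: "I = Inr ` {..<n} \<and> J = Inl ` {..<m}"
      show ?thesis
      proof (rule ss[of "Inr j" "Inl i"])
        show "Inr j \<in> I" "Inl i \<in> J" using IJ h(1,2) by auto
        show "nz (p v) = nz (q v)" if "v \<noteq> Inr j" "v \<noteq> Inl i" for v using h(5) that by blast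
      qed (assumption, rule h(3)[symmetric], rule h(4)[symmetric])
    qed
  qed
  ultimately show ?thesis using G by (auto simp: SS_def)
qed

section \<open>Lifting antisymmetrisations\<close>

text \<open>Precomposition with \<open>pairing M N k\<close> substitutes \<open>x\<^bsub>M+s\<^esub>\<close> for \<open>y\<^bsub>N+s\<^esub>\<close>, \<open>s < k\<close>; unlike
  \<open>res M N\<close>, it keeps the \<open>x\<^sub>i\<close> distinct.\<close>

definition pairing :: "nat \<Rightarrow> nat \<Rightarrow> nat \<Rightarrow> nat + nat \<Rightarrow> nat + nat" where
  "pairing M N k v = (case v of Inl i \<Rightarrow> Inl i | Inr j \<Rightarrow> if N \<le> j \<and> j < N + k then Inl (j - N + M) else Inr j)"

definition res :: "nat \<Rightarrow> nat \<Rightarrow> (nat + nat \<Rightarrow> 'l::one) \<Rightarrow> nat + nat \<Rightarrow> 'l" where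
  "res M N p v = (if v \<in> vars M N then p v else 1)"

lemma Bset_res:
  assumes "is_subring C" "exponents E" "f \<in> Bset C E V"
  shows "(\<lambda>p. f (res M N p)) \<in> Bset C E (vars M N)"
proof (rule Bset_subst[OF assms(1,2) finite_vars assms(3)])
  fix v
  show "(\<exists>w\<in>vars M N. \<forall>p::nat+nat\<Rightarrow>'a. nz (res M N p v) = nz (p w)) \<or> (\<forall>p::nat+nat\<Rightarrow>'a. nz (res M N p v) = 1)"
    by (cases "v \<in> vars M N") (auto simp: res_def)
qed

text \<open>The points \<open>P t\<close> interpolate between the two arguments: their first
  \<open>t\<close> extra pairs carry the values \<open>p (Inl (M + s))\<close>, the remaining ones
  are 1. Passing from \<open>t\<close> to \<open>Suc t\<close> changes one pair of equal
  coordinates.\<close>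

lemma ssym_pairing:
  fixes f :: "(nat + nat \<Rightarrow> 'l::field) \<Rightarrow> 'l"
  assumes f: "f \<in> SS C E (M + k) (N + k)"
  shows "f (res M N p) = f (\<lambda>v. p (pairing M N k v))"
proof -
  define P where "P = (\<lambda>t v. case v of Inl i \<Rightarrow> if i < M + t then p (Inl i) else 1
     | Inr j \<Rightarrow> if j < N then p (Inr j) else if j < N + t then p (Inl (j - N + M)) else 1)"
  have s: "ssym (M + k) (N + k) f" and B: "f \<in> Bset C E (vars (M + k) (N + k))" using f by (auto simp: SS_def)
  have "t \<le> k \<Longrightarrow> f (P t) = f (P 0)" for t
  proof (induction t)
    case (Suc t)
    have "f (P (Suc t)) = f (P t)"
    proof (rule ssymD[OF s, of "M + t" "N + t"])
      fix v assume v: "v \<noteq> Inl (M + t)" "v \<noteq> Inr (N + t)"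
      show "nz (P (Suc t) v) = nz (P t v)"
      proof (cases v)
        case (Inl i)
        then have "i < Suc (M + t) \<longleftrightarrow> i < M + t" using v by auto
        then show ?thesis using Inl by (simp add: P_def)
      next
        case (Inr j)
        then have "j < Suc (N + t) \<longleftrightarrow> j < N + t" using v by auto
        then show ?thesis using Inr by (simp add: P_def)
      qed
    qed (use Suc.prems in \<open>simp_all add: P_def add.commute\<close>)
    with Suc show ?case by simp
  qed simp
  moreover have "P 0 = res M N p"
    by (auto simp: P_def res_def vars_def fun_eq_iff split: sum.split)
  moreover have "f (P k) = f (\<lambda>v. p (pairing M N k v))"
  proof (rule Bset_local[OF B])
    fix v assume "v \<in> vars (M + k) (N + k)"
    then show "nz (P k v) = nz (p (pairing M N k v))"
      by (rule vars_cases) (auto simp: P_def pairing_def)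
  qed
  ultimately show ?thesis by auto
qed

text \<open>At a paired point the nodes are distinct, so \<open>gsum\<close> is meaningful there,
  whereas specialisation to 1 would repeat nodes. \<open>gsum_cancel\<close> removes the pairs.
  \<open>I\<close> and \<open>J\<close> enumerate the variables so that x and y can be
  exchanged.\<close>

lemma gsum_pairing:
  fixes r r' :: "nat + nat \<Rightarrow> 'l::field" and I J :: "nat \<Rightarrow> nat + nat"
  assumes IJ: "inj I" "inj J" "range I \<inter> range J = {}" and inj: "inj_on r' (I ` {..<M + k})"
    and low: "\<And>i. i < M \<Longrightarrow> r' (I i) = r (I i)" "\<And>j. j < N \<Longrightarrow> r' (J j) = r (J j)"
    and pair: "\<And>t. t < k \<Longrightarrow> r' (J (N + t)) = r' (I (M + t))"
  shows "gsum (I ` {..<M + k}) (J ` {..<N + k}) a r' =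
    (\<Sum>l<M. r (I l) powi a * (\<Prod>j<N. r (I l) - r (J j)) / (\<Prod>i\<in>{..<M} - {l}. r (I l) - r (I i)))"
proof -
  let ?h = "\<lambda>v. J (the_inv I v - M + N)" and ?h' = "\<lambda>v. I (the_inv J v - N + M)"
  have inv: "the_inv I (I i) = i" "the_inv J (J i) = i" for i
    using IJ(1,2) by (simp_all add: the_inv_f_f)
  have eq: "I i = I i' \<longleftrightarrow> i = i'" "J i = J i' \<longleftrightarrow> i = i'" for i i'
    using IJ(1,2) by (simp_all add: inj_eq)
  have split: "{..<M + k} = {..<M} \<union> {M..<M + k}" "{..<N + k} = {..<N} \<union> {N..<N + k}" by auto
  have "gsum (I ` {..<M} \<union> I ` {M..<M + k}) (J ` {..<N} \<union> J ` {N..<N + k}) a r' = gsum (I ` {..<M}) (J ` {..<N}) a r'"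
  proof (rule gsum_cancel[where h = ?h])
    show "bij_betw ?h (I ` {M..<M + k}) (J ` {N..<N + k})"
      by (rule bij_betw_byWitness[where f' = ?h']) (auto simp: inv intro!: imageI)
    show "r' (?h v) = r' v" if v: "v \<in> I ` {M..<M + k}" for v
    proof -
      obtain i where i: "v = I i" "M \<le> i" "i < M + k" using v by auto
      then show ?thesis using pair[of "i - M"] by (simp add: inv add.commute)
    qed
    show "inj_on r' (I ` {..<M} \<union> I ` {M..<M + k})"
      using inj unfolding split image_Un .
  qed (auto simp: eq)
  also have "\<dots> = gsum (I ` {..<M}) (J ` {..<N}) a r"
    by (rule gsum_cong) (auto simp: low)
  also have "\<dots> = (\<Sum>l<M. r (I l) powi a * (\<Prod>j<N. r (I l) - r (J j)) / (\<Prod>i\<in>{..<M} - {l}. r (I l) - r (I i)))"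
  proof -
    have "I ` {..<M} - {I l} = I ` ({..<M} - {l})" for l by (auto simp: eq)
    then show ?thesis
      using inj_on_subset[OF IJ(1) subset_UNIV] inj_on_subset[OF IJ(2) subset_UNIV]
      by (simp add: gsum_def sum.reindex prod.reindex)
  qed
  finally show ?thesis unfolding split image_Un .
qed

lemma inj_on_pairing:
  assumes "inj_on r (vars (M + k) (N + k))"
  shows "inj_on (\<lambda>v. r (pairing M N k v)) (Inl ` {..<M + k})" "inj_on (\<lambda>v. r (pairing M N k v)) (Inr ` {..<N + k})"
proof -
  have "inj_on (pairing M N k) (Inl ` {..<M + k})" "inj_on (pairing M N k) (Inr ` {..<N + k})"
    by (auto simp: inj_on_def pairing_def)
  moreover have "inj_on r (pairing M N k ` (Inl ` {..<M + k}))" "inj_on r (pairing M N k ` (Inr ` {..<N + k}))"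
    by (rule inj_on_subset[OF assms], force simp: pairing_def)+
  ultimately show "inj_on (\<lambda>v. r (pairing M N k v)) (Inl ` {..<M + k})" "inj_on (\<lambda>v. r (pairing M N k v)) (Inr ` {..<N + k})"
    using comp_inj_on[of "pairing M N k" _ r] by (simp_all add: comp_def)
qed

lemma gsum_level_x:
  fixes r :: "nat + nat \<Rightarrow> 'l::field"
  assumes inj: "inj_on r (vars (M + k) (N + k))"
  shows "gsum (Inl ` {..<M + k}) (Inr ` {..<N + k}) a (\<lambda>v. r (pairing M N k v)) =
    (\<Sum>l<M. r (Inl l) powi a * (\<Prod>j<N. r (Inl l) - r (Inr j)) / (\<Prod>i\<in>{..<M} - {l}. r (Inl l) - r (Inl i)))"
  by (rule gsum_pairing[OF _ _ _ inj_on_pairing(1)[OF inj]]) (auto simp: pairing_def add.commute)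

lemma gsum_level_y:
  fixes r :: "nat + nat \<Rightarrow> 'l::field"
  assumes inj: "inj_on r (vars (M + k) (N + k))"
  shows "gsum (Inr ` {..<N + k}) (Inl ` {..<M + k}) a (\<lambda>v. r (pairing M N k v)) =
    (\<Sum>l<N. r (Inr l) powi a * (\<Prod>j<M. r (Inr l) - r (Inl j)) / (\<Prod>i\<in>{..<N} - {l}. r (Inr l) - r (Inr i)))"
  by (rule gsum_pairing[OF _ _ _ inj_on_pairing(2)[OF inj]]) (auto simp: pairing_def add.commute)

lemma det_in_subring:
  assumes S: "is_subring S" and g: "\<And>i j. i < M \<Longrightarrow> j < M \<Longrightarrow> g i j \<in> S"
  shows "det (mat M M (\<lambda>(i,j). g i j)) \<in> S"
  unfolding det_def'[OF mat_carrier]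
proof (intro is_subring_sum[OF S] is_subringD(4)[OF S] is_subring_prod[OF S])
  fix p show "signof p \<in> S" using is_subringD[OF S] by (simp add: sign_def)
next
  fix p i assume "p \<in> {p. p permutes {0..<M}}" "i \<in> {0..<M}"
  then show "mat M M (\<lambda>(i,j). g i j) $$ (i, p i) \<in> S" using g by simp
qed

lemma det_fun_apply:
  fixes g :: "nat \<Rightarrow> nat \<Rightarrow> 'p \<Rightarrow> 'l::comm_ring_1"
  shows "det (mat M M (\<lambda>(i,j). g i j)) p = det (mat M M (\<lambda>(i,j). g i j p))"
proof -
  interpret h: comm_ring_hom "\<lambda>f :: 'p \<Rightarrow> 'l. f p" by unfold_locales auto
  have "map_mat (\<lambda>f. f p) (mat M M (\<lambda>(i,j). g i j)) = mat M M (\<lambda>(i,j). g i j p)"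
    by (rule eq_matI) auto
  then show ?thesis using h.hom_det[of "mat M M (\<lambda>(i,j). g i j)"] by simp
qed

definition xs :: "(nat + nat \<Rightarrow> 'l::field) \<Rightarrow> nat \<Rightarrow> 'l" where "xs p i = nz (p (Inl i))"
definition ys :: "(nat + nat \<Rightarrow> 'l::field) \<Rightarrow> nat \<Rightarrow> 'l" where "ys p j = nz (p (Inr j))"

definition Delta :: "nat \<Rightarrow> nat \<Rightarrow> (nat + nat \<Rightarrow> 'l::field) \<Rightarrow> 'l" where
  "Delta M N p = (\<Prod>i<M. \<Prod>j<N. xs p i - ys p j)"

definition Alt :: "nat \<Rightarrow> nat \<Rightarrow> ((nat + nat \<Rightarrow> 'l) \<Rightarrow> 'l::field) \<Rightarrow> (nat + nat \<Rightarrow> 'l) \<Rightarrow> 'l" where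
  "Alt M N u p = (\<Sum>\<sigma>\<in>{\<sigma>. \<sigma> permutes {0..<M}}. \<Sum>\<tau>\<in>{\<tau>. \<tau> permutes {0..<N}}.
     signof \<sigma> * signof \<tau> * u (\<lambda>v. p (map_sum \<sigma> \<tau> v)))"

lemma Alt_zero: "Alt M N (\<lambda>_. 0) p = 0" by (simp add: Alt_def)

lemma Alt_add: "Alt M N (\<lambda>p. u p + v p) p = Alt M N u p + Alt M N v p"
  by (simp add: Alt_def distrib_left sum.distrib)

lemma Alt_cmult:
  assumes "\<And>\<sigma> \<tau>. \<sigma> permutes {0..<M} \<Longrightarrow> \<tau> permutes {0..<N} \<Longrightarrow> r (\<lambda>v. p (map_sum \<sigma> \<tau> v)) = r p"
  shows "Alt M N (\<lambda>p. r p * u p) p = r p * Alt M N u p"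
  unfolding Alt_def sum_distrib_left using assms by (intro sum.cong refl) (auto simp: mult_ac)

lemma Mon_vars:
  "Mon (vars M N) \<alpha> p = (\<Prod>i<M. xs p i powi \<alpha> (Inl i)) * (\<Prod>j<N. ys p j powi \<alpha> (Inr j))"
proof -
  have "Mon (vars M N) \<alpha> p = (\<Prod>v\<in>Inl ` {..<M}. nz (p v) powi \<alpha> v) * (\<Prod>v\<in>Inr ` {..<N}. nz (p v) powi \<alpha> v)"
    unfolding Mon_def vars_def by (rule prod.union_disjoint) auto
  then show ?thesis by (simp add: prod.reindex xs_def ys_def)
qed

text \<open>A monomial splits into an x-part and a y-part, so the double alternating sum is a
  product of two Leibniz expansions.\<close>

lemma Alt_Mon:
  "Alt M N (\<lambda>p. c * Mon (vars M N) \<alpha> p) p = c * det (mat M M (\<lambda>(i,j). xs p j powi \<alpha> (Inl i))) *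
     det (mat N N (\<lambda>(i,j). ys p j powi \<alpha> (Inr i)))"
proof -
  have 1: "det (mat M M (\<lambda>(i,j). xs p j powi \<alpha> (Inl i))) =
     (\<Sum>\<sigma>\<in>{\<sigma>. \<sigma> permutes {0..<M}}. signof \<sigma> * (\<Prod>i<M. xs p (\<sigma> i) powi \<alpha> (Inl i)))"
    unfolding det_def'[OF mat_carrier] atLeast0LessThan[symmetric] by (intro sum.cong refl arg_cong2[where f = "(*)"] prod.cong) auto
  have 2: "det (mat N N (\<lambda>(i,j). ys p j powi \<alpha> (Inr i))) =
     (\<Sum>\<sigma>\<in>{\<sigma>. \<sigma> permutes {0..<N}}. signof \<sigma> * (\<Prod>i<N. ys p (\<sigma> i) powi \<alpha> (Inr i)))"
    unfolding det_def'[OF mat_carrier] atLeast0LessThan[symmetric] by (intro sum.cong refl arg_cong2[where f = "(*)"] prod.cong) auto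
  show ?thesis
    unfolding 1 2 Alt_def Mon_vars mult.assoc
    unfolding sum_product
    unfolding sum_distrib_left
    by (intro sum.cong refl) (simp add: xs_def ys_def mult_ac)
qed

text \<open>For a monomial \<open>u\<close> the witness is the product of two determinants of divided differences
  \<^term>\<open>gsum\<close>, one in the \<open>x\<^sub>i\<close> and one in the \<open>y\<^sub>j\<close>.\<close>

lemma Alt_lift:
  fixes C :: "'l::field_char_0 set"
  assumes C: "is_subring C" "\<int> \<subseteq> C" and E: "exponents E" and u: "u \<in> Bset C E (vars M N)"
  shows "\<exists>\<theta>\<in>AK C E (M + k) (N + k). \<forall>p. inj_on (\<lambda>v. nz (p v)) (vars (M + k) (N + k)) \<longrightarrow>
     \<theta> (res M N p) * (vdm M (xs p) * vdm N (ys p)) = Delta M N p * (\<Prod>j<N. \<Prod>i<M. ys p j - xs p i) * Alt M N u p"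
  using u
proof (induction rule: Bset.induct)
  case Bset_zero
  have "0 \<in> AK C E (M + k) (N + k)" using is_subringD(2)[OF is_subring_AK[OF C(1) E]] .
  then show ?case by (intro bexI[of _ 0]) (auto simp: Alt_def)
next
  case (Bset_step u c \<alpha>)
  let ?m = "M + k" and ?n = "N + k"
  note R = is_subring_AK[OF C(1) E, of ?m ?n] and RZ = is_subring_SS[OF is_subring_Ints E, of ?m ?n]
  obtain \<theta> where \<theta>: "\<theta> \<in> AK C E ?m ?n" "\<And>p. inj_on (\<lambda>v. nz (p v)) (vars ?m ?n) \<Longrightarrow>
     \<theta> (res M N p) * (vdm M (xs p) * vdm N (ys p)) = Delta M N p * (\<Prod>j<N. \<Prod>i<M. ys p j - xs p i) * Alt M N u p"
    using Bset_step.IH by blast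
  have "\<forall>a\<in>E. \<exists>G\<in>SS \<int> E ?m ?n. \<forall>p :: nat + nat \<Rightarrow> 'l. inj_on (\<lambda>v. nz (p v)) (Inl ` {..<?m}) \<longrightarrow>
     G p = gsum (Inl ` {..<?m}) (Inr ` {..<?n}) a (\<lambda>v. nz (p v))"
    using gsum_SS[OF E] by blast
  then obtain G where G: "\<And>a. a \<in> E \<Longrightarrow> G a \<in> SS \<int> E ?m ?n"
    "\<And>a p. a \<in> E \<Longrightarrow> inj_on (\<lambda>v. nz (p v)) (Inl ` {..<?m}) \<Longrightarrow>
      G a p = gsum (Inl ` {..<?m}) (Inr ` {..<?n}) a (\<lambda>v. nz (p v :: 'l))" by metis
  have "\<forall>a\<in>E. \<exists>G\<in>SS \<int> E ?m ?n. \<forall>p :: nat + nat \<Rightarrow> 'l. inj_on (\<lambda>v. nz (p v)) (Inr ` {..<?n}) \<longrightarrow>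
     G p = gsum (Inr ` {..<?n}) (Inl ` {..<?m}) a (\<lambda>v. nz (p v))"
    using gsum_SS[OF E] by blast
  then obtain H where H: "\<And>a. a \<in> E \<Longrightarrow> H a \<in> SS \<int> E ?m ?n"
    "\<And>a p. a \<in> E \<Longrightarrow> inj_on (\<lambda>v. nz (p v)) (Inr ` {..<?n}) \<Longrightarrow>
      H a p = gsum (Inr ` {..<?n}) (Inl ` {..<?m}) a (\<lambda>v. nz (p v :: 'l))" by metis
  let ?a = "\<lambda>i j. int i + \<alpha> (Inl j)" and ?b = "\<lambda>i j. int i + \<alpha> (Inr j)"
  \<comment> \<open>The row index is added to the exponent of the monomial, so the exponents stay in
    \<open>E\<close> also when only nonnegative ones are allowed.\<close>
  have ea: "?a i j \<in> E" if "j < M" for i j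
    by (rule exponentsD(3)[OF E exponentsD(4)[OF E]]) (use Bset_step.hyps(3) that in auto)
  have eb: "?b i j \<in> E" if "j < N" for i j
    by (rule exponentsD(3)[OF E exponentsD(4)[OF E]]) (use Bset_step.hyps(3) that in auto)
  define D where "D = det (mat M M (\<lambda>(i,j). G (?a i j)))"
  define D' where "D' = det (mat N N (\<lambda>(i,j). H (?b i j)))"
  have DS: "D \<in> SS \<int> E ?m ?n" "D' \<in> SS \<int> E ?m ?n"
    unfolding D_def D'_def by (rule det_in_subring[OF RZ], rule G(1), rule ea, assumption)
      (rule det_in_subring[OF RZ], rule H(1), rule eb, assumption)
  have "vsign M * vsign N \<in> C"
    using vsign_cases[of M, where 'l = 'l] vsign_cases[of N, where 'l = 'l] is_subringD[OF C(1)] by auto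
  then have cc: "c * (vsign M * vsign N) \<in> C" using is_subringD(4)[OF C(1)] Bset_step.hyps(2) by blast
  \<comment> \<open>The constants \<open>vsign M\<close> and \<open>vsign N\<close> are the signs
    that \<open>det_gsum_weights\<close> attaches to the two determinants.\<close>
  define \<eta> where "\<eta> = \<theta> + (\<lambda>_. c * (vsign M * vsign N)) * (D * D')"
  have "\<eta> \<in> AK C E ?m ?n"
    unfolding \<eta>_def
    by (intro is_subringD(4,6)[OF R] \<theta>(1) cnst_AK[OF C(1) E cc] SS_in_AK[OF C(1)] is_subringD(4)[OF RZ] DS)
  moreover have "\<eta> (res M N p) * (vdm M (xs p) * vdm N (ys p)) = Delta M N p * (\<Prod>j<N. \<Prod>i<M. ys p j - xs p i) *
      Alt M N (\<lambda>p. u p + c * Mon (vars M N) \<alpha> p) p"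
    if inj: "inj_on (\<lambda>v. nz (p v)) (vars ?m ?n)" for p
  proof -
    \<comment> \<open>The determinants are computed at \<open>q\<close>, where the nodes are
      distinct, and \<open>ssym_pairing\<close> transports the value to \<open>res M N p\<close>.
      The coordinates that \<open>res M N\<close> ignores supply the extra distinct nodes.\<close>
    define q where "q = (\<lambda>v. p (pairing M N k v))"
    have injx: "inj_on (\<lambda>v. nz (q v)) (Inl ` {..<?m})" and injy: "inj_on (\<lambda>v. nz (q v)) (Inr ` {..<?n})"
      unfolding q_def by (rule inj_on_pairing[OF inj])+
    have ix: "inj_on (xs p) {..<M}" "inj_on (ys p) {..<N}"
      by (auto intro!: inj_onI simp: xs_def ys_def inj_on_eq_iff[OF inj])
    have "vsign M * det (mat M M (\<lambda>(i,j). G (?a i j) q)) * vdm M (xs p) =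
       (\<Prod>l<M. \<Prod>j<N. xs p l - ys p j) * det (mat M M (\<lambda>(i,j). xs p j powi \<alpha> (Inl i)))"
    proof (rule det_gsum_weights[OF _ ix(1), where \<alpha> = "\<lambda>j. \<alpha> (Inl j)"])
      fix i j assume "i < M" "j < M"
      show "G (?a i j) q = (\<Sum>l<M. xs p l powi ?a i j * (\<Prod>j<N. xs p l - ys p j) / (\<Prod>k\<in>{..<M} - {l}. xs p l - xs p k))"
        using G(2)[OF ea[OF \<open>j < M\<close>] injx] gsum_level_x[OF inj] by (simp add: q_def xs_def ys_def)
    qed (simp add: xs_def)
    then have X: "vsign M * D q * vdm M (xs p) = Delta M N p * det (mat M M (\<lambda>(i,j). xs p j powi \<alpha> (Inl i)))"
      by (simp add: D_def det_fun_apply Delta_def)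
    have "vsign N * det (mat N N (\<lambda>(i,j). H (?b i j) q)) * vdm N (ys p) =
       (\<Prod>l<N. \<Prod>j<M. ys p l - xs p j) * det (mat N N (\<lambda>(i,j). ys p j powi \<alpha> (Inr i)))"
    proof (rule det_gsum_weights[OF _ ix(2), where \<alpha> = "\<lambda>j. \<alpha> (Inr j)"])
      fix i j assume "i < N" "j < N"
      show "H (?b i j) q = (\<Sum>l<N. ys p l powi ?b i j * (\<Prod>j<M. ys p l - xs p j) / (\<Prod>k\<in>{..<N} - {l}. ys p l - ys p k))"
        using H(2)[OF eb[OF \<open>j < N\<close>] injy] gsum_level_y[OF inj] by (simp add: q_def xs_def ys_def)
    qed (simp add: ys_def)
    then have Y: "vsign N * D' q * vdm N (ys p) =
        (\<Prod>j<N. \<Prod>i<M. ys p j - xs p i) * det (mat N N (\<lambda>(i,j). ys p j powi \<alpha> (Inr i)))"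
      by (simp add: D'_def det_fun_apply)
    have "\<eta> (res M N p) = \<theta> (res M N p) + c * (vsign M * vsign N) * (D q * D' q)"
      using ssym_pairing[OF DS(1)] ssym_pairing[OF DS(2)] by (simp add: \<eta>_def q_def)
    then have "\<eta> (res M N p) * (vdm M (xs p) * vdm N (ys p)) = \<theta> (res M N p) * (vdm M (xs p) * vdm N (ys p)) +
       c * (vsign M * D q * vdm M (xs p)) * (vsign N * D' q * vdm N (ys p))"
      by (simp add: algebra_simps)
    also have "\<dots> = Delta M N p * (\<Prod>j<N. \<Prod>i<M. ys p j - xs p i) * Alt M N (\<lambda>p. u p + c * Mon (vars M N) \<alpha> p) p"
      unfolding X Y \<theta>(2)[OF inj] Alt_add Alt_Mon by (simp add: algebra_simps)
    finally show ?thesis .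
  qed
  ultimately show ?case by blast
qed

section \<open>Chains of radical ideals\<close>

text \<open>Ideals of \<open>A\<close> closed under square roots, which is the form in which the
  chain argument uses radicality; closure under higher roots follows by halving exponents.\<close>

definition rad_in :: "'r::comm_ring_1 set \<Rightarrow> 'r set \<Rightarrow> bool" where
  "rad_in A R \<longleftrightarrow> R \<subseteq> A \<and> 0 \<in> R \<and> (\<forall>f\<in>R. \<forall>g\<in>R. f + g \<in> R) \<and> (\<forall>a\<in>A. \<forall>f\<in>R. a * f \<in> R) \<and>
     (\<forall>f\<in>A. f * f \<in> R \<longrightarrow> f \<in> R)"

lemma rad_inD:
  assumes "rad_in A R"
  shows "f \<in> R \<Longrightarrow> f \<in> A" "0 \<in> R" "f \<in> R \<Longrightarrow> g \<in> R \<Longrightarrow> f + g \<in> R" "a \<in> A \<Longrightarrow> f \<in> R \<Longrightarrow> a * f \<in> R"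
    "f \<in> A \<Longrightarrow> f * f \<in> R \<Longrightarrow> f \<in> R"
proof -
  note r = assms[unfolded rad_in_def]
  note a = conjunct1[OF r] and z = conjunct1[OF conjunct2[OF r]] and p = conjunct1[OF conjunct2[OF conjunct2[OF r]]]
    and m = conjunct1[OF conjunct2[OF conjunct2[OF conjunct2[OF r]]]] and s = conjunct2[OF conjunct2[OF conjunct2[OF conjunct2[OF r]]]]
  show "f \<in> R \<Longrightarrow> f \<in> A" by (rule subsetD[OF a])
  show "0 \<in> R" by (rule z)
  show "f \<in> R \<Longrightarrow> g \<in> R \<Longrightarrow> f + g \<in> R" by (rule p[rule_format])
  show "a \<in> A \<Longrightarrow> f \<in> R \<Longrightarrow> a * f \<in> R" by (rule m[rule_format])
  show "f \<in> A \<Longrightarrow> f * f \<in> R \<Longrightarrow> f \<in> R" by (rule s[rule_format])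
qed

lemma rad_in_sum:
  assumes "rad_in A R" "\<And>i. i \<in> I \<Longrightarrow> f i \<in> R" shows "sum f I \<in> R"
  using assms(2)
  by (induction I rule: infinite_finite_induct) (simp_all add: rad_inD(2,3)[OF assms(1)])

lemma res_map_sum:
  assumes "\<sigma> permutes {..<M}" "\<tau> permutes {..<N}"
  shows "res M N (\<lambda>v. p (map_sum \<sigma> \<tau> v)) = (\<lambda>v. res M N p (map_sum \<sigma> \<tau> v))"
proof
  fix v show "res M N (\<lambda>v. p (map_sum \<sigma> \<tau> v)) v = res M N p (map_sum \<sigma> \<tau> v)"
    using permutes_in_image[OF assms(1)] permutes_in_image[OF assms(2)]
    by (cases v) (simp_all add: res_def)
qed

lemma SS_res_invariant:
  assumes f: "f \<in> SS C E m n" and MN: "M \<le> m" "N \<le> n" and st: "\<sigma> permutes {0..<M}" "\<tau> permutes {0..<N}"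
  shows "f (res M N (\<lambda>v. p (map_sum \<sigma> \<tau> v))) = f (res M N p)"
proof -
  have st': "\<sigma> permutes {..<M}" "\<tau> permutes {..<N}" using st by (simp_all add: atLeast0LessThan)
  have "\<sigma> permutes {..<m}" "\<tau> permutes {..<n}"
    using MN by (auto intro: permutes_subset[OF st'(1)] permutes_subset[OF st'(2)])
  with f show ?thesis unfolding res_map_sum[OF st'] SS_def Winv_def by blast
qed

lemma Delta_invariant:
  assumes st: "\<sigma> permutes {0..<M}" "\<tau> permutes {0..<N}"
  shows "Delta M N (\<lambda>v. p (map_sum \<sigma> \<tau> v)) = Delta M N p"
proof -
  have "Delta M N (\<lambda>v. p (map_sum \<sigma> \<tau> v)) = (\<Prod>i<M. \<Prod>j<N. xs p (\<sigma> i) - ys p (\<tau> j))"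
    by (simp add: Delta_def xs_def ys_def)
  also have "\<dots> = (\<Prod>i<M. \<Prod>j<N. xs p (\<sigma> i) - ys p j)"
    using prod.permute[OF st(2), where g = "\<lambda>j. xs p (\<sigma> i) - ys p j" for i]
    by (simp add: atLeast0LessThan comp_def)
  also have "\<dots> = Delta M N p"
    using prod.permute[OF st(1), where g = "\<lambda>i. \<Prod>j<N. xs p i - ys p j"]
    by (simp add: atLeast0LessThan comp_def Delta_def)
  finally show ?thesis .
qed

lemma Delta_swap: "(\<Prod>j<N. \<Prod>i<M. ys p j - xs p i) = (- 1) ^ (M * N) * Delta M N p"
proof -
  have "(\<Prod>j<N. \<Prod>i<M. ys p j - xs p i) = (\<Prod>i<M. \<Prod>j<N. ys p j - xs p i)" by (rule prod.swap)
  also have "\<dots> = (\<Prod>i<M. \<Prod>j<N. (- 1) * (xs p i - ys p j))" by simp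
  also have "\<dots> = (- 1) ^ (M * N) * Delta M N p"
    by (simp only: prod.distrib prod_constant card_lessThan Delta_def power_mult) (simp add: power_mult mult.commute flip: power_mult)
  finally show ?thesis .
qed

lemma Alt_staircase:
  "Alt M N (Mon (vars M N) (\<lambda>v. case v of Inl i \<Rightarrow> int i | Inr j \<Rightarrow> int j)) p = vdm M (xs p) * vdm N (ys p)"
  using Alt_Mon[of M N 1 "\<lambda>v. case v of Inl i \<Rightarrow> int i | Inr j \<Rightarrow> int j" p]
  by (simp add: det_vandermonde)

lemma Alt_sum: "Alt M N (\<lambda>p. \<Sum>i\<in>I. u i p) p = (\<Sum>i\<in>I. Alt M N (u i) p)"
  by (induction I rule: infinite_finite_induct) (simp_all add: Alt_zero Alt_add)

text \<open>The condition on \<open>e\<close> is divisibility of its restriction by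
  \<open>Delta\<close>, a form that fits both uses: kernel elements of the next specialisation, by
  \<open>res_kernel_divide\<close>, and \<open>e = 1\<close> when \<open>Delta\<close> is an empty
  product.\<close>

lemma acc_step:
  fixes C :: "'l::field_char_0 set" and R :: "nat \<Rightarrow> ((nat + nat \<Rightarrow> 'l) \<Rightarrow> 'l) set"
  assumes C: "is_subring C" "\<int> \<subseteq> C" "noeth C" and E: "exponents E"
    and R: "\<And>j. rad_in (AK C E (M + k) (N + k)) (R j)" "\<And>i j. i \<le> j \<Longrightarrow> R i \<subseteq> R j"
    and IH: "\<And>j f e. f \<in> R j \<Longrightarrow> e \<in> AK C E (M + k) (N + k) \<Longrightarrow> (\<And>p. e (res M N p) = 0) \<Longrightarrow> e * f \<in> R N0"
  shows "\<exists>N1. \<forall>j f e. f \<in> R j \<longrightarrow> e \<in> AK C E (M + k) (N + k) \<longrightarrow>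
    (\<exists>b\<in>Bset C E (vars M N). \<forall>p. e (res M N p) = Delta M N p * b p) \<longrightarrow> e * f \<in> R N1"
proof -
  let ?m = "M + k" and ?n = "N + k"
  let ?A = "AK C E ?m ?n" and ?V = "vars ?m ?n" and ?B = "Bset C E (vars M N)"
  note RA = is_subring_AK[OF C(1) E, of ?m ?n] and RB = is_subring_Bset[OF C(1) E, of "vars M N"]
  have AS: "f \<in> SS C E ?m ?n" if "f \<in> ?A" for f using AK_subset_SS[OF C(1,2) E] that by blast
  have AB: "f \<in> Bset C E ?V" if "f \<in> ?A" for f using AS[OF that] by (simp add: SS_def)
  define \<phi> where "\<phi> = (\<lambda>(f :: (nat + nat \<Rightarrow> 'l) \<Rightarrow> 'l) p. f (res M N p))"
  have \<phi>B: "\<phi> f \<in> ?B" if "f \<in> ?A" for f unfolding \<phi>_def by (rule Bset_res[OF C(1) E AB[OF that]])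
  have RjA: "f \<in> ?A" if "f \<in> R j" for f j using rad_inD(1)[OF R(1) that] .
  have "\<phi> ` (\<Union>j. R j) \<subseteq> ?B" using \<phi>B RjA by blast
  from noeth_finitely_generated[OF noeth_Bset[OF C(1,3) E finite_vars] this]
  obtain F where F: "F \<subseteq> \<phi> ` (\<Union>j. R j)" "finite F" "\<phi> ` (\<Union>j. R j) \<subseteq> lspan ?B F" by blast
  from finite_subset_image[OF F(2,1)] obtain T where T: "T \<subseteq> (\<Union>j. R j)" "finite T" "F = \<phi> ` T" by blast
  \<comment> \<open>Finitely many lifts generate the ideal of all restrictions, and since the chain
    increases, a single member contains them all.\<close>
  have "\<exists>Na. T \<subseteq> R Na" using T(2,1)
  proof (induction T rule: finite_induct)
    case (insert x T)
    then obtain Na j where Na: "T \<subseteq> R Na" "x \<in> R j" by blast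
    have "T \<subseteq> R (max Na j)" "x \<in> R (max Na j)"
      using Na R(2)[OF max.cobounded1[of Na j]] R(2)[OF max.cobounded2[of j Na]] by blast+
    then show ?case by blast
  qed blast
  then obtain Na where Na: "T \<subseteq> R Na" by blast
  let ?N1 = "max Na N0"
  have "e * f \<in> R ?N1" if f: "f \<in> R j" and e: "e \<in> ?A" and b: "b \<in> ?B" "\<And>p. e (res M N p) = Delta M N p * b p" for j f e b
  proof -
    have fA: "f \<in> ?A" using RjA[OF f] .
    have "\<phi> f \<in> lspan ?B (\<phi> ` T)" using F(3) T(3) f by blast
    from lspan_image[OF this T(2) RB] obtain c where c: "\<And>\<rho>. c \<rho> \<in> ?B" "\<phi> f = (\<Sum>\<rho>\<in>T. c \<rho> * \<phi> \<rho>)" by blast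
    define \<delta> :: "(nat + nat \<Rightarrow> 'l) \<Rightarrow> 'l" where "\<delta> = Mon (vars M N) (\<lambda>v. case v of Inl i \<Rightarrow> int i | Inr j \<Rightarrow> int j)"
    have \<delta>B: "\<delta> \<in> ?B"
      using Bset_Mon[OF is_subringD(1)[OF C(1)], of "\<lambda>v. case v of Inl i \<Rightarrow> int i | Inr j \<Rightarrow> int j" "vars M N" E]
        exponentsD(4)[OF E] by (auto simp: \<delta>_def image_subset_iff split: sum.splits)
    \<comment> \<open>The factor \<open>b * b\<close> completes the square of \<open>Delta\<close>
      to the square of the restriction of \<open>e\<close>. The monomial \<open>\<delta>\<close>
      makes the alternating sum of an invariant multiple equal to that multiple of the Vandermonde
      product.\<close>
    define u where "u = (\<lambda>\<rho>. b * b * c \<rho> * \<delta>)"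
    have "u \<rho> \<in> ?B" for \<rho> unfolding u_def by (intro is_subringD(4)[OF RB] b(1) c(1) \<delta>B)
    then have "\<forall>\<rho>. \<exists>\<theta>\<in>?A. \<forall>p. inj_on (\<lambda>v. nz (p v)) ?V \<longrightarrow> \<theta> (res M N p) * (vdm M (xs p) * vdm N (ys p)) =
       Delta M N p * (\<Prod>j<N. \<Prod>i<M. ys p j - xs p i) * Alt M N (u \<rho>) p"
      using Alt_lift[OF C(1,2) E] by blast
    then obtain \<theta> where \<theta>: "\<And>\<rho>. \<theta> \<rho> \<in> ?A" "\<And>\<rho> p. inj_on (\<lambda>v. nz (p v)) ?V \<Longrightarrow>
       \<theta> \<rho> (res M N p) * (vdm M (xs p) * vdm N (ys p)) = Delta M N p * (\<Prod>j<N. \<Prod>i<M. ys p j - xs p i) * Alt M N (u \<rho>) p"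
      by metis
    \<comment> \<open>The sign that turns the product of all \<open>y\<^sub>j - x\<^sub>i\<close>
      into \<open>Delta\<close>.\<close>
    define \<epsilon> :: 'l where "\<epsilon> = (- 1) ^ (M * N)"
    have \<epsilon>: "\<epsilon> * \<epsilon> = 1" "\<epsilon> \<in> C"
      using is_subringD[OF C(1)] by (auto simp: \<epsilon>_def minus_one_power_iff)
    have \<epsilon>A: "(\<lambda>_. \<epsilon>) \<in> ?A" by (rule cnst_AK[OF C(1) E \<epsilon>(2)])
    define S where "S = (\<Sum>\<rho>\<in>T. \<theta> \<rho> * \<rho>)"
    have TA: "\<rho> \<in> ?A" if "\<rho> \<in> T" for \<rho> using RjA[OF subsetD[OF Na that]] .
    have SA: "S \<in> ?A" unfolding S_def
      by (rule is_subring_sum[OF RA], rule is_subringD(4)[OF RA \<theta>(1) TA])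
    \<comment> \<open>The error of the relation in \<open>A\<close>. It restricts to zero, so the
      induction hypothesis applies to it as a new \<open>e\<close>.\<close>
    define Z where "Z = (\<lambda>_. \<epsilon>) * (e * e * f) - S"
    have ZA: "Z \<in> ?A" unfolding Z_def by (intro is_subringD(3,4)[OF RA] \<epsilon>A e fA SA)
    have "Z (res M N p) = 0" for p
    proof (rule Bset_density[where f = "\<lambda>p. Z (res M N p)" and U = ?V])
      show "(\<lambda>p. Z (res M N p)) \<in> Bset C E (vars M N)" by (rule Bset_res[OF C(1) E AB[OF ZA]])
      fix p :: "nat + nat \<Rightarrow> 'l" assume inj: "inj_on (\<lambda>v. nz (p v)) ?V"
      let ?vv = "vdm M (xs p) * vdm N (ys p)"
      have v0: "?vv \<noteq> 0" by (auto simp: vdm_def xs_def ys_def inj_on_eq_iff[OF inj])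
      have D0: "Delta M N p \<noteq> 0" by (auto simp: Delta_def xs_def ys_def inj_on_eq_iff[OF inj])
      have inv: "\<phi> g (\<lambda>v. p (map_sum \<sigma> \<tau> v)) = \<phi> g p" if "g \<in> ?A" "\<sigma> permutes {0..<M}" "\<tau> permutes {0..<N}" for g \<sigma> \<tau>
        unfolding \<phi>_def by (rule SS_res_invariant[OF AS[OF that(1)] _ _ that(2,3)]) auto
      \<comment> \<open>\<open>b\<close> inherits the invariance of \<open>e\<close> and
        \<open>Delta\<close> by cancellation, which is possible because \<open>Delta\<close> is
        nonzero at a generic point. Hence \<open>Alt_cmult\<close> can pull \<open>b\<close> out of
        the alternating sum.\<close>
      have binv: "b (\<lambda>v. p (map_sum \<sigma> \<tau> v)) = b p" if "\<sigma> permutes {0..<M}" "\<tau> permutes {0..<N}" for \<sigma> \<tau>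
        using inv[OF e that] b(2)[of p] b(2)[of "\<lambda>v. p (map_sum \<sigma> \<tau> v)"] Delta_invariant[OF that, of p] D0
        by (simp add: \<phi>_def)
      have "S (res M N p) * ?vv = (\<Sum>\<rho>\<in>T. \<phi> \<rho> p * (\<theta> \<rho> (res M N p) * ?vv))"
      proof -
        have "(\<Sum>\<rho>\<in>T. \<theta> \<rho> * \<rho>) q = (\<Sum>\<rho>\<in>T. \<theta> \<rho> q * \<rho> q)" for q
          by (induction T rule: infinite_finite_induct) auto
        then show ?thesis by (simp add: S_def \<phi>_def sum_distrib_left sum_distrib_right mult_ac)
      qed
      also have "\<dots> = Delta M N p * (\<epsilon> * Delta M N p) * (\<Sum>\<rho>\<in>T. \<phi> \<rho> p * Alt M N (u \<rho>) p)"
        unfolding \<theta>(2)[OF inj] Delta_swap \<epsilon>_def[symmetric] by (simp add: sum_distrib_left mult_ac)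
      also have "(\<Sum>\<rho>\<in>T. \<phi> \<rho> p * Alt M N (u \<rho>) p) = (\<Sum>\<rho>\<in>T. Alt M N (\<lambda>p. \<phi> \<rho> p * u \<rho> p) p)"
      proof (rule sum.cong[OF refl])
        fix \<rho> assume "\<rho> \<in> T"
        then have "\<rho> \<in> ?A" using Na RjA by blast
        then show "\<phi> \<rho> p * Alt M N (u \<rho>) p = Alt M N (\<lambda>p. \<phi> \<rho> p * u \<rho> p) p"
          using inv by (intro Alt_cmult[symmetric]) auto
      qed
      also have "\<dots> = Alt M N (\<lambda>p. b p * b p * \<phi> f p * \<delta> p) p"
      proof -
        have "\<phi> f q = (\<Sum>\<rho>\<in>T. c \<rho> q * \<phi> \<rho> q)" for q
        proof -
          have "(\<Sum>\<rho>\<in>T. c \<rho> * \<phi> \<rho>) q = (\<Sum>\<rho>\<in>T. c \<rho> q * \<phi> \<rho> q)"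
            by (induction T rule: infinite_finite_induct) auto
          then show ?thesis by (simp add: c(2))
        qed
        then have "(\<lambda>p. b p * b p * \<phi> f p * \<delta> p) = (\<lambda>p. \<Sum>\<rho>\<in>T. \<phi> \<rho> p * u \<rho> p)"
          by (simp add: u_def sum_distrib_left sum_distrib_right mult_ac)
        then show ?thesis by (simp add: Alt_sum)
      qed
      also have "\<dots> = b p * b p * \<phi> f p * Alt M N \<delta> p"
        using binv inv[OF fA] by (intro Alt_cmult) simp
      also have "Alt M N \<delta> p = ?vv" unfolding \<delta>_def by (rule Alt_staircase)
      finally have "S (res M N p) * ?vv = \<epsilon> * ((Delta M N p * b p) * (Delta M N p * b p) * \<phi> f p) * ?vv"
        by (simp add: mult_ac)
      then have "S (res M N p) = \<epsilon> * (e (res M N p) * e (res M N p) * f (res M N p))"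
        using v0 by (simp add: b(2) \<phi>_def)
      then show "Z (res M N p) = 0" by (simp add: Z_def)
    qed simp_all
    then have Zf: "Z * f \<in> R ?N1"
      using IH[OF f ZA] R(2)[of N0 ?N1] by auto
    have "S \<in> R ?N1" unfolding S_def
      by (rule rad_in_sum[OF R(1)], rule rad_inD(4)[OF R(1) \<theta>(1)], rule subsetD[OF R(2)[of Na ?N1]])
         (use Na in auto)
    then have "f * S \<in> R ?N1" using rad_inD(4)[OF R(1) fA] by blast
    with Zf have "Z * f + f * S \<in> R ?N1" using rad_inD(3)[OF R(1)] by blast
    \<comment> \<open>In \<open>Z * f + f * S\<close> the sum \<open>S\<close> drops out and
      \<open>\<epsilon>\<close> times the square of \<open>e * f\<close> remains. Since
      \<open>\<epsilon> * \<epsilon> = 1\<close>, that square lies in the ideal, and radicality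
      gives \<open>e * f\<close>.\<close>
    then have "(\<lambda>_. \<epsilon>) * (Z * f + f * S) \<in> R ?N1" using rad_inD(4)[OF R(1) \<epsilon>A] by blast
    also have "(\<lambda>_. \<epsilon>) * (Z * f + f * S) = (e * f) * (e * f)"
    proof
      fix p
      have "((\<lambda>_. \<epsilon>) * (Z * f + f * S)) p = (\<epsilon> * \<epsilon>) * (e p * f p * (e p * f p))"
        by (simp add: Z_def algebra_simps)
      then show "((\<lambda>_. \<epsilon>) * (Z * f + f * S)) p = ((e * f) * (e * f)) p" by (simp add: \<epsilon>(1))
    qed
    finally show ?thesis
      using rad_inD(5)[OF R(1)] is_subringD(4)[OF RA e fA] by blast
  qed
  then show ?thesis by blast
qed

text \<open>If some \<open>x\<^sub>i\<close> equals some \<open>y\<^sub>j\<close>, a permutation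
  moves this pair to the last position and supersymmetry replaces it by 1, where \<open>e\<close>
  vanishes by assumption. So the restriction vanishes on all these loci, and
  \<open>Bset_divide\<close> extracts their product.\<close>

lemma res_kernel_divide:
  fixes C :: "'l::field_char_0 set"
  assumes C: "is_subring C" and E: "exponents E" and e: "e \<in> SS C E m n"
    and MN: "Suc M \<le> m" "Suc N \<le> n" and z: "\<And>p. e (res M N p) = 0"
  shows "\<exists>b\<in>Bset C E (vars (Suc M) (Suc N)). \<forall>p. e (res (Suc M) (Suc N) p) = Delta (Suc M) (Suc N) p * b p"
proof -
  let ?S = "(Inl ` {..<Suc M} \<times> Inr ` {..<Suc N}) :: ((nat + nat) \<times> (nat + nat)) set"
  let ?V = "vars (Suc M) (Suc N)"
  have W: "Winv m n e" and s: "ssym m n e" and B: "e \<in> Bset C E (vars m n)" using e by (auto simp: SS_def)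
  have vanish: "e (res (Suc M) (Suc N) p) = 0"
    if ij: "i < Suc M" "j < Suc N" and eq: "nz (p (Inl i)) = nz (p (Inr j))" for p :: "nat + nat \<Rightarrow> 'l" and i j
  proof -
    let ?\<sigma> = "transpose i M" and ?\<tau> = "transpose j N"
    have st: "?\<sigma> permutes {..<Suc M}" "?\<tau> permutes {..<Suc N}"
      using ij by (auto intro!: permutes_swap_id)
    define q where "q = (\<lambda>v. p (map_sum ?\<sigma> ?\<tau> v))"
    have "e (res (Suc M) (Suc N) q) = e (res (Suc M) (Suc N) p)"
      unfolding q_def
      by (rule SS_res_invariant[OF e MN]) (use st in \<open>simp_all add: atLeast0LessThan\<close>)
    moreover have "e (res (Suc M) (Suc N) q) = e (res M N q)"
    proof (rule ssymD[OF s, of M N])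
      show "nz (res (Suc M) (Suc N) q (Inl M)) = nz (res (Suc M) (Suc N) q (Inr N))"
        using eq by (simp add: res_def q_def)
      fix v :: "nat + nat" assume "v \<noteq> Inl M" "v \<noteq> Inr N"
      then show "nz (res (Suc M) (Suc N) q v) = nz (res M N q v)"
        by (cases v) (auto simp: res_def less_Suc_eq)
    qed (use MN in \<open>auto simp: res_def\<close>)
    ultimately show ?thesis using z by simp
  qed
  have "\<exists>b\<in>Bset C E ?V. \<forall>p. e (res (Suc M) (Suc N) p) = (\<Prod>(v,w)\<in>?S. nz (p v) - nz (p w)) * b p"
    by (rule Bset_divide[OF C E finite_vars Bset_res[OF C E B], of ?S "Inl ` {..<Suc M}" "Inr ` {..<Suc N}"])
       (use vanish in \<open>auto simp: vars_def\<close>)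
  moreover have "(\<Prod>(v,w)\<in>?S. nz (p v) - nz (p w)) = Delta (Suc M) (Suc N) p" for p :: "nat + nat \<Rightarrow> 'l"
    by (simp add: prod.cartesian_product[symmetric] prod.reindex Delta_def xs_def ys_def)
  ultimately show ?thesis by simp
qed

theorem acc_AK:
  fixes C :: "'l::field_char_0 set"
  assumes C: "is_subring C" "\<int> \<subseteq> C" "noeth C" and E: "exponents E"
    and R: "\<And>j. rad_in (AK C E m n) (R j)" "\<And>j. R j \<subseteq> R (Suc j)"
  shows "\<exists>N. \<forall>j\<ge>N. R j = R N"
proof -
  let ?A = "AK C E m n"
  note RA = is_subring_AK[OF C(1) E, of m n]
  have mono: "R i \<subseteq> R j" if "i \<le> j" for i j using that R(2) by (rule lift_Suc_mono_le[rotated])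
  have AS: "f \<in> SS C E m n" if "f \<in> ?A" for f using AK_subset_SS[OF C(1,2) E] that by blast
  \<comment> \<open>After \<open>r\<close> pairs one group of variables is exhausted,
    \<open>Delta\<close> is an empty product, and \<open>acc_step\<close> applies to
    \<open>e = 1\<close>.\<close>
  define r where "r = min m n"
  have "k \<le> r \<Longrightarrow> \<exists>N0. \<forall>j f e. f \<in> R j \<longrightarrow> e \<in> ?A \<longrightarrow> (\<forall>p. e (res (m - k) (n - k) p) = 0) \<longrightarrow> e * f \<in> R N0" for k
  proof (induction k)
    case 0
    have "e * f \<in> R 0" if "e \<in> ?A" "\<And>p. e (res m n p) = 0" for e f
    proof -
      have "e p = 0" for p
        using Bset_local[of e C E "vars m n" p "res m n p"] AS[OF that(1)] that(2)[of p] by (simp add: SS_def res_def)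
      then have "e * f = 0" by auto
      then show ?thesis using rad_inD(2)[OF R(1)] by simp
    qed
    then show ?case unfolding diff_zero by blast
  next
    case (Suc k)
    then obtain N0 where N0: "\<And>j f e. f \<in> R j \<Longrightarrow> e \<in> ?A \<Longrightarrow> (\<And>p. e (res (m - k) (n - k) p) = 0) \<Longrightarrow> e * f \<in> R N0"
      by fastforce
    \<comment> \<open>The numbers of variables left after \<open>k + 1\<close> specialisations.
      \<open>acc_step\<close> works one level earlier, with \<open>Suc M\<close> and
      \<open>Suc N\<close>, while the kernel condition on \<open>e\<close> refers to
      \<open>M\<close> and \<open>N\<close>.\<close>
    define M N where "M = m - Suc k" and "N = n - Suc k"
    have eq: "m - k = Suc M" "n - k = Suc N" "Suc M + k = m" "Suc N + k = n"
      using Suc.prems by (auto simp: M_def N_def r_def)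
    note step = acc_step[OF C E, where M = "Suc M" and N = "Suc N" and k = k and R = R and ?N0.0 = N0, unfolded eq(3,4)]
    have "\<exists>N1. \<forall>j f e. f \<in> R j \<longrightarrow> e \<in> ?A \<longrightarrow>
      (\<exists>b\<in>Bset C E (vars (Suc M) (Suc N)). \<forall>p. e (res (Suc M) (Suc N) p) = Delta (Suc M) (Suc N) p * b p) \<longrightarrow> e * f \<in> R N1"
      by (rule step[OF R(1) mono N0[unfolded eq]]) assumption+
    then obtain N1 where N1: "\<And>j f e. f \<in> R j \<Longrightarrow> e \<in> ?A \<Longrightarrow>
      (\<exists>b\<in>Bset C E (vars (Suc M) (Suc N)). \<forall>p. e (res (Suc M) (Suc N) p) = Delta (Suc M) (Suc N) p * b p) \<Longrightarrow> e * f \<in> R N1"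
      by blast
    have "e * f \<in> R N1" if "f \<in> R j" "e \<in> ?A" "\<And>p. e (res M N p) = 0" for j f e
      by (rule N1[OF that(1,2) res_kernel_divide[OF C(1) E AS[OF that(2)] _ _ that(3)]])
         (use eq in auto)
    then show ?case unfolding M_def[symmetric] N_def[symmetric] by blast
  qed
  from this[OF order_refl] obtain N0 where N0: "\<And>j f e. f \<in> R j \<Longrightarrow> e \<in> ?A \<Longrightarrow> (\<And>p. e (res (m - r) (n - r) p) = 0) \<Longrightarrow> e * f \<in> R N0"
    by fastforce
  have eq: "m - r + r = m" "n - r + r = n" "m - r = 0 \<or> n - r = 0" by (auto simp: r_def)
  note step = acc_step[OF C E, where M = "m - r" and N = "n - r" and k = r and R = R and ?N0.0 = N0, unfolded eq(1,2)]
  have "\<exists>N1. \<forall>j f e. f \<in> R j \<longrightarrow> e \<in> ?A \<longrightarrow>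
      (\<exists>b\<in>Bset C E (vars (m - r) (n - r)). \<forall>p. e (res (m - r) (n - r) p) = Delta (m - r) (n - r) p * b p) \<longrightarrow> e * f \<in> R N1"
    by (rule step[OF R(1) mono N0]) assumption+
  then obtain N1 where N1: "\<And>j f e. f \<in> R j \<Longrightarrow> e \<in> ?A \<Longrightarrow>
      (\<exists>b\<in>Bset C E (vars (m - r) (n - r)). \<forall>p. e (res (m - r) (n - r) p) = Delta (m - r) (n - r) p * b p) \<Longrightarrow> e * f \<in> R N1"
    by blast
  have "f \<in> R N1" if "f \<in> R j" for j f
  proof -
    have D: "Delta (m - r) (n - r) p = 1" for p :: "nat + nat \<Rightarrow> 'l" using eq(3) by (auto simp: Delta_def)
    have "\<exists>b\<in>Bset C E (vars (m - r) (n - r)). \<forall>p. (1 :: (nat + nat \<Rightarrow> 'l) \<Rightarrow> 'l) (res (m - r) (n - r) p) = Delta (m - r) (n - r) p * b p"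
      using is_subringD(1)[OF is_subring_Bset[OF C(1) E]] by (intro bexI[of _ 1]) (auto simp: D)
    then have "1 * f \<in> R N1" by (rule N1[OF that is_subringD(1)[OF RA]])
    then show ?thesis by simp
  qed
  then have "R j = R N1" if "j \<ge> N1" for j using mono[OF that] by blast
  then show ?thesis by blast
qed

section \<open>Radical ideals as finite intersections of primes\<close>

context cring
begin

text \<open>From exponent N one descends to k, half of N rounded up: the power with exponent 2k is a
  multiple of the one with exponent N and is the square of the k-th power. The descent is strict for
  N > 1.\<close>

lemma pow_mem_square_closed:
  assumes sq: "\<And>f. f \<in> carrier R \<Longrightarrow> f \<otimes> f \<in> I \<Longrightarrow> f \<in> I" and I: "ideal I R"
    and f: "f \<in> carrier R" and "f [^] (N::nat) \<in> I" "N > 0"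
  shows "f \<in> I"
  using assms(4,5)
proof (induction N rule: less_induct)
  case (less N)
  show ?case
  proof (cases "N = 1")
    case True
    then show ?thesis using less.prems f by simp
  next
    case False
    define k where "k = (N + 1) div 2"
    have k: "k < N" "k > 0" "k + k = N + (k + k - N)" using False less.prems by (auto simp: k_def)
    have "f [^] N \<otimes> f [^] (k + k - N) \<in> I"
      using less.prems f by (intro ideal.I_r_closed[OF I]) auto
    then have "f [^] k \<otimes> f [^] k \<in> I" using f k(3) by (simp add: nat_pow_mult)
    then have "f [^] k \<in> I" using sq f by blast
    with less.IH k show ?thesis by blast
  qed
qed

lemma radical_idealI:
  assumes I: "ideal I R" and "\<And>f. f \<in> carrier R \<Longrightarrow> f \<otimes> f \<in> I \<Longrightarrow> f \<in> I"
  shows "radical_ideal I R"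
  unfolding radical_ideal_def
proof (intro conjI I equalityI subsetI)
  fix f assume f: "f \<in> I"
  have "f \<in> carrier R" using ideal.Icarr[OF I f] .
  then show "f \<in> {f \<in> carrier R. \<exists>N::nat. N > 0 \<and> f [^] N \<in> I}"
    using f by (auto intro!: exI[of _ "1::nat"])
qed (use pow_mem_square_closed[OF assms(2) I] in blast)

lemma radical_idealD:
  assumes "radical_ideal I R" shows "ideal I R" "f \<in> carrier R \<Longrightarrow> f \<otimes> f \<in> I \<Longrightarrow> f \<in> I"
proof -
  show I: "ideal I R" using assms by (simp add: radical_ideal_def)
  assume f: "f \<in> carrier R" "f \<otimes> f \<in> I"
  then have "f [^] (2::nat) \<in> I" by (simp add: numeral_2_eq_2)
  with f(1) have "f \<in> {f \<in> carrier R. \<exists>N::nat. N > 0 \<and> f [^] N \<in> I}" by (auto intro!: exI[of _ "2::nat"])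
  with assms show "f \<in> I" unfolding radical_ideal_def by blast
qed

text \<open>If the square of \<open>f\<close> times \<open>g\<close> lies in \<open>M\<close>, so
  does its multiple, the square of \<open>f \<otimes> g\<close>; radicality of \<open>M\<close> then
  gives \<open>f \<otimes> g\<close>.\<close>

lemma radical_colon:
  assumes M: "radical_ideal M R" and S: "S \<subseteq> carrier R"
  shows "radical_ideal {f \<in> carrier R. \<forall>g\<in>S. f \<otimes> g \<in> M} R"
proof -
  note I = radical_idealD(1)[OF M]
  interpret M: ideal M R by (rule I)
  let ?J = "{f \<in> carrier R. \<forall>g\<in>S. f \<otimes> g \<in> M}"
  have "ideal ?J R"
  proof (rule idealI[OF ring_axioms])
    show "subgroup ?J (add_monoid R)"
    proof (rule add.subgroupI)
      have "\<zero> \<in> ?J" using S by (auto simp: subset_eq)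
      then show "?J \<noteq> {}" by blast
    next
      fix a assume "a \<in> ?J"
      then show "\<ominus> a \<in> ?J" using S by (auto simp: l_minus subset_eq)
    next
      fix a b assume "a \<in> ?J" "b \<in> ?J"
      then show "a \<oplus> b \<in> ?J" using S by (auto simp: l_distr subset_eq)
    qed auto
  next
    fix a x assume a: "a \<in> ?J" "x \<in> carrier R"
    have "x \<otimes> a \<otimes> g \<in> M" if "g \<in> S" for g
    proof -
      have "g \<in> carrier R" using S that by blast
      then have "x \<otimes> a \<otimes> g = x \<otimes> (a \<otimes> g)" using a by (simp add: m_assoc)
      then show ?thesis using a that by (simp add: M.I_l_closed)
    qed
    then show "x \<otimes> a \<in> ?J" using a by simp
    then show "a \<otimes> x \<in> ?J" using a by (simp add: m_comm)
  qed
  then show ?thesis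
  proof (rule radical_idealI)
    fix f assume f: "f \<in> carrier R" "f \<otimes> f \<in> ?J"
    have "f \<otimes> g \<in> M" if "g \<in> S" for g
    proof (rule radical_idealD(2)[OF M])
      have g: "g \<in> carrier R" using S that by blast
      then show "f \<otimes> g \<in> carrier R" using f by simp
      have "f \<otimes> f \<otimes> g \<in> M" using f that by blast
      then have "f \<otimes> f \<otimes> g \<otimes> g \<in> M" using g by (rule M.I_r_closed)
      moreover have "f \<otimes> f \<otimes> g \<otimes> g = f \<otimes> g \<otimes> (f \<otimes> g)" using f g by algebra
      ultimately show "f \<otimes> g \<otimes> (f \<otimes> g) \<in> M" by simp
    qed
    then show "f \<in> ?J" using f by simp
  qed
qed

text \<open>For a product of \<open>a\<close> and \<open>b\<close> in \<open>M\<close> with neither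
  factor in \<open>M\<close>, take \<open>J1 = (M : a)\<close>, which contains \<open>b\<close>, and
  \<open>J2 = (M : J1)\<close>, which contains \<open>a\<close>. An element of both has its square
  in \<open>M\<close>. Colon ideals are already radical, so no radicals of sums have to be
  formed.\<close>

lemma radical_split:
  assumes M: "radical_ideal M R" and "M \<noteq> carrier R" "\<not> primeideal M R"
  shows "\<exists>J1 J2. radical_ideal J1 R \<and> radical_ideal J2 R \<and> M \<subset> J1 \<and> M \<subset> J2 \<and> M = J1 \<inter> J2"
proof -
  note I = radical_idealD(1)[OF M]
  interpret M: ideal M R by (rule I)
  obtain a b where ab: "a \<in> carrier R" "b \<in> carrier R" "a \<otimes> b \<in> M" "a \<notin> M" "b \<notin> M"
    using assms(2,3) I by (auto simp: primeideal_def primeideal_axioms_def cring_axioms)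
  define J1 where "J1 = {f \<in> carrier R. \<forall>g\<in>{a}. f \<otimes> g \<in> M}"
  define J2 where "J2 = {f \<in> carrier R. \<forall>g\<in>J1. f \<otimes> g \<in> M}"
  have r: "radical_ideal J1 R" "radical_ideal J2 R"
  proof -
    show "radical_ideal J1 R" unfolding J1_def using ab by (intro radical_colon[OF M]) simp
    show "radical_ideal J2 R" unfolding J2_def by (intro radical_colon[OF M]) (auto simp: J1_def)
  qed
  have Mc: "m \<in> carrier R" if "m \<in> M" for m using M.Icarr that by simp
  have J1: "M \<subseteq> J1" "b \<in> J1" using ab Mc by (auto simp: J1_def m_comm[of b a] intro: M.I_r_closed)
  have J2: "M \<subseteq> J2" "a \<in> J2" using ab Mc by (auto simp: J1_def J2_def m_comm[of a] intro: M.I_r_closed)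
  have "J1 \<inter> J2 \<subseteq> M"
  proof
    fix f assume "f \<in> J1 \<inter> J2"
    then have "f \<in> carrier R" "f \<otimes> f \<in> M" by (auto simp: J1_def J2_def)
    then show "f \<in> M" by (rule radical_idealD(2)[OF M])
  qed
  then have "M = J1 \<inter> J2" "M \<subset> J1" "M \<subset> J2" using J1 J2 ab by auto
  with r show ?thesis by blast
qed

text \<open>Noetherian induction: a bad ideal with no larger bad one is neither the unit ideal nor
  prime, so \<open>radical_split\<close> would exhibit it as an intersection of two good ones. Hence
  bad ideals would form a strictly increasing chain.\<close>

lemma acc_finite_prime_intersection:
  assumes acc: "acc_radical_ideals R" and I: "radical_ideal I R"
  shows "\<exists>\<P>. finite_prime_intersection R I \<P>"
proof (rule ccontr)
  define bad where "bad = (\<lambda>J. radical_ideal J R \<and> (\<nexists>\<P>. finite_prime_intersection R J \<P>))"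
  assume "\<nexists>\<P>. finite_prime_intersection R I \<P>"
  with I have "bad I" by (simp add: bad_def)
  moreover have "\<exists>J'. bad J' \<and> J \<subset> J'" if J: "bad J" for J
  proof (rule ccontr)
    assume max: "\<nexists>J'. bad J' \<and> J \<subset> J'"
    have "J \<noteq> carrier R"
    proof
      assume "J = carrier R"
      then have "finite_prime_intersection R J {}" by (simp add: finite_prime_intersection_def)
      with J show False by (auto simp: bad_def)
    qed
    moreover have "\<not> primeideal J R"
    proof
      assume p: "primeideal J R"
      then have "J \<subseteq> carrier R" using ideal.Icarr[OF primeideal.axioms(1)[OF p]] by blast
      then have "finite_prime_intersection R J {J}" using p by (auto simp: finite_prime_intersection_def)
      with J show False by (auto simp: bad_def)
    qed
    ultimately obtain J1 J2 where JJ: "radical_ideal J1 R" "radical_ideal J2 R" "J \<subset> J1" "J \<subset> J2" "J = J1 \<inter> J2"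
      using radical_split J by (metis bad_def)
    then obtain P1 P2 where P: "finite_prime_intersection R J1 P1" "finite_prime_intersection R J2 P2"
      using max by (meson bad_def)
    then have "finite_prime_intersection R J (P1 \<union> P2)"
      unfolding finite_prime_intersection_def JJ(5) by auto
    with J show False by (auto simp: bad_def)
  qed
  ultimately have "\<exists>f. \<forall>k::nat. bad (f k) \<and> f k \<subset> f (Suc k)"
    using dependent_nat_choice[of "\<lambda>_. bad" "\<lambda>_ J J'. J \<subset> J'"] by auto
  then obtain f :: "nat \<Rightarrow> 'a set" where f: "\<And>k. bad (f k)" "\<And>k. f k \<subset> f (Suc k)" by blast
  then have "\<exists>N. \<forall>k\<ge>N. f k = f N"
    using acc by (auto simp: acc_radical_ideals_def bad_def psubset_imp_subset)
  then obtain N where "\<And>k. k \<ge> N \<Longrightarrow> f k = f N" by blast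
  from this[of "Suc N"] f(2)[of N] show False by auto
qed

text \<open>Otherwise each member of the family has an element outside \<open>Q\<close>; their
  product lies in every member but, \<open>Q\<close> being prime, not in \<open>Q\<close>.\<close>

lemma prime_contains_finite_intersection:
  assumes Q: "primeideal Q R" and fin: "finite \<P>" and id: "\<And>P. P \<in> \<P> \<Longrightarrow> ideal P R"
    and sub: "carrier R \<inter> \<Inter>\<P> \<subseteq> Q"
  shows "\<exists>P\<in>\<P>. P \<subseteq> Q"
proof (rule ccontr)
  interpret Q: primeideal Q R by (rule Q)
  assume "\<not> ?thesis"
  then have no: "\<And>P. P \<in> \<P> \<Longrightarrow> \<not> P \<subseteq> Q" by blast
  have "\<exists>x\<in>carrier R. x \<notin> Q \<and> (\<forall>P\<in>\<P>. x \<in> P)"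
    using fin no id
  proof (induction \<P> rule: finite_induct)
    case empty
    then show ?case using Q.I_notcarr Q.one_imp_carrier by auto
  next
    case (insert P \<P>)
    then obtain x where x: "x \<in> carrier R" "x \<notin> Q" "\<And>P. P \<in> \<P> \<Longrightarrow> x \<in> P" by auto
    obtain y where y: "y \<in> P" "y \<notin> Q" using insert.prems(1) by blast
    have yc: "y \<in> carrier R" using ideal.Icarr[OF insert.prems(2)[of P] y(1)] by simp
    have "x \<otimes> y \<notin> Q" using Q.I_prime x y yc by blast
    moreover have "x \<otimes> y \<in> P'" if "P' \<in> insert P \<P>" for P'
    proof -
      interpret P': ideal P' R by (rule insert.prems(2)[OF that])
      from that show ?thesis
      proof
        assume "P' = P"
        then show ?thesis using P'.I_l_closed[of y x] x(1) y(1) by simp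
      next
        assume "P' \<in> \<P>"
        then show ?thesis using P'.I_r_closed[of x y] x(3) yc by simp
      qed
    qed
    ultimately show ?case using x yc by (intro bexI[of _ "x \<otimes> y"]) auto
  qed
  with sub show False by blast
qed

text \<open>Every prime over \<open>I\<close> contains a member of the given family, so the minimal
  primes are members and hence finite in number; conversely each member lies above a minimal one, so
  the others may be dropped from the intersection.\<close>

lemma finite_prime_intersection_minimal:
  assumes P: "finite_prime_intersection R I \<P>"
  shows "finite_prime_intersection R I (minimal_primes R I)"
proof -
  have fin: "finite \<P>" and pr: "\<And>P. P \<in> \<P> \<Longrightarrow> primeideal P R" and I: "I = carrier R \<inter> \<Inter>\<P>"
    using P by (auto simp: finite_prime_intersection_def)
  have above: "\<exists>P\<in>\<P>. P \<subseteq> Q" if "primeideal Q R" "I \<subseteq> Q" for Q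
  proof (rule prime_contains_finite_intersection[OF that(1) fin])
    show "ideal P R" if "P \<in> \<P>" for P using primeideal.axioms(1)[OF pr[OF that]] .
  qed (use that(2) I in simp)
  have I_sub: "I \<subseteq> P" if "P \<in> \<P>" for P using that I by blast
  have "minimal_primes R I \<subseteq> \<P>"
  proof
    fix Q assume Q: "Q \<in> minimal_primes R I"
    then obtain P where P: "P \<in> \<P>" "P \<subseteq> Q" using above[of Q] by (auto simp: minimal_primes_def)
    have "P = Q" using Q pr[OF P(1)] I_sub[OF P(1)] P(2) unfolding minimal_primes_def by blast
    then show "Q \<in> \<P>" using P(1) by simp
  qed
  moreover have "carrier R \<inter> \<Inter>(minimal_primes R I) \<subseteq> I"
  proof
    fix x assume x: "x \<in> carrier R \<inter> \<Inter>(minimal_primes R I)"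
    have "x \<in> P" if P: "P \<in> \<P>" for P
    proof -
      obtain P' where P': "P' \<in> \<P>" "P' \<subseteq> P" "\<And>P''. P'' \<in> \<P> \<Longrightarrow> P'' \<subseteq> P' \<Longrightarrow> P' = P''"
        using finite_has_minimal2[OF fin P] by blast
      have "P' \<in> minimal_primes R I"
        unfolding minimal_primes_def
      proof (intro CollectI conjI allI impI)
        fix Q assume Q: "primeideal Q R \<and> I \<subseteq> Q \<and> Q \<subseteq> P'"
        then obtain P'' where "P'' \<in> \<P>" "P'' \<subseteq> Q" using above by blast
        with P'(3)[of P''] Q show "Q = P'" by auto
      qed (use pr I_sub P' in auto)
      with x P' show "x \<in> P" by auto
    qed
    with x show "x \<in> I" by (auto simp: I)
  qed
  moreover have "I \<subseteq> carrier R \<inter> \<Inter>(minimal_primes R I)"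
    using I by (auto simp: minimal_primes_def)
  ultimately show ?thesis
    using finite_subset[OF _ fin] by (auto simp: finite_prime_intersection_def minimal_primes_def)
qed

end

section \<open>Formal integer combinations of pairs, and additive extension of functions\<close>

definition pmult :: "('a::comm_ring_1 \<times> 'k::comm_ring_1 \<Rightarrow>\<^sub>0 int) \<Rightarrow> ('a \<times> 'k \<Rightarrow>\<^sub>0 int) \<Rightarrow> ('a \<times> 'k \<Rightarrow>\<^sub>0 int)" where
  "pmult c d = frag_extend (\<lambda>(r, s). frag_extend (\<lambda>(r', s'). frag_of (r * r', s * s')) d) c"

lemma frag_UNIV_induct [case_names zero one diff]:
  assumes "P 0" "\<And>x. P (frag_of x)" "\<And>a b. P a \<Longrightarrow> P b \<Longrightarrow> P (a - b)" shows "P c"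
  by (rule frag_induction[of c UNIV]) (use assms in auto)

lemma pmult_simps [simp]:
  "pmult 0 d = 0" "pmult c 0 = 0"
  "pmult (a - b) d = pmult a d - pmult b d" "pmult c (a - b) = pmult c a - pmult c b"
  "pmult (frag_of (r, s)) (frag_of (r', s')) = frag_of (r * r', s * s')"
proof -
  show 0: "pmult 0 d = 0" for d :: "'a \<times> 'b \<Rightarrow>\<^sub>0 int" by (simp add: pmult_def)
  show l: "pmult (a - b) d = pmult a d - pmult b d" for a b d :: "'a \<times> 'b \<Rightarrow>\<^sub>0 int"
    by (simp add: pmult_def frag_extend_diff)
  show "pmult c 0 = 0"
    by (induction c rule: frag_UNIV_induct) (auto simp: 0 l, simp add: pmult_def split: prod.split)
  show "pmult c (a - b) = pmult c a - pmult c b"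
    by (induction c rule: frag_UNIV_induct) (auto simp: 0 l, simp add: pmult_def frag_extend_diff split: prod.split)
  show "pmult (frag_of (r, s)) (frag_of (r', s')) = frag_of (r * r', s * s')" by (simp add: pmult_def)
qed

lemma pmult_add [simp]: "pmult (a + b) d = pmult a d + pmult b d"
  using pmult_simps(3)[of a "- b" d] pmult_simps(3)[of 0 b d] by (simp del: pmult_simps(3) add: pmult_simps(1))

lemma pmult_comm: "pmult c d = pmult d c"
proof (induction c rule: frag_UNIV_induct)
  case (one x)
  show ?case by (induction d rule: frag_UNIV_induct) (cases x; auto simp: mult.commute)+
qed auto

lemma pmult_assoc: "pmult (pmult c d) e = pmult c (pmult d e)"
proof (induction c rule: frag_UNIV_induct)
  case (one x)
  show ?case
  proof (induction d rule: frag_UNIV_induct)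
    case (one y)
    show ?case by (induction e rule: frag_UNIV_induct) (cases x; cases y; auto simp: mult.assoc)+
  qed auto
qed auto

lemma pmult_one: "pmult (frag_of (1, 1)) c = c"
  by (induction c rule: frag_UNIV_induct) auto

lemma keys_pmult:
  assumes A: "\<And>a b. a \<in> A \<Longrightarrow> b \<in> A \<Longrightarrow> a * b \<in> A"
    and "keys c \<subseteq> A \<times> UNIV" "keys d \<subseteq> A \<times> UNIV"
  shows "keys (pmult c d) \<subseteq> A \<times> UNIV"
  using assms(2)
proof (induction c rule: frag_induction)
  case (one x)
  show ?case using assms(3)
  proof (induction d rule: frag_induction)
    case (one y)
    then show ?case using \<open>x \<in> A \<times> UNIV\<close> A by (cases x; cases y) auto
  next
    case (diff a b)
    then show ?case using keys_diff[of "pmult (frag_of x) a" "pmult (frag_of x) b"] by auto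
  qed auto
next
  case (diff a b)
  then show ?case using keys_diff[of "pmult a d" "pmult b d"] by auto
qed auto

definition lin :: "('x \<Rightarrow> 'f::comm_ring_1) \<Rightarrow> ('x \<Rightarrow>\<^sub>0 int) \<Rightarrow> 'f" where
  "lin F c = (\<Sum>x\<in>keys c. of_int (lookup c x) * F x)"

lemma lin_superset:
  assumes "finite D" "keys c \<subseteq> D"
  shows "lin F c = (\<Sum>x\<in>D. of_int (lookup c x) * F x)"
  unfolding lin_def using assms by (intro sum.mono_neutral_left) (auto simp: in_keys_iff)

lemma lin_simps [simp]: "lin F 0 = 0" "lin F (frag_of x) = F x" "lin F (c - d) = lin F c - lin F d"
  "lin F (c + d) = lin F c + lin F d"
proof -
  show "lin F 0 = 0" "lin F (frag_of x) = F x" by (simp_all add: lin_def)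
  let ?X = "keys c \<union> keys d"
  have s: "lin F c = (\<Sum>x\<in>?X. of_int (lookup c x) * F x)"
    "lin F d = (\<Sum>x\<in>?X. of_int (lookup d x) * F x)"
    by (rule lin_superset; simp)+
  have "lin F (c - d) = (\<Sum>x\<in>?X. of_int (lookup (c - d) x) * F x)"
    using keys_diff[of c d] by (intro lin_superset) auto
  then show "lin F (c - d) = lin F c - lin F d"
    unfolding s by (simp add: lookup_minus algebra_simps sum_subtractf)
  have "lin F (c + d) = (\<Sum>x\<in>?X. of_int (lookup (c + d) x) * F x)"
    using keys_add[of c d] by (intro lin_superset) auto
  then show "lin F (c + d) = lin F c + lin F d"
    unfolding s by (simp add: lookup_add algebra_simps sum.distrib)
qed

section \<open>Tensor products over the integers\<close>

text \<open>The assumption \<open>basis\<close> is what makes evaluation faithful on tensors: a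
  tensor involves finitely many scalars, these lie in the integral span of some \<open>D\<close>,
  and the elements of \<open>D\<close> are independent over the evaluated ring
  \<open>A\<close>.\<close>

locale tensor_eval =
  fixes A :: "'a::comm_ring_1 set" and ev :: "'a \<Rightarrow> 'f::comm_ring_1" and \<iota> :: "'k::comm_ring_1 \<Rightarrow> 'f"
  assumes A: "is_subring A"
    and ev: "ev 1 = 1" "\<And>x y. x \<in> A \<Longrightarrow> y \<in> A \<Longrightarrow> ev (x - y) = ev x - ev y"
      "\<And>x y. x \<in> A \<Longrightarrow> y \<in> A \<Longrightarrow> ev (x * y) = ev x * ev y"
    and \<iota>: "\<iota> 1 = 1" "\<And>x y. \<iota> (x - y) = \<iota> x - \<iota> y" "\<And>x y. \<iota> (x * y) = \<iota> x * \<iota> y"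
    and basis: "\<And>Y. finite Y \<Longrightarrow> \<exists>D. finite D \<and> (\<forall>x\<in>Y. \<exists>z. x = (\<Sum>e\<in>D. of_int (z e) * e)) \<and>
      (\<forall>g. (\<forall>e\<in>D. g e \<in> A) \<longrightarrow> (\<Sum>e\<in>D. ev (g e) * \<iota> e) = 0 \<longrightarrow> (\<forall>e\<in>D. g e = 0))"
begin

abbreviation "R \<equiv> ring_on A"
abbreviation "S \<equiv> (ring_of_type_algebra :: 'k ring)"
definition P where "P = pair_ring R S"

lemma P_simps [simp]:
  "carrier P = {c. keys c \<subseteq> A \<times> UNIV}" "monoid.mult P = pmult" "one P = frag_of (1, 1)"
  "ring.zero P = 0" "add P = (+)"
  by (auto simp: P_def pair_ring_def ring_of_type_algebra_def pmult_def fun_eq_iff)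

lemma cring_P: "cring P"
proof (rule cringI)
  show "abelian_group P"
  proof (rule abelian_groupI)
    fix x y assume "x \<in> carrier P" "y \<in> carrier P"
    then show "x \<oplus>\<^bsub>P\<^esub> y \<in> carrier P" using keys_add[of x y] by auto
  next
    fix x assume "x \<in> carrier P"
    then show "\<exists>y\<in>carrier P. y \<oplus>\<^bsub>P\<^esub> x = \<zero>\<^bsub>P\<^esub>" by (intro bexI[of _ "- x"]) auto
  qed (auto simp: add_ac)
  show "Group.comm_monoid P"
  proof (rule comm_monoidI)
    fix x y assume "x \<in> carrier P" "y \<in> carrier P"
    then show "x \<otimes>\<^bsub>P\<^esub> y \<in> carrier P"
      using keys_pmult[of A x y] is_subringD(4)[OF A] by simp
  qed (auto simp: is_subringD(1)[OF A] pmult_assoc pmult_one intro: pmult_comm)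
qed auto

sublocale P: cring P by (rule cring_P)

lemma P_minus: "x \<in> carrier P \<Longrightarrow> \<ominus>\<^bsub>P\<^esub> x = - x"
  by (rule P.minus_equality) auto

definition \<Psi> where "\<Psi> = lin (\<lambda>(a, k). ev a * \<iota> k)"

lemma \<Psi>_mult:
  assumes "c \<in> carrier P" "d \<in> carrier P" shows "\<Psi> (pmult c d) = \<Psi> c * \<Psi> d"
  using assms(1) unfolding P_simps mem_Collect_eq
proof (induction c rule: frag_induction)
  case (one x)
  show ?case using assms(2) unfolding P_simps mem_Collect_eq
  proof (induction d rule: frag_induction)
    case (one y)
    with \<open>x \<in> A \<times> UNIV\<close> show ?case by (cases x; cases y) (auto simp: \<Psi>_def ev \<iota>)
  qed (auto simp: \<Psi>_def algebra_simps)
qed (auto simp: \<Psi>_def algebra_simps)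

lemma \<Psi>_hom: "\<Psi> \<in> Ring.ring_hom P (ring_of_type_algebra :: 'f ring)"
  by (rule ring_hom_memI)
     (use \<Psi>_mult in \<open>auto simp: ring_of_type_algebra_def \<Psi>_def ev \<iota>\<close>)

sublocale \<Psi>: ring_hom_ring P "ring_of_type_algebra :: 'f ring" \<Psi>
  by (rule ring_hom_ringI2) (auto intro: P.ring_axioms \<Psi>_hom)

abbreviation "rels \<equiv> biadditivity_relations R S"

lemma rels_left: "a \<in> A \<Longrightarrow> b \<in> A \<Longrightarrow> frag_of (a + b, k) - frag_of (a, k) - frag_of (b, k) \<in> rels"
  unfolding biadditivity_relations_def by (rule UnI1) (force simp: ring_of_type_algebra_def)

lemma rels_right: "a \<in> A \<Longrightarrow> frag_of (a, k + l) - frag_of (a, k) - frag_of (a, l) \<in> rels"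
  unfolding biadditivity_relations_def by (rule UnI2) (force simp: ring_of_type_algebra_def)

lemma rels_cases:
  assumes "c \<in> rels"
  obtains a b k where "a \<in> A" "b \<in> A" "c = frag_of (a + b, k) - frag_of (a, k) - frag_of (b, k)"
  | a k l where "a \<in> A" "c = frag_of (a, k + l) - frag_of (a, k) - frag_of (a, l)"
  using assms unfolding biadditivity_relations_def by (auto simp: ring_of_type_algebra_def)

lemma ev_add: "x \<in> A \<Longrightarrow> y \<in> A \<Longrightarrow> ev (x + y) = ev x + ev y"
  using ev(2)[of x "- y"] ev(2)[of 0 y] ev(2)[of 0 0] is_subringD[OF A] by simp

lemma \<iota>_add: "\<iota> (x + y) = \<iota> x + \<iota> y"
  using \<iota>(2)[of x "- y"] \<iota>(2)[of 0 y] \<iota>(2)[of 0 0] by simp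

lemma rels_carrier: "rels \<subseteq> carrier P"
proof
  fix c assume "c \<in> rels"
  then show "c \<in> carrier P"
  proof (cases rule: rels_cases)
    case (1 a b k)
    have "keys c \<subseteq> {(a + b, k), (a, k), (b, k)}"
      unfolding 1 using keys_diff[of "frag_of (a + b, k) - frag_of (a, k)" "frag_of (b, k)"]
        keys_diff[of "frag_of (a + b, k)" "frag_of (a, k)"] by auto
    then show ?thesis using 1 is_subringD(6)[OF A 1(1,2)] by auto
  next
    case (2 a k l)
    have "keys c \<subseteq> {(a, k + l), (a, k), (a, l)}"
      unfolding 2 using keys_diff[of "frag_of (a, k + l) - frag_of (a, k)" "frag_of (a, l)"]
        keys_diff[of "frag_of (a, k + l)" "frag_of (a, k)"] by auto
    then show ?thesis using 2 by auto
  qed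
qed

definition I0 where "I0 = Idl\<^bsub>P\<^esub> rels"

lemma ideal_I0: "ideal I0 P"
  unfolding I0_def by (rule P.genideal_ideal[OF rels_carrier])

lemma rels_I0: "rels \<subseteq> I0"
  unfolding I0_def by (rule P.genideal_self[OF rels_carrier])

lemma I0_zero: "0 \<in> I0"
  using additive_subgroup.zero_closed[OF ideal.axioms(1)[OF ideal_I0]] by simp

lemma I0_add: "x \<in> I0 \<Longrightarrow> y \<in> I0 \<Longrightarrow> x + y \<in> I0"
  using additive_subgroup.a_closed[OF ideal.axioms(1)[OF ideal_I0]] by simp

lemma I0_uminus: "x \<in> I0 \<Longrightarrow> - x \<in> I0"
  using additive_subgroup.a_inv_closed[OF ideal.axioms(1)[OF ideal_I0], of x]
    P_minus[of x] ideal.Icarr[OF ideal_I0] by simp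

lemma I0_diff: "x \<in> I0 \<Longrightarrow> y \<in> I0 \<Longrightarrow> x - y \<in> I0"
  using I0_add[of x "- y"] I0_uminus[of y] by simp

lemma I0_trans: "x - y \<in> I0 \<Longrightarrow> y - z \<in> I0 \<Longrightarrow> x - z \<in> I0"
  using I0_add[of "x - y" "y - z"] by simp

lemma I0_sym: "x - y \<in> I0 \<Longrightarrow> y - x \<in> I0"
  using I0_uminus[of "x - y"] by simp

lemma I0_sum: "(\<And>i. i \<in> D \<Longrightarrow> x i - y i \<in> I0) \<Longrightarrow> sum x D - sum y D \<in> I0"
proof (induction D rule: infinite_finite_induct)
  case (insert i D)
  then have "(x i - y i) + (sum x D - sum y D) \<in> I0" by (intro I0_add) auto
  then show ?case using insert.hyps by (simp add: algebra_simps)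
qed (simp_all add: I0_zero)

lemma I0_left: "a \<in> A \<Longrightarrow> b \<in> A \<Longrightarrow> frag_of (a + b, k) - (frag_of (a, k) + frag_of (b, k)) \<in> I0"
  using rels_left[of a b k] rels_I0 by (auto simp: algebra_simps)

lemma I0_right: "a \<in> A \<Longrightarrow> frag_of (a, k + l) - (frag_of (a, k) + frag_of (a, l)) \<in> I0"
  using rels_right[of a k l] rels_I0 by (auto simp: algebra_simps)

lemma I0_left_0: "frag_of (0, k) \<in> I0"
  using I0_uminus[OF I0_left[of 0 0 k]] is_subringD(2)[OF A] by simp

lemma I0_right_0: "a \<in> A \<Longrightarrow> frag_of (a, 0) \<in> I0"
  using I0_uminus[OF I0_right[of a 0 0]] by simp

lemma of_int_A: "of_int z \<in> A"
proof -
  have n: "of_nat n \<in> A" for n :: nat by (induction n) (simp_all add: is_subringD[OF A])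
  show ?thesis
  proof (cases z)
    case (neg k)
    then show ?thesis using is_subringD(5)[OF A n[of "Suc k"]] by simp
  qed (simp add: n)
qed

lemma I0_of_int_left: "a \<in> A \<Longrightarrow> frag_of (of_int z * a, k) - frag_cmul z (frag_of (a, k)) \<in> I0"
proof (induction z rule: int_induct[where k = 0])
  case base
  then show ?case using I0_left_0 by simp
next
  case (step1 i)
  have m: "of_int i * a \<in> A" using is_subringD(4)[OF A of_int_A step1.prems] .
  from I0_add[OF I0_left[OF m step1.prems, of k] step1.IH[OF step1.prems]]
  show ?case by (simp add: algebra_simps frag_cmul_distrib)
next
  case (step2 i)
  have m: "of_int (i - 1) * a \<in> A" using is_subringD(4)[OF A of_int_A step2.prems] .
  from I0_diff[OF step2.IH[OF step2.prems] I0_left[OF m step2.prems, of k]]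
  show ?case by (simp add: algebra_simps frag_cmul_diff_distrib)
qed

lemma I0_of_int_right: "a \<in> A \<Longrightarrow> frag_of (a, of_int z * k) - frag_cmul z (frag_of (a, k)) \<in> I0"
proof (induction z rule: int_induct[where k = 0])
  case base
  then show ?case using I0_right_0 by simp
next
  case (step1 i)
  from I0_add[OF I0_right[OF step1.prems, of "of_int i * k" k] step1.IH[OF step1.prems]]
  show ?case by (simp add: algebra_simps frag_cmul_distrib)
next
  case (step2 i)
  from I0_diff[OF step2.IH[OF step2.prems] I0_right[OF step2.prems, of "of_int (i - 1) * k" k]]
  show ?case by (simp add: algebra_simps frag_cmul_diff_distrib)
qed

lemma I0_right_sum: "a \<in> A \<Longrightarrow> frag_of (a, sum x D) - (\<Sum>e\<in>D. frag_of (a, x e)) \<in> I0"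
proof (induction D rule: infinite_finite_induct)
  case (insert i D)
  from I0_add[OF I0_right[OF insert.prems, of "x i" "sum x D"] insert.IH[OF insert.prems]]
  show ?case using insert.hyps by (simp add: algebra_simps)
qed (simp_all add: I0_right_0)

text \<open>Modulo the relations a scalar is expanded over \<open>D\<close> and its integer
  coefficients are moved to the left factor; then one element of \<open>A\<close> is collected for
  each \<open>e\<close> in \<open>D\<close>.\<close>

lemma normal_form:
  assumes D: "finite D" "\<And>x. x \<in> Y \<Longrightarrow> \<exists>z. x = (\<Sum>e\<in>D. of_int (z e) * e)"
    and c: "keys c \<subseteq> A \<times> Y"
  shows "\<exists>g. (\<forall>e. g e \<in> A) \<and> c - (\<Sum>e\<in>D. frag_of (g e, e)) \<in> I0"
  using c
proof (induction c rule: frag_induction)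
  case zero
  have "0 - (\<Sum>e\<in>D. frag_of (0, e)) \<in> I0"
    using I0_sum[of D "\<lambda>_. 0" "\<lambda>e. frag_of (0, e)"] I0_uminus[OF I0_left_0] by simp
  then show ?case using is_subringD(2)[OF A] by (intro exI[of _ "\<lambda>_. 0"] conjI) simp_all
next
  case (one y)
  then obtain a x where y: "y = (a, x)" "a \<in> A" "x \<in> Y" by auto
  then obtain z where z: "x = (\<Sum>e\<in>D. of_int (z e) * e)" using D by blast
  have "frag_of y - (\<Sum>e\<in>D. frag_of (a, of_int (z e) * e)) \<in> I0"
    unfolding y(1) z by (rule I0_right_sum[OF y(2)])
  moreover have "(\<Sum>e\<in>D. frag_of (a, of_int (z e) * e)) - (\<Sum>e\<in>D. frag_of (of_int (z e) * a, e)) \<in> I0"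
    by (rule I0_sum, rule I0_trans[OF I0_of_int_right[OF y(2)] I0_sym[OF I0_of_int_left[OF y(2)]]])
  ultimately have "frag_of y - (\<Sum>e\<in>D. frag_of (of_int (z e) * a, e)) \<in> I0" by (rule I0_trans)
  moreover have "of_int (z e) * a \<in> A" for e by (rule is_subringD(4)[OF A of_int_A y(2)])
  ultimately show ?case by (intro exI[of _ "\<lambda>e. of_int (z e) * a"] conjI allI)
next
  case (diff c d)
  then obtain g h where g: "\<And>e. g e \<in> A" "c - (\<Sum>e\<in>D. frag_of (g e, e)) \<in> I0"
    and h: "\<And>e. h e \<in> A" "d - (\<Sum>e\<in>D. frag_of (h e, e)) \<in> I0" by blast
  have "(frag_of (g e, e) - frag_of (h e, e)) - frag_of (g e - h e, e) \<in> I0" for e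
    using I0_left[OF is_subringD(3)[OF A g(1)[of e] h(1)[of e]] h(1)[of e], of e]
    by (simp add: algebra_simps)
  then have 2: "(\<Sum>e\<in>D. frag_of (g e, e) - frag_of (h e, e)) - (\<Sum>e\<in>D. frag_of (g e - h e, e)) \<in> I0"
    by (rule I0_sum)
  have "(c - d) - (\<Sum>e\<in>D. frag_of (g e, e) - frag_of (h e, e)) \<in> I0"
    using I0_diff[OF g(2) h(2)] by (simp add: sum_subtractf algebra_simps)
  then have "(c - d) - (\<Sum>e\<in>D. frag_of (g e - h e, e)) \<in> I0" using 2 by (rule I0_trans)
  moreover have "g e - h e \<in> A" for e by (rule is_subringD(3)[OF A g(1) h(1)])
  ultimately show ?case by (intro exI[of _ "\<lambda>e. g e - h e"]) simp
qed

lemma I0_subset_kernel: "I0 \<subseteq> a_kernel P ring_of_type_algebra \<Psi>"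
  unfolding I0_def
proof (rule P.genideal_minimal[OF \<Psi>.kernel_is_ideal])
  show "rels \<subseteq> a_kernel P ring_of_type_algebra \<Psi>"
  proof
    fix c assume c: "c \<in> rels"
    then have "\<Psi> c = 0"
    proof (cases rule: rels_cases)
      case (1 a b k)
      show ?thesis unfolding 1(3) \<Psi>_def lin_simps by (simp add: ev_add[OF 1(1,2)] algebra_simps)
    next
      case (2 a k l)
      show ?thesis unfolding 2(2) \<Psi>_def lin_simps by (simp add: \<iota>_add algebra_simps)
    qed
    with c rels_carrier show "c \<in> a_kernel P ring_of_type_algebra \<Psi>"
      unfolding a_kernel_def' by (simp add: ring_of_type_algebra_def subset_eq)
  qed
qed

text \<open>Choose \<open>D\<close> for the finitely many scalars that occur in \<open>c\<close>.
  The normal form of \<open>c\<close> still evaluates to 0, so independence makes all its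
  coefficients 0, and pairs with left factor 0 are relations.\<close>

lemma kernel_eq: "a_kernel P ring_of_type_algebra \<Psi> = I0"
proof (rule equalityI[OF _ I0_subset_kernel], rule subsetI)
  fix c assume "c \<in> a_kernel P ring_of_type_algebra \<Psi>"
  then have c: "keys c \<subseteq> A \<times> UNIV" "\<Psi> c = 0"
    unfolding a_kernel_def' by (simp_all add: ring_of_type_algebra_def)
  from basis[of "snd ` keys c"] obtain D where D': "finite D" "\<forall>x\<in>snd ` keys c. \<exists>z. x = (\<Sum>e\<in>D. of_int (z e) * e)"
    "\<forall>g. (\<forall>e\<in>D. g e \<in> A) \<longrightarrow> (\<Sum>e\<in>D. ev (g e) * \<iota> e) = 0 \<longrightarrow> (\<forall>e\<in>D. g e = 0)" by auto
  have D: "finite D" "\<And>x. x \<in> snd ` keys c \<Longrightarrow> \<exists>z. x = (\<Sum>e\<in>D. of_int (z e) * e)"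
    "\<And>g. (\<And>e. e \<in> D \<Longrightarrow> g e \<in> A) \<Longrightarrow> (\<Sum>e\<in>D. ev (g e) * \<iota> e) = 0 \<Longrightarrow> (\<And>e. e \<in> D \<Longrightarrow> g e = 0)"
    using D' by blast+
  have "keys c \<subseteq> A \<times> snd ` keys c" using c(1) by force
  from normal_form[OF D(1,2) this] obtain g where g: "\<And>e. g e \<in> A" "c - (\<Sum>e\<in>D. frag_of (g e, e)) \<in> I0" by blast
  have "\<Psi> (c - (\<Sum>e\<in>D. frag_of (g e, e))) = 0"
    using subsetD[OF I0_subset_kernel g(2)] unfolding a_kernel_def' by (simp add: ring_of_type_algebra_def)
  moreover have "\<Psi> (\<Sum>e\<in>D. frag_of (g e, e)) = (\<Sum>e\<in>D. ev (g e) * \<iota> e)"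
    by (induction D rule: infinite_finite_induct) (auto simp: \<Psi>_def)
  ultimately have "(\<Sum>e\<in>D. ev (g e) * \<iota> e) = 0" using c(2) by (simp add: \<Psi>_def)
  with D(3)[of g] g(1) have "g e = 0" if "e \<in> D" for e using that by blast
  then have "(\<Sum>e\<in>D. frag_of (g e, e)) = (\<Sum>e\<in>D. frag_of (0, e))" by simp
  moreover have "(\<Sum>e\<in>D. frag_of (0, e)) \<in> I0"
    using I0_sum[of D "\<lambda>e. frag_of (0, e)" "\<lambda>_. 0"] I0_left_0 by simp
  ultimately have "(\<Sum>e\<in>D. frag_of (g e, e)) \<in> I0" by simp
  from I0_add[OF g(2) this] show "c \<in> I0" by simp
qed

abbreviation "Q \<equiv> R \<otimes>\<^sub>\<int> S"

lemma Q_eq: "Q = P Quot (a_kernel P ring_of_type_algebra \<Psi>)"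
proof -
  have "Q = P Quot I0" by (simp only: tensor_ring_def I0_def P_def)
  then show ?thesis by (simp only: kernel_eq)
qed

lemma cring_Q: "cring Q"
  unfolding Q_eq by (rule ideal.quotient_is_cring[OF \<Psi>.kernel_is_ideal cring_P])

lemma image_\<Psi>: "\<Psi> ` carrier P = lspan (range \<iota>) (ev ` A)"
proof (intro equalityI subsetI)
  have sub: "is_subring (range \<iota>)" by (force simp: is_subring_def \<iota>[symmetric])
  fix y assume "y \<in> \<Psi> ` carrier P"
  then obtain c where c: "keys c \<subseteq> A \<times> UNIV" "y = \<Psi> c" by auto
  have "\<Psi> c \<in> lspan (range \<iota>) (ev ` A)" using c(1)
  proof (induction c rule: frag_induction)
    case (one x)
    then show ?case using lspan_base[of "\<iota> (snd x)" "range \<iota>" "ev (fst x)" "ev ` A"]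
      by (auto simp: \<Psi>_def mult.commute)
  next
    case (diff a b)
    then show ?case using lspan_add[OF diff(1) lspan_uminus[OF sub diff(2)]] by (simp add: \<Psi>_def)
  qed (auto simp: \<Psi>_def lspan_zero)
  then show "y \<in> lspan (range \<iota>) (ev ` A)" using c(2) by simp
next
  fix y assume "y \<in> lspan (range \<iota>) (ev ` A)"
  then show "y \<in> \<Psi> ` carrier P"
  proof (induction rule: lspan.induct)
    case lspan_zero
    have "\<Psi> 0 = 0" by (simp add: \<Psi>_def)
    then show ?case by (metis P.zero_closed P_simps(4) imageI)
  next
    case (lspan_step v k a)
    then obtain c x z where c: "c \<in> carrier P" "v = \<Psi> c" "k = \<iota> z" "a = ev x" "x \<in> A" by blast
    have "c + frag_of (x, z) \<in> carrier P" using c(1,5) keys_add[of c "frag_of (x, z)"] by auto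
    moreover have "\<Psi> (c + frag_of (x, z)) = v + k * a" using c by (simp add: \<Psi>_def mult.commute)
    ultimately show ?case by (metis imageI)
  qed
qed

text \<open>The tensor product is isomorphic to the image of \<open>\<Psi>\<close> by
  \<open>kernel_eq\<close>. Only the chain condition is carried across this isomorphism; the
  decomposition into primes takes place in the tensor product itself.\<close>

theorem tensor_prime_intersections:
  assumes acc: "\<And>J. (\<And>j. rad_in (lspan (range \<iota>) (ev ` A)) (J j)) \<Longrightarrow> (\<And>j. J j \<subseteq> J (Suc j)) \<Longrightarrow>
    \<exists>N::nat. \<forall>j\<ge>N. J j = J N"
  shows "acc_radical_ideals Q \<and> (\<forall>I. radical_ideal I Q \<longrightarrow>
      (\<exists>\<P>. finite_prime_intersection Q I \<P>) \<and> finite_prime_intersection Q I (minimal_primes Q I))"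
proof -
  interpret Q: cring Q by (rule cring_Q)
  define \<psi> where "\<psi> = (\<lambda>Y. the_elem (\<Psi> ` Y))"
  let ?A = "lspan (range \<iota>) (ev ` A)"
  have iso: "\<psi> \<in> ring_iso Q (ring_of_type_algebra\<lparr>carrier := ?A\<rparr>)"
    using \<Psi>.FactRing_iso_set_aux unfolding Q_eq image_\<Psi> \<psi>_def .
  then have hom: "\<psi> \<in> Ring.ring_hom Q (ring_of_type_algebra\<lparr>carrier := ?A\<rparr>)"
    by (simp add: ring_iso_def)
  have ops: "x \<otimes>\<^bsub>ring_of_type_algebra\<lparr>carrier := ?A\<rparr>\<^esub> y = x * y"
    "x \<oplus>\<^bsub>ring_of_type_algebra\<lparr>carrier := ?A\<rparr>\<^esub> y = x + y" for x y :: 'f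
    by (simp_all add: ring_of_type_algebra_def)
  have \<psi>: "bij_betw \<psi> (carrier Q) ?A"
    "\<And>x y. x \<in> carrier Q \<Longrightarrow> y \<in> carrier Q \<Longrightarrow> \<psi> (x \<otimes>\<^bsub>Q\<^esub> y) = \<psi> x * \<psi> y"
    "\<And>x y. x \<in> carrier Q \<Longrightarrow> y \<in> carrier Q \<Longrightarrow> \<psi> (x \<oplus>\<^bsub>Q\<^esub> y) = \<psi> x + \<psi> y"
    subgoal using iso by (simp add: ring_iso_def)
    subgoal using ring_hom_mult[OF hom] by (simp only: ops)
    subgoal using ring_hom_add[OF hom] by (simp only: ops)
    done
  have inj: "inj_on \<psi> (carrier Q)" and im: "\<psi> ` carrier Q = ?A" using \<psi>(1) by (auto simp: bij_betw_def)
  have \<psi>0: "\<psi> \<zero>\<^bsub>Q\<^esub> = 0" using \<psi>(3)[of "\<zero>\<^bsub>Q\<^esub>" "\<zero>\<^bsub>Q\<^esub>"] by simp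
  have rad: "rad_in ?A (\<psi> ` J)" if J: "radical_ideal J Q" for J
  proof -
    note I = Q.radical_idealD(1)[OF J]
    interpret J: ideal J Q by (rule I)
    have JQ: "J \<subseteq> carrier Q" using J.Icarr by blast
    show ?thesis
      unfolding rad_in_def
    proof (intro conjI ballI impI)
      show "\<psi> ` J \<subseteq> ?A" using JQ im by blast
      show "0 \<in> \<psi> ` J" using \<psi>0 J.zero_closed by (metis imageI)
    next
      fix f g assume "f \<in> \<psi> ` J" "g \<in> \<psi> ` J"
      then obtain x y where "x \<in> J" "y \<in> J" "f = \<psi> x" "g = \<psi> y" by blast
      then show "f + g \<in> \<psi> ` J" using \<psi>(3)[of x y] JQ J.a_closed[of x y] by (metis imageI subsetD)
    next
      fix a f assume "a \<in> ?A" "f \<in> \<psi> ` J"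
      then obtain x y where "x \<in> carrier Q" "y \<in> J" "a = \<psi> x" "f = \<psi> y" unfolding im[symmetric] by blast
      then show "a * f \<in> \<psi> ` J" using \<psi>(2)[of x y] JQ J.I_l_closed[of y x] by (metis imageI subsetD)
    next
      fix f assume "f \<in> ?A" "f * f \<in> \<psi> ` J"
      then obtain x y where xy: "x \<in> carrier Q" "y \<in> J" "f = \<psi> x" "f * f = \<psi> y" unfolding im[symmetric] by blast
      then have "\<psi> (x \<otimes>\<^bsub>Q\<^esub> x) = \<psi> y" using \<psi>(2) by simp
      then have "x \<otimes>\<^bsub>Q\<^esub> x = y" using inj xy JQ by (auto dest!: inj_onD)
      then have "x \<in> J" using Q.radical_idealD(2)[OF J] xy by blast
      then show "f \<in> \<psi> ` J" using xy by blast
    qed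
  qed
  have "acc_radical_ideals Q"
    unfolding acc_radical_ideals_def
  proof (intro allI impI)
    fix J :: "nat \<Rightarrow> ('a \<times> 'k \<Rightarrow>\<^sub>0 int) set set"
    assume J: "(\<forall>k. radical_ideal (J k) Q) \<and> (\<forall>k. J k \<subseteq> J (Suc k))"
    have "\<exists>N::nat. \<forall>j\<ge>N. \<psi> ` J j = \<psi> ` J N"
      by (rule acc) (use J rad in blast)+
    then obtain N where N: "\<And>j. j \<ge> N \<Longrightarrow> \<psi> ` J j = \<psi> ` J N" by blast
    have "J j \<subseteq> carrier Q" for j using J ideal.Icarr[OF Q.radical_idealD(1), of "J j"] by blast
    then have "J j = J N" if "j \<ge> N" for j
      using N[OF that] inj by (simp add: inj_on_image_eq_iff)
    then show "\<exists>N. \<forall>k\<ge>N. J k = J N" by blast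
  qed
  then show ?thesis
    using Q.acc_finite_prime_intersection Q.finite_prime_intersection_minimal by blast
qed

end

section \<open>Independence of monomials\<close>

lemma noeth_field: "noeth (UNIV :: 'k::field set)"
  unfolding noeth_def
proof (intro allI impI)
  fix a :: "nat \<Rightarrow> 'k"
  show "\<exists>N. a N \<in> lspan UNIV (a ` {..<N})"
  proof (cases "a 0 = 0")
    case True
    then show ?thesis by (intro exI[of _ 0]) (simp add: lspan_zero)
  next
    case False
    have "(a 1 / a 0) * a 0 \<in> lspan UNIV (a ` {..<1})" by (rule lspan_base) auto
    then show ?thesis using False by (intro exI[of _ 1]) simp
  qed
qed

text \<open>Division with remainder: an element \<open>d\<close> of least nonzero absolute value in
  the ideal of the whole sequence divides every term, and it is already a combination of the first
  \<open>N\<close> terms for some \<open>N\<close>.\<close>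

lemma noeth_int: "noeth (UNIV :: int set)"
  unfolding noeth_def
proof (intro allI impI)
  fix a :: "nat \<Rightarrow> int"
  have R: "is_subring (UNIV :: int set)" by (simp add: is_subring_def)
  show "\<exists>N. a N \<in> lspan UNIV (a ` {..<N})"
  proof (cases "\<forall>i. a i = 0")
    case True
    then show ?thesis by (intro exI[of _ 0]) (simp add: lspan_zero)
  next
    case False
    then obtain i where "a i \<noteq> 0" by blast
    then have "a i \<in> lspan UNIV (range a) \<and> a i \<noteq> 0"
      using lspan_incl[OF R rangeI[of a i]] by simp
    from ex_has_least_nat[of "\<lambda>d. d \<in> lspan UNIV (range a) \<and> d \<noteq> 0", OF this, of "\<lambda>d. nat \<bar>d\<bar>"]
    obtain d where d: "d \<in> lspan UNIV (range a)" "d \<noteq> 0"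
      "\<And>e. e \<in> lspan UNIV (range a) \<Longrightarrow> e \<noteq> 0 \<Longrightarrow> nat \<bar>d\<bar> \<le> nat \<bar>e\<bar>" by blast
    obtain T where T: "T \<subseteq> range a" "finite T" "d \<in> lspan UNIV T" using lspan_finite_support[OF d(1)] by blast
    from finite_subset_image[OF T(2,1)] obtain J where J: "finite J" "T = a ` J" by blast
    obtain N where N: "J \<subseteq> {..<N}" using finite_nat_bounded[OF J(1)] by auto
    have dN: "d \<in> lspan UNIV (a ` {..<N})" using T(3) J(2) N by (intro lspan_mono[of T "a ` {..<N}"]) auto
    have m: "a N mod d = a N + (- (a N div d)) * d" by (simp add: minus_div_mult_eq_mod)
    have "a N mod d \<in> lspan UNIV (range a)"
      unfolding m by (rule lspan_add[OF lspan_incl[OF R rangeI] lspan_smult[OF R d(1) UNIV_I]])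
    then have "a N mod d \<noteq> 0 \<Longrightarrow> nat \<bar>d\<bar> \<le> nat \<bar>a N mod d\<bar>" by (rule d(3))
    moreover have "\<bar>a N mod d\<bar> < \<bar>d\<bar>" using d(2) by (rule abs_mod_less)
    ultimately have "a N mod d = 0" by linarith
    then have "a N = (a N div d) * d" by (metis add.right_neutral div_mult_mod_eq)
    with lspan_smult[OF R dN, of "a N div d"] show ?thesis by (intro exI[of _ N]) simp
  qed
qed

definition zindep :: "'k::comm_ring_1 set \<Rightarrow> bool" where
  "zindep D \<longleftrightarrow> (\<forall>z. (\<Sum>e\<in>D. of_int (z e) * e) = 0 \<longrightarrow> (\<forall>e\<in>D. z e = 0))"

lemma zbasis_int: "\<exists>D. finite D \<and> (\<forall>x\<in>Y. \<exists>z. x = (\<Sum>e\<in>D. of_int (z e) * e)) \<and> zindep (D :: int set)"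
  by (intro exI[of _ "{1}"]) (auto simp: zindep_def intro!: exI[of _ "\<lambda>_. x" for x])

text \<open>A relation \<open>n x = \<Sum> z\<^sub>e e\<close> between a new element and an independent family is resolved by
  dividing the family by \<open>n\<close>.\<close>

lemma zbasis_field:
  assumes "finite Y"
  shows "\<exists>D. finite D \<and> (\<forall>x\<in>Y. \<exists>z. x = (\<Sum>e\<in>D. of_int (z e) * e)) \<and> zindep (D :: 'k::field_char_0 set)"
  using assms
proof (induction Y rule: finite_induct)
  case empty
  show ?case by (intro exI[of _ "{}"]) (auto simp: zindep_def)
next
  case (insert y Y)
  then obtain D where D: "finite D" "\<And>x. x \<in> Y \<Longrightarrow> \<exists>z. x = (\<Sum>e\<in>D. of_int (z e) * e)" "zindep D" by blast
  show ?case
  proof (cases "\<exists>n z. n \<noteq> 0 \<and> of_int n * y = (\<Sum>e\<in>D. of_int (z e) * e)")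
    case True
    then obtain n z where n: "n \<noteq> 0" "of_int n * y = (\<Sum>e\<in>D. of_int (z e) * e)" by blast
    let ?h = "\<lambda>e. e / of_int n :: 'k" and ?D = "(\<lambda>e. e / of_int n) ` D"
    have inj: "inj_on ?h D" using n by (auto simp: inj_on_def)
    have re: "(\<Sum>e\<in>?D. of_int (w e) * e) = (\<Sum>e\<in>D. of_int (w (?h e)) * e) / of_int n" for w
      using inj by (simp add: sum.reindex sum_divide_distrib)
    have hn: "?h e * of_int n = e" for e using n by simp
    have repr: "\<exists>w. x = (\<Sum>e\<in>?D. of_int (w e) * e)" if "of_int n * x = (\<Sum>e\<in>D. of_int (v e) * e)" for v x
    proof -
      have "the_inv_into D ?h (?h e) = e" if "e \<in> D" for e using the_inv_into_f_f[OF inj that] .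
      then have "(\<Sum>e\<in>?D. of_int ((v \<circ> the_inv_into D ?h) e) * e) = (\<Sum>e\<in>D. of_int (v e) * e) / of_int n"
        unfolding re by (intro arg_cong2[where f = "(/)"] sum.cong refl) simp
      also have "\<dots> = x" using that[symmetric] n by simp
      finally show ?thesis by metis
    qed
    have "\<exists>w. x = (\<Sum>e\<in>?D. of_int (w e) * e)" if xY: "x \<in> Y" for x
    proof -
      obtain v where v: "x = (\<Sum>e\<in>D. of_int (v e) * e)" using D(2)[OF xY] by blast
      have "of_int n * x = (\<Sum>e\<in>D. of_int (n * v e) * e)" unfolding v by (simp add: sum_distrib_left mult_ac)
      from repr[OF this] show ?thesis .
    qed
    moreover have "zindep ?D"
      unfolding zindep_def re using D(3) n by (auto simp: zindep_def) 
    ultimately show ?thesis using repr[OF n(2)] D(1) by (intro exI[of _ ?D]) auto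
  next
    case False
    have yD: "y \<notin> D"
    proof
      assume "y \<in> D"
      have "(\<Sum>e\<in>D. of_int (if e = y then 1 else 0) * e) = (\<Sum>e\<in>D. if e = y then y else 0)"
        by (intro sum.cong) auto
      also have "\<dots> = y" using D(1) \<open>y \<in> D\<close> by simp
      finally have "of_int 1 * y = (\<Sum>e\<in>D. of_int (if e = y then 1 else 0) * e)" by simp
      with False show False by (metis one_neq_zero)
    qed
    have "\<exists>z. x = (\<Sum>e\<in>insert y D. of_int (z e) * e)" if xY: "x \<in> insert y Y" for x
    proof (cases "x = y")
      case True
      have "(\<Sum>e\<in>D. of_int (if e = y then 1 else 0) * e) = 0" using yD by (intro sum.neutral) auto
      then show ?thesis using True yD D(1) by (intro exI[of _ "\<lambda>e. if e = y then 1 else 0"]) simp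
    next
      case False
      then have "x \<in> Y" using xY by simp
      from D(2)[OF this] obtain z where z: "x = (\<Sum>e\<in>D. of_int (z e) * e)" by blast
      have "(\<Sum>e\<in>D. of_int (if e = y then 0 else z e) * e) = x" unfolding z using yD by (intro sum.cong) auto
      then show ?thesis using yD D(1) by (intro exI[of _ "\<lambda>e. if e = y then 0 else z e"]) simp
    qed
    moreover have "zindep (insert y D)"
      unfolding zindep_def
    proof (intro allI impI)
      fix z assume z: "(\<Sum>e\<in>insert y D. of_int (z e) * e) = 0"
      then have eq: "of_int (z y) * y + (\<Sum>e\<in>D. of_int (z e) * e) = 0" using yD D(1) by simp
      then have "of_int (- z y) * y = (\<Sum>e\<in>D. of_int (z e) * e)" by (simp add: add_eq_0_iff)
      with False have "z y = 0" by (metis neg_equal_0_iff_equal)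
      then have "(\<Sum>e\<in>D. of_int (z e) * e) = 0" using eq by simp
      with D(3) \<open>z y = 0\<close> show "\<forall>e\<in>insert y D. z e = 0" by (auto simp: zindep_def)
    qed
    ultimately show ?thesis using D(1) by (intro exI[of _ "insert y D"]) auto
  qed
qed

text \<open>Dedekind's argument: evaluating the relation at \<open>mul r s\<close> and subtracting
  \<open>\<chi> k s\<close> times the relation at \<open>r\<close> removes the character
  \<open>k\<close>, and a point \<open>s\<close> separating \<open>j\<close> from \<open>k\<close>
  keeps the coefficient of \<open>j\<close> alive.\<close>

lemma characters_independent:
  fixes \<chi> :: "'i \<Rightarrow> 'm \<Rightarrow> 'l::idom"
  assumes "finite M"
    and mul: "\<And>r s. r \<in> G \<Longrightarrow> s \<in> G \<Longrightarrow> mul r s \<in> G"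
      "\<And>i r s. r \<in> G \<Longrightarrow> s \<in> G \<Longrightarrow> \<chi> i (mul r s) = \<chi> i r * \<chi> i s"
    and one: "u \<in> G" "\<And>i. \<chi> i u \<noteq> 0"
    and dist: "\<And>i j. i \<noteq> j \<Longrightarrow> \<exists>r\<in>G. \<chi> i r \<noteq> \<chi> j r"
    and z: "\<And>r. r \<in> G \<Longrightarrow> (\<Sum>i\<in>M. c i * \<chi> i r) = 0" and i: "i \<in> M"
  shows "c i = 0"
  using assms(1) z i
proof (induction M arbitrary: c i rule: finite_induct)
  case (insert k M)
  have M: "c j = 0" if "j \<in> M" for j
  proof -
    have "j \<noteq> k" using that insert.hyps by auto
    then obtain s where s: "s \<in> G" "\<chi> j s \<noteq> \<chi> k s" using dist by blast
    have "(\<Sum>i\<in>M. (c i * (\<chi> i s - \<chi> k s)) * \<chi> i r) = 0" if "r \<in> G" for r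
    proof -
      have "(\<Sum>i\<in>insert k M. c i * \<chi> i (mul r s)) - \<chi> k s * (\<Sum>i\<in>insert k M. c i * \<chi> i r) = 0"
        using insert.prems(1) mul(1) that s by simp
      moreover have "(\<Sum>i\<in>insert k M. c i * \<chi> i (mul r s)) - \<chi> k s * (\<Sum>i\<in>insert k M. c i * \<chi> i r) =
        (\<Sum>i\<in>insert k M. (c i * (\<chi> i s - \<chi> k s)) * \<chi> i r)"
        unfolding sum_distrib_left sum_subtractf[symmetric]
        by (intro sum.cong refl) (simp add: mul(2)[OF that s(1)] algebra_simps)
      ultimately show ?thesis using insert.hyps by simp
    qed
    from insert.IH[OF this \<open>j \<in> M\<close>] show ?thesis using s(2) by simp
  qed
  have "c k * \<chi> k u = 0" using insert.prems(1)[OF one(1)] M insert.hyps by simp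
  then have "c k = 0" using one(2) by simp
  with M insert.prems(2) show ?case by blast
qed simp

lemma two_powi_distinct:
  assumes "a \<noteq> b" shows "(2::'l::field_char_0) powi a \<noteq> 2 powi b"
proof -
  have ne: "(2::'l) powi c \<noteq> 1" if "c > 0" for c
  proof -
    have "(of_nat (2 ^ nat c) :: 'l) \<noteq> of_nat 1" unfolding of_nat_eq_iff using that by simp
    then show ?thesis using that by (simp add: power_int_def)
  qed
  have "(2::'l) powi a = 2 powi (a - b) * 2 powi b" "(2::'l) powi b = 2 powi (b - a) * 2 powi a"
    by (simp_all add: power_int_add[symmetric])
  with ne[of "a - b"] ne[of "b - a"] assms show ?thesis by (cases "a < b") auto
qed

text \<open>Powers are characters of the multiplicative group; in characteristic 0 the point 2
  separates them.\<close>

lemma powi_independent: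
  fixes c :: "int \<Rightarrow> 'l::field_char_0"
  assumes "finite M" "\<And>t. t \<noteq> 0 \<Longrightarrow> (\<Sum>k\<in>M. c k * t powi k) = 0" "k \<in> M" shows "c k = 0"
proof (rule characters_independent[where \<chi> = "\<lambda>k t. t powi k" and G = "{t. t \<noteq> 0}" and u = 1 and mul = "(*)"])
  show "\<exists>r\<in>{t. t \<noteq> 0}. r powi i \<noteq> (r powi j :: 'l)" if "i \<noteq> j" for i j
    by (rule bexI[of _ 2]) (use two_powi_distinct[OF that] in auto)
  show "(\<Sum>k\<in>M. c k * r powi k) = 0" if "r \<in> {t. t \<noteq> 0}" for r using assms(2) that by simp
qed (use assms(1,3) in \<open>simp_all add: power_int_mult_distrib\<close>)

lemma lin_mult:
  fixes f g :: "'x::comm_monoid_add \<Rightarrow>\<^sub>0 int"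
  assumes "\<And>a b. F (a + b) = F a * F b"
  shows "lin F (f * g) = lin F f * lin F g"
proof (induction f rule: frag_UNIV_induct)
  case (one x)
  show ?case
    by (induction g rule: frag_UNIV_induct) (simp_all add: mult_single assms right_diff_distrib)
qed (simp_all add: left_diff_distrib)

definition pmon :: "('e::zero \<Rightarrow> int) \<Rightarrow> ('v \<Rightarrow>\<^sub>0 'e) \<Rightarrow> ('v \<Rightarrow> 'l::field) \<Rightarrow> 'l" where
  "pmon ex \<mu> q = (\<Prod>v\<in>keys \<mu>. q v powi ex (lookup \<mu> v))"

text \<open>Lets natural and integral exponents be treated at once: \<open>ex\<close> is
  \<open>int\<close> in case S and the identity in case L, and \<open>ex_range\<close> yields the
  exponent set of the function ring.\<close>

locale exponent_embedding =
  fixes ex :: "'e::{cancel_comm_monoid_add, zero_neq_one} \<Rightarrow> int"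
  assumes ex_add: "ex (a + b) = ex a + ex b" and ex_inj: "inj ex" and ex_1: "ex 1 = 1"
    and ex_range: "exponents (range ex)"
begin

lemma ex_0: "ex 0 = 0" using ex_add[of 0 0] by simp

lemma pmon_superset:
  assumes "finite V" "keys \<mu> \<subseteq> V"
  shows "pmon ex \<mu> q = (\<Prod>v\<in>V. q v powi ex (lookup \<mu> v))"
  unfolding pmon_def using assms by (intro prod.mono_neutral_left) (auto simp: in_keys_iff ex_0)

lemma pmon_add:
  assumes "\<And>v. q v \<noteq> 0" shows "pmon ex (\<mu> + \<nu>) q = pmon ex \<mu> q * pmon ex \<nu> q"
proof -
  let ?V = "keys \<mu> \<union> keys \<nu>"
  have "pmon ex (\<mu> + \<nu>) q = (\<Prod>v\<in>?V. q v powi ex (lookup (\<mu> + \<nu>) v))"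
    using keys_add[of \<mu> \<nu>] by (intro pmon_superset) auto
  also have "\<dots> = pmon ex \<mu> q * pmon ex \<nu> q"
    using assms by (simp add: pmon_superset[of ?V] lookup_add ex_add power_int_add prod.distrib)
  finally show ?thesis .
qed

lemma pmon_mult: "pmon ex \<mu> (\<lambda>v. q v * r v) = pmon ex \<mu> q * pmon ex \<mu> r"
  by (simp add: pmon_def power_int_mult_distrib prod.distrib)

lemma pmon_distinct:
  assumes "\<mu> \<noteq> \<nu>"
  shows "\<exists>r :: 'v \<Rightarrow> 'l::field_char_0. (\<forall>v. r v \<noteq> 0) \<and> pmon ex \<mu> r \<noteq> pmon ex \<nu> r"
proof -
  obtain v where v: "lookup \<mu> v \<noteq> lookup \<nu> v"
    using assms by (auto simp: poly_mapping_eq_iff fun_eq_iff)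
  let ?r = "\<lambda>w. if w = v then 2 else (1::'l)"
  have p: "pmon ex \<rho> ?r = 2 powi ex (lookup \<rho> v)" for \<rho>
  proof -
    have "pmon ex \<rho> ?r = (\<Prod>w\<in>insert v (keys \<rho>). ?r w powi ex (lookup \<rho> w))"
      by (intro pmon_superset) auto
    also have "\<dots> = 2 powi ex (lookup \<rho> v) * (\<Prod>w\<in>keys \<rho> - {v}. ?r w powi ex (lookup \<rho> w))"
      by (subst prod.insert_remove) auto
    also have "(\<Prod>w\<in>keys \<rho> - {v}. ?r w powi ex (lookup \<rho> w)) = 1"
      by (intro prod.neutral) auto
    finally show ?thesis by simp
  qed
  have "(2::'l) powi a \<noteq> 2 powi b" if "a \<noteq> b" for a b using that by (rule two_powi_distinct)
  moreover have "ex (lookup \<mu> v) \<noteq> ex (lookup \<nu> v)"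
    using v ex_inj by (auto dest: injD)
  ultimately have "pmon ex \<mu> ?r \<noteq> pmon ex \<nu> ?r" unfolding p by blast
  then show ?thesis by (intro exI[of _ ?r]) auto
qed

lemma pmon_independent:
  fixes c :: "('v \<Rightarrow>\<^sub>0 'e) \<Rightarrow> 'l::field_char_0"
  assumes "finite M" "\<And>q :: 'v \<Rightarrow> 'l. (\<And>v. q v \<noteq> 0) \<Longrightarrow> (\<Sum>\<mu>\<in>M. c \<mu> * pmon ex \<mu> q) = 0" "\<mu> \<in> M"
  shows "c \<mu> = 0"
proof (rule characters_independent[where \<chi> = "\<lambda>\<mu> q. pmon ex \<mu> q" and G = "{q. \<forall>v. q v \<noteq> 0}" and u = "\<lambda>_. 1"
      and mul = "\<lambda>q r v. q v * r v"])
  show "finite M" "\<mu> \<in> M" by (rule assms(1), rule assms(3))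
  show "(\<lambda>v. r v * s v) \<in> {q. \<forall>v. q v \<noteq> 0}" if "r \<in> {q. \<forall>v. q v \<noteq> 0}" "s \<in> {q. \<forall>v. q v \<noteq> 0}"
    for r s :: "'v \<Rightarrow> 'l" using that by simp
  show "(\<Sum>i\<in>M. c i * pmon ex i r) = 0" if "r \<in> {q. \<forall>v. q v \<noteq> 0}" for r
    using assms(2) that by simp
  show "pmon ex i (\<lambda>v. r v * s v) = pmon ex i r * pmon ex i s" for i and r s :: "'v \<Rightarrow> 'l"
    by (rule pmon_mult)
  show "pmon ex i (\<lambda>_. 1) \<noteq> (0 :: 'l)" for i :: "'v \<Rightarrow>\<^sub>0 'e" by (simp add: pmon_def)
  show "\<exists>r\<in>{q. \<forall>v. q v \<noteq> 0}. pmon ex i r \<noteq> (pmon ex j r :: 'l)" if "i \<noteq> j" for i j :: "'v \<Rightarrow>\<^sub>0 'e"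
    using pmon_distinct[OF that] by blast
qed simp

end

lemma prod_fun_apply: "(\<Prod>i\<in>I. F i) p = (\<Prod>i\<in>I. F i p :: 'l::comm_ring_1)"
  by (induction I rule: infinite_finite_induct) auto

lemma sum_fun_apply: "(\<Sum>i\<in>I. F i) p = (\<Sum>i\<in>I. F i p :: 'l::comm_ring_1)"
  by (induction I rule: infinite_finite_induct) auto

lemma is_subring_range:
  assumes "h 1 = 1" "\<And>x y. h (x - y) = h x - h y" "\<And>x y. h (x * y) = h x * h y"
  shows "is_subring (range h)"
  unfolding is_subring_def
proof (intro conjI ballI)
  show "1 \<in> range h" by (rule image_eqI[of _ _ 1]) (simp_all add: assms(1))
  fix a b assume "a \<in> range h" "b \<in> range h"
  then obtain x y where xy: "a = h x" "b = h y" by blast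
  show "a - b \<in> range h" unfolding xy assms(2)[symmetric] by (rule rangeI)
  show "a * b \<in> range h" unfolding xy assms(3)[symmetric] by (rule rangeI)
qed

lemma lin_single: "lin F (Poly_Mapping.single x z) = of_int z * F x"
  by (cases "z = 0") (simp_all add: lin_def)

lemma lookup_map_key: "inj \<pi> \<Longrightarrow> lookup (Poly_Mapping.map_key \<pi> f) v = lookup f (\<pi> v)"
  by (simp add: Poly_Mapping.map_key.rep_eq)

lemma inj_map_key: "bij \<pi> \<Longrightarrow> inj (Poly_Mapping.map_key \<pi> :: ('a \<Rightarrow>\<^sub>0 'e::zero) \<Rightarrow> 'b \<Rightarrow>\<^sub>0 'e)"
proof (rule injI, rule poly_mapping_eqI)
  fix f g :: "'a \<Rightarrow>\<^sub>0 'e" and v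
  assume b: "bij \<pi>" and eq: "Poly_Mapping.map_key \<pi> f = Poly_Mapping.map_key \<pi> g"
  obtain w where "v = \<pi> w" using b by (metis bij_pointE)
  then show "lookup f v = lookup g v"
    using lookup_map_key[OF bij_is_inj[OF b]] eq by metis
qed

lemma lookup_permute_vars:
  assumes "bij \<pi>"
  shows "lookup (permute_vars \<pi> f) \<mu> = lookup f (Poly_Mapping.map_key \<pi> \<mu>)"
  unfolding permute_vars_def by (rule lookup_map_key[OF inj_map_key[OF assms]])

lemma map_key_inv:
  assumes "bij \<pi>" shows "Poly_Mapping.map_key \<pi> (Poly_Mapping.map_key (Hilbert_Choice.inv \<pi>) \<mu>) = \<mu>"
  by (rule poly_mapping_eqI)
     (simp add: lookup_map_key[OF bij_is_inj[OF assms]] lookup_map_key[OF bij_is_inj[OF bij_imp_bij_inv[OF assms]]] inv_f_f[OF bij_is_inj[OF assms]])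

lemma is_subring_gpoly_in: "is_subring (gpoly_in m n :: 'e::{cancel_comm_monoid_add, zero_neq_one} gpoly set)"
  unfolding is_subring_def
proof (intro conjI ballI)
  show "1 \<in> gpoly_in m n" by (simp add: gpoly_in_def)
next
  fix f g :: "'e gpoly" assume fg: "f \<in> gpoly_in m n" "g \<in> gpoly_in m n"
  show "f - g \<in> gpoly_in m n" using fg keys_diff[of f g] unfolding gpoly_in_def by blast
  show "f * g \<in> gpoly_in m n"
    unfolding gpoly_in_def
  proof (intro CollectI ballI)
    fix \<mu> assume "\<mu> \<in> keys (f * g)"
    then obtain a b where ab: "\<mu> = a + b" "a \<in> keys f" "b \<in> keys g"
      using keys_mult[of f g] by blast
    show "keys \<mu> \<subseteq> vars m n"
      using keys_add[of a b] fg ab unfolding gpoly_in_def by blast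
  qed
qed

locale gpoly_eval = exponent_embedding ex for ex :: "'e::{cancel_comm_monoid_add, zero_neq_one} \<Rightarrow> int" +
  fixes s :: "'l::field_char_0"
  assumes s: "s = 1 \<or> s = - 1"
begin

text \<open>In case S the \<open>y\<^sub>j\<close> change sign (\<open>s = - 1\<close>), so that the substitution \<open>x\<^sub>1 = t, y\<^sub>1 = - t\<close> becomes
  \<open>x\<^sub>1 = y\<^sub>1 = t\<close> as in case L.\<close>

definition sg :: "nat + nat \<Rightarrow> 'l" where "sg v = (case v of Inl _ \<Rightarrow> 1 | Inr _ \<Rightarrow> s)"
definition tw :: "(nat + nat \<Rightarrow> 'l) \<Rightarrow> nat + nat \<Rightarrow> 'l" where "tw p v = sg v * nz (p v)"
definition ev :: "'e gpoly \<Rightarrow> (nat + nat \<Rightarrow> 'l) \<Rightarrow> 'l" where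
  "ev f p = lin (\<lambda>\<mu>. pmon ex \<mu> (tw p)) f"

lemma sg_square: "sg v * sg v = 1" using s by (cases v) (auto simp: sg_def)

lemma sg_nonzero [simp]: "sg v \<noteq> 0" using sg_square[of v] by auto

lemma tw_nonzero [simp]: "tw p v \<noteq> 0" by (simp add: tw_def)

lemma tw_surj:
  assumes "\<And>v. q v \<noteq> 0" shows "\<exists>p. tw p = q \<and> (\<forall>v. p v \<noteq> 0)"
proof (intro exI[of _ "\<lambda>v. sg v * q v"] conjI ext allI)
  fix v
  have "nz (sg v * q v) = sg v * q v" using assms[of v] by simp
  then show "tw (\<lambda>v. sg v * q v) v = q v" by (simp add: tw_def mult.assoc[symmetric] sg_square)
qed (use assms in simp)

lemma ev_1: "ev 1 = 1" and ev_diff: "ev (f - g) = ev f - ev g"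
  and ev_mult: "ev (f * g) = ev f * ev g"
proof -
  have "lin F 1 = F 0" for F :: "(nat + nat \<Rightarrow>\<^sub>0 'e) \<Rightarrow> 'l"
    using lin_simps(2)[of F 0] unfolding single_one .
  then show "ev 1 = 1" by (simp add: ev_def fun_eq_iff pmon_def)
  show "ev (f - g) = ev f - ev g" by (simp add: ev_def fun_eq_iff)
  show "ev (f * g) = ev f * ev g" by (simp add: ev_def fun_eq_iff lin_mult[OF pmon_add])
qed

text \<open>Two independences in turn: that of monomials over the field of values gives a relation
  between the \<open>\<iota> e\<close> for every exponent vector; injectivity of
  \<open>\<iota>\<close> turns it into an integral relation in \<open>D\<close>, which
  \<open>zindep\<close> makes trivial.\<close>

lemma ev_independent:
  fixes \<iota> :: "'k::comm_ring_1 \<Rightarrow> 'l"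
  assumes \<iota>: "\<iota> 1 = 1" "\<And>x y. \<iota> (x - y) = \<iota> x - \<iota> y" "\<And>x y. \<iota> (x * y) = \<iota> x * \<iota> y" "inj \<iota>"
    and D: "finite D" "zindep D" and z: "\<And>p. (\<Sum>e\<in>D. ev (g e) p * \<iota> e) = 0" and d: "d \<in> D"
  shows "g d = 0"
proof (rule poly_mapping_eqI)
  have \<iota>0: "\<iota> 0 = 0" using \<iota>(2)[of 0 0] by simp
  have \<iota>_add: "\<iota> (x + y) = \<iota> x + \<iota> y" for x y using \<iota>(2)[of x "- y"] \<iota>(2)[of 0 y] \<iota>0 by simp
  have \<iota>_sum: "\<iota> (sum h D) = (\<Sum>e\<in>D. \<iota> (h e))" for h
    by (induction D rule: infinite_finite_induct) (simp_all add: \<iota>0 \<iota>_add)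
  have \<iota>_nat: "\<iota> (of_nat j) = of_nat j" for j by (induction j) (simp_all add: \<iota>0 \<iota>_add \<iota>(1))
  have \<iota>_int: "\<iota> (of_int j) = of_int j" for j
    by (cases j) (use \<iota>(2)[of 0] \<iota>_nat in \<open>simp_all add: \<iota>0 del: of_nat_Suc\<close>)
  define M where "M = (\<Union>e\<in>D. keys (g e))"
  define c where "c = (\<lambda>\<mu>. \<Sum>e\<in>D. of_int (lookup (g e) \<mu>) * \<iota> e)"
  have fin: "finite M" using D(1) by (simp add: M_def)
  fix \<mu>
  show "lookup (g d) \<mu> = lookup 0 \<mu>"
  proof (cases "\<mu> \<in> M")
    case True
    have "c \<mu> = 0"
    proof (rule pmon_independent[OF fin _ True])
      fix q :: "nat + nat \<Rightarrow> 'l" assume "\<And>v. q v \<noteq> 0"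
      then obtain p where p: "tw p = q" using tw_surj by blast
      have "ev (g e) p = (\<Sum>\<mu>\<in>M. of_int (lookup (g e) \<mu>) * pmon ex \<mu> q)" if "e \<in> D" for e
        unfolding ev_def p using that by (intro lin_superset fin) (auto simp: M_def)
      then have "0 = (\<Sum>e\<in>D. (\<Sum>\<mu>\<in>M. of_int (lookup (g e) \<mu>) * pmon ex \<mu> q) * \<iota> e)"
        unfolding z[of p, symmetric] by (intro sum.cong) auto
      also have "\<dots> = (\<Sum>\<mu>\<in>M. c \<mu> * pmon ex \<mu> q)"
        unfolding c_def sum_distrib_right by (subst sum.swap) (simp add: mult_ac)
      finally show "(\<Sum>\<mu>\<in>M. c \<mu> * pmon ex \<mu> q) = 0" by simp
    qed
    then have "\<iota> (\<Sum>e\<in>D. of_int (lookup (g e) \<mu>) * e) = \<iota> 0"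
      by (simp add: c_def \<iota>_sum \<iota>(3) \<iota>_int \<iota>0)
    then have "(\<Sum>e\<in>D. of_int (lookup (g e) \<mu>) * e) = 0" using \<iota>(4) by (simp add: inj_eq)
    then have "\<forall>e\<in>D. lookup (g e) \<mu> = 0"
      by (rule mp[OF spec[OF D(2)[unfolded zindep_def], of "\<lambda>e. lookup (g e) \<mu>"]])
    then show ?thesis using d by simp
  next
    case False
    then show ?thesis using d by (auto simp: M_def in_keys_iff)
  qed
qed

lemma ev_eq_0:
  assumes z: "\<And>p. ev f p = 0" shows "f = 0"
proof -
  have D: "zindep {1::int}" by (simp add: zindep_def)
  have i: "inj (of_int :: int \<Rightarrow> 'l)" by (simp add: inj_def)
  show ?thesis
    using ev_independent[OF of_int_1 of_int_diff of_int_mult i _ D, of "\<lambda>_. f" 1] z by simp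
qed

lemma ev_inj: "ev f = ev g \<Longrightarrow> f = g"
  using ev_eq_0[of "f - g"] by (simp add: ev_diff)

lemma sg_powi_Ints: "sg v powi a \<in> \<int>"
proof -
  have "sg v = 1 \<or> sg v = - 1" using s by (cases v) (auto simp: sg_def)
  then show ?thesis by (auto simp: power_int_minus_left)
qed

lemma ev_Bset:
  assumes f: "f \<in> gpoly_in m n" shows "ev f \<in> Bset \<int> (range ex) (vars m n)"
proof -
  let ?B = "Bset \<int> (range ex) (vars m n) :: ((nat + nat \<Rightarrow> 'l) \<Rightarrow> 'l) set"
  have RB: "is_subring ?B" by (rule is_subring_Bset[OF is_subring_Ints ex_range])
  have c: "(\<lambda>_. of_int z) \<in> ?B" for z by (rule Bset_const[OF ex_range]) simp
  have "(\<lambda>p. pmon ex \<mu> (tw p)) \<in> ?B" if "\<mu> \<in> keys f" for \<mu>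
  proof -
    have "(\<Prod>v\<in>keys \<mu>. (\<lambda>_. sg v powi ex (lookup \<mu> v)) *
        (\<lambda>p. nz (p v) powi ex (lookup \<mu> v))) \<in> ?B"
    proof (rule is_subring_prod[OF RB], rule is_subringD(4)[OF RB])
      fix v assume "v \<in> keys \<mu>"
      then have v: "v \<in> vars m n" using f that by (auto simp: gpoly_in_def)
      show "(\<lambda>_. sg v powi ex (lookup \<mu> v)) \<in> ?B"
        by (rule Bset_const[OF ex_range sg_powi_Ints])
      show "(\<lambda>p. nz (p v) powi ex (lookup \<mu> v)) \<in> ?B"
        by (rule Bset_Xpow[OF is_subring_Ints ex_range finite_vars v rangeI])
    qed
    also have "(\<Prod>v\<in>keys \<mu>. (\<lambda>_. sg v powi ex (lookup \<mu> v)) *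
        (\<lambda>p. nz (p v) powi ex (lookup \<mu> v))) = (\<lambda>p. pmon ex \<mu> (tw p))"
      by (simp add: fun_eq_iff prod_fun_apply pmon_def tw_def power_int_mult_distrib)
    finally show ?thesis .
  qed
  then have "(\<Sum>\<mu>\<in>keys f. (\<lambda>_. of_int (lookup f \<mu>)) * (\<lambda>p. pmon ex \<mu> (tw p))) \<in> ?B"
    by (intro is_subring_sum[OF RB] is_subringD(4)[OF RB] c)
  also have "(\<Sum>\<mu>\<in>keys f. (\<lambda>_. of_int (lookup f \<mu>)) * (\<lambda>p. pmon ex \<mu> (tw p))) = ev f"
    by (simp add: fun_eq_iff sum_fun_apply ev_def lin_def)
  finally show ?thesis .
qed

lemma is_subring_ev_image:
  assumes "is_subring A" shows "is_subring (ev ` A)"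
  unfolding is_subring_def
proof (intro conjI ballI)
  show "1 \<in> ev ` A" using is_subringD(1)[OF assms] ev_1 by (metis imageI)
  fix a b assume "a \<in> ev ` A" "b \<in> ev ` A"
  then obtain f g where "f \<in> A" "g \<in> A" "a = ev f" "b = ev g" by blast
  then show "a - b \<in> ev ` A" "a * b \<in> ev ` A"
    using is_subringD(3,4)[OF assms, of f g] by (simp_all flip: ev_diff ev_mult)
qed

lemma Bset_ev:
  assumes F: "F \<in> Bset \<int> (range ex) (vars m n)" shows "\<exists>f\<in>gpoly_in m n. ev f = F"
proof -
  let ?I = "ev ` gpoly_in m n"
  have RI: "is_subring ?I" by (rule is_subring_ev_image[OF is_subring_gpoly_in])
  have C: "(\<lambda>_. c) \<in> ?I" if "c \<in> \<int>" for c
  proof -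
    from that obtain z where z: "c = of_int z" by (auto elim: Ints_cases)
    have "ev (Poly_Mapping.single 0 z) = (\<lambda>_. c)" by (simp add: ev_def fun_eq_iff lin_single pmon_def z)
    moreover have "Poly_Mapping.single 0 z \<in> gpoly_in m n" by (simp add: gpoly_in_def)
    ultimately show ?thesis by (metis imageI)
  qed
  have Y: "(\<lambda>p. nz (p v) powi a) \<in> ?I" if v: "v \<in> vars m n" and a: "a \<in> range ex" for v a
  proof -
    obtain b where b: "a = ex b" using a by blast
    have "ev (Poly_Mapping.single (Poly_Mapping.single v b) 1) = (\<lambda>p. tw p v powi a)"
    proof -
      have "pmon ex (Poly_Mapping.single v b) q = q v powi ex b" for q :: "nat + nat \<Rightarrow> 'l"
        by (subst pmon_superset[of "{v}"]) auto
      then show ?thesis by (simp add: ev_def fun_eq_iff b)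
    qed
    moreover have "Poly_Mapping.single (Poly_Mapping.single v b) 1 \<in> gpoly_in m n"
      using v by (simp add: gpoly_in_def)
    ultimately have "(\<lambda>p. tw p v powi a) \<in> ?I" by (metis imageI)
    then have "(\<lambda>_. sg v powi a) * (\<lambda>p. tw p v powi a) \<in> ?I"
      by (rule is_subringD(4)[OF RI C[OF sg_powi_Ints]])
    also have "(\<lambda>_. sg v powi a) * (\<lambda>p. tw p v powi a) = (\<lambda>p. nz (p v) powi a)"
      by (simp add: fun_eq_iff tw_def power_int_mult_distrib[symmetric] mult.assoc[symmetric] sg_square)
    finally show ?thesis .
  qed
  have "F \<in> ?I" using F
  proof (induction rule: Bset.induct)
    case Bset_zero
    then show ?case by (rule is_subringD(2)[OF RI])
  next
    case (Bset_step f c \<alpha>)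
    have "f + (\<lambda>_. c) * (\<Prod>v\<in>vars m n. (\<lambda>p. nz (p v) powi \<alpha> v)) \<in> ?I"
      using Bset_step.hyps(3)
      by (intro is_subringD(6)[OF RI Bset_step.IH] is_subringD(4)[OF RI C[OF Bset_step.hyps(2)]] is_subring_prod[OF RI] Y) auto
    also have "f + (\<lambda>_. c) * (\<Prod>v\<in>vars m n. (\<lambda>p. nz (p v) powi \<alpha> v)) = (\<lambda>p. f p + c * Mon (vars m n) \<alpha> p)"
      by (simp add: fun_eq_iff prod_fun_apply Mon_def)
    finally show ?case .
  qed
  then show ?thesis by blast
qed

lemma lin_permute:
  assumes \<pi>: "bij \<pi>"
  shows "lin (\<lambda>\<mu>. pmon ex \<mu> q) (permute_vars \<pi> f) = lin (\<lambda>\<mu>. pmon ex \<mu> (\<lambda>v. q (\<pi> v))) f"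
proof -
  let ?T = "Poly_Mapping.map_key \<pi> :: (nat + nat \<Rightarrow>\<^sub>0 'e) \<Rightarrow> nat + nat \<Rightarrow>\<^sub>0 'e"
  have Tk: "keys (?T \<mu>) = \<pi> -` keys \<mu>" for \<mu>
    by (auto simp: in_keys_iff lookup_map_key[OF bij_is_inj[OF \<pi>]])
  have pm: "pmon ex \<mu> q = pmon ex (?T \<mu>) (\<lambda>v. q (\<pi> v))" for \<mu>
  proof -
    have "bij_betw \<pi> (\<pi> -` keys \<mu>) (keys \<mu>)"
      unfolding bij_betw_def
      by (intro conjI inj_on_subset[OF bij_is_inj[OF \<pi>] subset_UNIV] surj_image_vimage_eq[OF bij_is_surj[OF \<pi>]])
    from prod.reindex_bij_betw[OF this, of "\<lambda>v. q v powi ex (lookup \<mu> v)"]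
    show ?thesis by (simp add: pmon_def Tk lookup_map_key[OF bij_is_inj[OF \<pi>]])
  qed
  have bT: "bij_betw ?T (keys (permute_vars \<pi> f)) (keys f)"
  proof (rule bij_betwI')
    show "(?T \<mu> = ?T \<nu>) = (\<mu> = \<nu>)" for \<mu> \<nu> by (rule inj_eq[OF inj_map_key[OF \<pi>]])
    show "?T \<mu> \<in> keys f" if "\<mu> \<in> keys (permute_vars \<pi> f)" for \<mu>
      using that by (simp add: in_keys_iff lookup_permute_vars[OF \<pi>])
    show "\<exists>\<mu>\<in>keys (permute_vars \<pi> f). \<nu> = ?T \<mu>" if "\<nu> \<in> keys f" for \<nu>
      using that map_key_inv[OF \<pi>, of \<nu>]
      by (intro bexI[of _ "Poly_Mapping.map_key (Hilbert_Choice.inv \<pi>) \<nu>"]) (simp_all add: in_keys_iff lookup_permute_vars[OF \<pi>])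
  qed
  have "lin (\<lambda>\<mu>. pmon ex \<mu> q) (permute_vars \<pi> f) =
    (\<Sum>\<mu>\<in>keys (permute_vars \<pi> f). of_int (lookup f (?T \<mu>)) * pmon ex (?T \<mu>) (\<lambda>v. q (\<pi> v)))"
    unfolding lin_def lookup_permute_vars[OF \<pi>] using pm by simp
  also have "\<dots> = lin (\<lambda>\<mu>. pmon ex \<mu> (\<lambda>v. q (\<pi> v))) f"
    unfolding lin_def by (rule sum.reindex_bij_betw[OF bT])
  finally show ?thesis .
qed

lemma ev_permute:
  assumes "\<sigma> permutes {..<m}" "\<tau> permutes {..<n}"
  shows "ev (permute_vars (map_sum \<sigma> \<tau>) f) p = ev f (\<lambda>v. p (map_sum \<sigma> \<tau> v))"
proof -
  have "bij (map_sum \<sigma> \<tau>)"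
    by (rule o_bij[of "map_sum (Hilbert_Choice.inv \<sigma>) (Hilbert_Choice.inv \<tau>)"])
       (simp_all add: map_sum.comp permutes_inv_o[OF assms(1)] permutes_inv_o[OF assms(2)] map_sum.id)
  moreover have "(\<lambda>v. tw p (map_sum \<sigma> \<tau> v)) = tw (\<lambda>v. p (map_sum \<sigma> \<tau> v))"
  proof
    show "tw p (map_sum \<sigma> \<tau> v) = tw (\<lambda>v. p (map_sum \<sigma> \<tau> v)) v" for v by (cases v) (simp_all add: tw_def sg_def)
  qed
  ultimately show ?thesis by (simp add: ev_def lin_permute)
qed

lemma W_invariants_iff: "f \<in> W_invariants m n \<longleftrightarrow> f \<in> gpoly_in m n \<and> Winv m n (ev f)"
proof -
  have "permute_vars (map_sum \<sigma> \<tau>) f = f \<longleftrightarrow> (\<forall>p. ev f (\<lambda>v. p (map_sum \<sigma> \<tau> v)) = ev f p)"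
    if "\<sigma> permutes {..<m}" "\<tau> permutes {..<n}" for \<sigma> \<tau>
    using ev_permute[OF that, of f] ev_inj[of "permute_vars (map_sum \<sigma> \<tau>) f" f] by (auto simp: fun_eq_iff)
  then show ?thesis unfolding W_invariants_def Winv_def by auto
qed

text \<open>\<open>\<iota>\<close> embeds K into a field of values of characteristic 0. Cases S and
  L enter only through the description of \<open>A\<close> by \<open>ssym\<close>, and evaluation
  identifies \<open>A\<close> with the invariant supersymmetric functions with integer
  coefficients.\<close>

lemma tensor_prime_intersections:
  fixes \<iota> :: "'k::comm_ring_1 \<Rightarrow> 'l"
  assumes \<iota>: "\<iota> 1 = 1" "\<And>x y. \<iota> (x - y) = \<iota> x - \<iota> y" "\<And>x y. \<iota> (x * y) = \<iota> x * \<iota> y" "inj \<iota>"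
    and K: "noeth (UNIV :: 'k set)"
    and zb: "\<And>Y :: 'k set. finite Y \<Longrightarrow> \<exists>D. finite D \<and> (\<forall>x\<in>Y. \<exists>z. x = (\<Sum>e\<in>D. of_int (z e) * e)) \<and> zindep D"
    and A: "A = {f \<in> W_invariants m n. ssym m n (ev f)}"
    and Q: "Q = ring_on A \<otimes>\<^sub>\<int> (ring_of_type_algebra :: 'k ring)"
  shows "acc_radical_ideals Q \<and> (\<forall>I. radical_ideal I Q \<longrightarrow>
      (\<exists>\<P>. finite_prime_intersection Q I \<P>) \<and> finite_prime_intersection Q I (minimal_primes Q I))"
proof -
  let ?E = "range ex"
  have A': "A = {f \<in> gpoly_in m n. ev f \<in> SS \<int> ?E m n}"
    unfolding A SS_def using ev_Bset by (auto simp: W_invariants_iff)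
  have im: "ev ` A = SS \<int> ?E m n"
  proof (intro equalityI subsetI)
    fix F :: "(nat + nat \<Rightarrow> 'l) \<Rightarrow> 'l" assume F: "F \<in> SS \<int> ?E m n"
    then obtain f where "f \<in> gpoly_in m n" "ev f = F" using Bset_ev[of F m n] by (auto simp: SS_def)
    with F show "F \<in> ev ` A" by (auto simp: A')
  qed (auto simp: A')
  have sub: "is_subring A"
    unfolding is_subring_def
  proof (intro conjI ballI)
    note G = is_subring_gpoly_in[of m n, where 'e = 'e]
      and S = is_subring_SS[OF is_subring_Ints ex_range, of m n, where 'a = 'l]
    show "1 \<in> A" using is_subringD(1)[OF G] is_subringD(1)[OF S] by (simp add: A' ev_1)
    fix f g assume "f \<in> A" "g \<in> A"
    then have fg: "f \<in> gpoly_in m n" "g \<in> gpoly_in m n" "ev f \<in> SS \<int> ?E m n" "ev g \<in> SS \<int> ?E m n"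
      by (simp_all add: A')
    show "f - g \<in> A" using is_subringD(3)[OF G fg(1,2)] is_subringD(3)[OF S fg(3,4)] by (simp add: A' ev_diff)
    show "f * g \<in> A" using is_subringD(4)[OF G fg(1,2)] is_subringD(4)[OF S fg(3,4)] by (simp add: A' ev_mult)
  qed
  have \<iota>0: "\<iota> 0 = 0" using \<iota>(2)[of 0 0] by simp
  have \<iota>_add: "\<iota> (x + y) = \<iota> x + \<iota> y" for x y using \<iota>(2)[of x "- y"] \<iota>(2)[of 0 y] \<iota>0 by simp
  have C: "is_subring (range \<iota>)" by (rule is_subring_range[OF \<iota>(1-3)])
  have CZ: "\<int> \<subseteq> range \<iota>"
  proof
    fix x :: 'l assume "x \<in> \<int>"
    then obtain z where z: "x = of_int z" by (auto elim: Ints_cases)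
    have n: "of_nat j \<in> range \<iota>" for j :: nat
      by (induction j) (simp_all only: of_nat_0 of_nat_Suc is_subringD[OF C])
    show "x \<in> range \<iota>" unfolding z
      by (cases z) (use n is_subringD(5)[OF C n] in \<open>simp_all del: of_nat_Suc\<close>)
  qed
  have CN: "noeth (range \<iota>)" by (rule noeth_hom[OF K \<iota>0 \<iota>_add \<iota>(3)])
  interpret tensor_eval A ev "\<lambda>k _. \<iota> k"
  proof
    show "is_subring A" by (rule sub)
    fix Y :: "'k set" assume "finite Y"
    then obtain D where D: "finite D" "\<forall>x\<in>Y. \<exists>z. x = (\<Sum>e\<in>D. of_int (z e) * e)" "zindep D" using zb by blast
    have "g d = 0" if "(\<Sum>e\<in>D. ev (g e) * (\<lambda>_. \<iota> e)) = 0" "d \<in> D" for g d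
    proof (rule ev_independent[OF \<iota> D(1,3) _ that(2)])
      show "(\<Sum>e\<in>D. ev (g e) p * \<iota> e) = 0" for p
        using fun_cong[OF that(1), of p] by (simp add: sum_fun_apply)
    qed
    with D show "\<exists>D. finite D \<and> (\<forall>x\<in>Y. \<exists>z. x = (\<Sum>e\<in>D. of_int (z e) * e)) \<and>
        (\<forall>g. (\<forall>e\<in>D. g e \<in> A) \<longrightarrow> (\<Sum>e\<in>D. ev (g e) * (\<lambda>_. \<iota> e)) = 0 \<longrightarrow> (\<forall>e\<in>D. g e = 0))"
      by blast
  qed (simp_all add: ev_1 ev_diff ev_mult \<iota> fun_eq_iff)
  have lspan_eq: "lspan (range (\<lambda>k _. \<iota> k)) (ev ` A) = AK (range \<iota>) ?E m n"
    unfolding AK_def im by (simp add: image_image)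
  show ?thesis
    unfolding Q by (rule tensor_prime_intersections, rule acc_AK[OF C CZ CN ex_range]) (simp_all only: lspan_eq)
qed

end

section \<open>The two supersymmetry conditions\<close>

text \<open>The group permutes the pairs of an x and a y transitively, by a transposition in each
  factor, so the condition that case S imposes on the first pair spreads to all pairs.\<close>

lemma ssym_from_first_pair:
  assumes W: "Winv m n f" and mn: "0 < m" "0 < n"
    and f: "\<And>p q. nz (p (Inl 0)) = nz (p (Inr 0)) \<Longrightarrow> nz (q (Inl 0)) = nz (q (Inr 0)) \<Longrightarrow>
      (\<And>v. v \<noteq> Inl 0 \<Longrightarrow> v \<noteq> Inr 0 \<Longrightarrow> nz (p v) = nz (q v)) \<Longrightarrow> f p = f q"
  shows "ssym m n f"
proof (rule ssymI)
  fix i j and p q :: "nat + nat \<Rightarrow> 'a"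
  assume h: "i < m" "j < n" "nz (p (Inl i)) = nz (p (Inr j))" "nz (q (Inl i)) = nz (q (Inr j))"
    "\<And>v. v \<noteq> Inl i \<Longrightarrow> v \<noteq> Inr j \<Longrightarrow> nz (p v) = nz (q v)"
  let ?\<pi> = "map_sum (transpose 0 i) (transpose 0 j)"
  have "transpose 0 i permutes {..<m}" "transpose 0 j permutes {..<n}"
    using h(1,2) mn by (auto intro!: permutes_swap_id)
  then have W': "f (\<lambda>v. r (?\<pi> v)) = f r" for r using W unfolding Winv_def by blast
  have "f (\<lambda>v. p (?\<pi> v)) = f (\<lambda>v. q (?\<pi> v))"
  proof (rule f)
    fix v :: "nat + nat" assume v: "v \<noteq> Inl 0" "v \<noteq> Inr 0"
    have "?\<pi> v \<noteq> Inl i" "?\<pi> v \<noteq> Inr j"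
      using v by (cases v; auto simp: transpose_def split: if_splits)+
    then show "nz (p (?\<pi> v)) = nz (q (?\<pi> v))" by (rule h(5))
  qed (use h(3,4) in simp_all)
  then show "f p = f q" by (simp add: W')
qed

lemma exponent_embedding_int: "exponent_embedding int"
  by unfold_locales (auto simp: exponents_def image_def intro: zero_le_imp_eq_int)

lemma exponent_embedding_id: "exponent_embedding (\<lambda>a::int. a)"
  by unfold_locales (auto simp: exponents_def)

definition peval :: "(nat + nat \<Rightarrow> 'l::field) \<Rightarrow> zpoly \<Rightarrow> 'l" where
  "peval q = lin (\<lambda>\<mu>. pmon int \<mu> q)"

lemma comm_ring_hom_peval:
  fixes q :: "nat + nat \<Rightarrow> 'l::field"
  assumes "\<And>v. q v \<noteq> 0" shows "comm_ring_hom (peval q)"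
proof
  interpret exponent_embedding int by (rule exponent_embedding_int)
  have one: "lin F 1 = F 0" for F :: "(nat + nat \<Rightarrow>\<^sub>0 nat) \<Rightarrow> 'l"
    using lin_simps(2)[of F 0] unfolding single_one .
  show "peval q 1 = 1" by (simp add: peval_def one pmon_def)
  show "peval q (f * g) = peval q f * peval q g" for f g
    unfolding peval_def by (rule lin_mult[OF pmon_add[OF assms]])
qed (simp_all add: peval_def)

lemma map_poly_const: "f 0 = 0 \<Longrightarrow> map_poly f [:a:] = [:f a:]"
  by (rule poly_eqI) (simp add: coeff_map_poly coeff_pCons split: nat.split)

text \<open>Substituting and then evaluating the other variables is the same as evaluating at the
  altered point. The value \<open>t = 0\<close> is harmless since all exponents come from
  \<open>nat\<close>.\<close>

lemma peval_subst_t: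
  fixes q :: "nat + nat \<Rightarrow> 'l::field"
  assumes "\<And>v. q v \<noteq> 0"
  shows "poly (map_poly (peval q) (subst_t f)) t = peval (q(Inl 0 := t, Inr 0 := - t)) f"
proof -
  interpret c: comm_ring_hom "peval q" by (rule comm_ring_hom_peval[OF assms])
  interpret mp: map_poly_comm_ring_hom "peval q" ..
  let ?\<phi> = "\<lambda>v. if v = Inl 0 then [:0, 1:] else if v = Inr 0 then - [:0, 1:] else [:Var v:] :: zpoly poly"
  let ?q = "q(Inl 0 := t, Inr 0 := - t)"
  have V: "peval q (Var v) = q v" for v by (simp add: peval_def Var_def pmon_def)
  have \<phi>: "poly (map_poly (peval q) (?\<phi> v)) t = ?q v" for v
    by (cases "v = Inl 0"; cases "v = Inr 0") (simp_all add: map_poly_const c.hom_uminus V)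
  have "poly (map_poly (peval q) (subst_poly ?\<phi> f)) t = (\<Sum>\<mu>\<in>keys f. of_int (lookup f \<mu>) *
     (\<Prod>v\<in>keys \<mu>. poly (map_poly (peval q) (?\<phi> v)) t ^ lookup \<mu> v))"
    unfolding subst_poly_def mp.hom_sum mp.hom_mult mp.hom_prod mp.hom_power mp.hom_of_int poly_sum poly_mult poly_prod poly_power
    by simp
  also have "\<dots> = peval ?q f"
    unfolding \<phi> by (simp add: peval_def lin_def pmon_def)
  finally show ?thesis by (simp add: subst_t_def)
qed

lemma poly_constant_if_constant_values:
  fixes P :: "'l::field_char_0 poly"
  assumes "\<And>t. t \<noteq> 0 \<Longrightarrow> poly P t = c" shows "P = [:c:]"
proof -
  have "poly (P - [:c:]) t = 0" if "t \<noteq> 0" for t using assms[OF that] by simp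
  then have "UNIV - {0} \<subseteq> {t. poly (P - [:c:]) t = 0}" by blast
  moreover have "infinite (UNIV - {0::'l})" using infinite_UNIV_char_0 by simp
  ultimately have "P - [:c:] = 0" using poly_roots_finite finite_subset by blast
  then show ?thesis by simp
qed

locale eval_S = gpoly_eval int s for s :: "'l::field_char_0" +
  assumes s_eq: "s = - 1"
begin

lemma sg_eq: "sg v = (case v of Inl _ \<Rightarrow> 1 | Inr _ \<Rightarrow> - 1)"
  unfolding sg_def by (simp only: s_eq)

lemma ev_peval: "ev f p = peval (tw p) f"
  by (simp add: ev_def peval_def)

lemma tw_first_pair:
  assumes "\<And>v. v \<noteq> Inl 0 \<Longrightarrow> v \<noteq> Inr 0 \<Longrightarrow> nz (p v) = nz (q v)" "nz (q (Inl 0)) = nz (q (Inr 0))"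
  shows "tw q = (tw p)(Inl 0 := nz (q (Inl 0)), Inr 0 := - nz (q (Inl 0)))"
  using assms by (auto simp: fun_eq_iff tw_def sg_eq split: sum.split)

lemma supersym_iff:
  assumes f: "f \<in> W_invariants m n"
  shows "(m > 0 \<and> n > 0 \<longrightarrow> degree (subst_t f) = 0) \<longleftrightarrow> ssym m n (ev f)"
proof
  assume d: "m > 0 \<and> n > 0 \<longrightarrow> degree (subst_t f) = 0"
  show "ssym m n (ev f)"
  proof (cases "m > 0 \<and> n > 0")
    case True
    with d obtain c where c: "subst_t f = [:c:]" by (meson degree_eq_zeroE)
    show ?thesis
    proof (rule ssym_from_first_pair)
      show "Winv m n (ev f)" using f by (simp add: W_invariants_iff)
      fix p q :: "nat + nat \<Rightarrow> 'l"
      assume h: "nz (p (Inl 0)) = nz (p (Inr 0))" "nz (q (Inl 0)) = nz (q (Inr 0))"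
        "\<And>v. v \<noteq> Inl 0 \<Longrightarrow> v \<noteq> Inr 0 \<Longrightarrow> nz (p v) = nz (q v)"
      have "peval ((tw p)(Inl 0 := t, Inr 0 := - t)) f = peval (tw p) c" for t
      proof -
        interpret c: comm_ring_hom "peval (tw p)" by (rule comm_ring_hom_peval) simp
        show ?thesis unfolding peval_subst_t[OF tw_nonzero, symmetric] c by (simp add: map_poly_const)
      qed
      moreover have "tw p = (tw p)(Inl 0 := nz (p (Inl 0)), Inr 0 := - nz (p (Inl 0)))"
        by (rule tw_first_pair[OF _ h(1)]) simp
      moreover note tw_first_pair[OF h(3,2)]
      ultimately show "ev f p = ev f q" unfolding ev_peval by metis
    qed (use True in auto)
  qed (auto simp: ssym_def)
next
  assume sym: "ssym m n (ev f)"
  show "m > 0 \<and> n > 0 \<longrightarrow> degree (subst_t f) = 0"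
  proof
    assume mn: "m > 0 \<and> n > 0"
    \<comment> \<open>At every point the evaluated polynomial in t is constant for t different from
      0, hence constant, so its higher coefficients vanish. The coefficients of
      \<open>subst_t f\<close> are polynomials vanishing on the whole torus, hence zero.\<close>
    have "coeff (subst_t f) i = 0" if "i > 0" for i
    proof (rule ev_eq_0)
      fix p
      interpret c: comm_ring_hom "peval (tw p)" by (rule comm_ring_hom_peval) simp
      define P where "P = map_poly (peval (tw p)) (subst_t f)"
      let ?p = "\<lambda>t. p(Inl 0 := t, Inr 0 := t)"
      have "poly P t = ev f (?p 1)" if "t \<noteq> 0" for t
      proof -
        have "poly P t = peval ((tw p)(Inl 0 := t, Inr 0 := - t)) f" unfolding P_def by (rule peval_subst_t) simp
        also have "(tw p)(Inl 0 := t, Inr 0 := - t) = tw (?p t)"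
          using that tw_first_pair[of p "?p t"] by simp
        also have "peval (tw (?p t)) f = ev f (?p 1)"
          unfolding ev_peval[symmetric] by (rule ssymD[OF sym, of 0 0]) (use mn in auto)
        finally show ?thesis .
      qed
      then have "P = [:ev f (?p 1):]" by (rule poly_constant_if_constant_values)
      then have "coeff P i = 0" using \<open>i > 0\<close> by (simp add: coeff_pCons split: nat.split)
      then show "ev (coeff (subst_t f) i) p = 0" by (simp add: P_def coeff_map_poly ev_peval)
    qed
    then show "degree (subst_t f) = 0" by (intro le_antisym degree_le) auto
  qed
qed

end

lemma Var_partial_deriv:
  "Var v * partial_deriv v f = (\<Sum>\<mu>\<in>keys f. Poly_Mapping.single \<mu> (lookup \<mu> v * lookup f \<mu>))"
  unfolding partial_deriv_def Var_def sum_distrib_left mult_single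
  by (intro sum.cong refl arg_cong2[where f = Poly_Mapping.single]) auto

lemma lin_sum: "lin F (sum f I) = (\<Sum>i\<in>I. lin F (f i))"
  by (induction I rule: infinite_finite_induct) auto

text \<open>Grouping a Laurent polynomial by the total exponent \<open>k\<close> of the specialised pair, both conditions
  say that the coefficients of \<open>t\<^sup>k\<close> vanish for all \<open>k \<noteq> 0\<close>.\<close>

lemma euler_constant_iff:
  fixes c :: "'i \<Rightarrow> 'l::field_char_0" and k :: "'i \<Rightarrow> int"
  assumes M: "finite M"
  shows "(\<forall>t. t \<noteq> 0 \<longrightarrow> (\<Sum>i\<in>M. of_int (k i) * (c i * t powi k i)) = 0) \<longleftrightarrow>
    (\<forall>t. t \<noteq> 0 \<longrightarrow> (\<Sum>i\<in>M. c i * t powi k i) = (\<Sum>i\<in>M. c i))"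
proof -
  define d where "d = (\<lambda>j. \<Sum>i\<in>{i \<in> M. k i = j}. c i)"
  have g: "(\<Sum>i\<in>M. w (k i) * c i) = (\<Sum>j\<in>k ` M. w j * d j)" for w :: "int \<Rightarrow> 'l"
    unfolding d_def sum_distrib_left by (subst sum.image_gen[OF M, of _ k]) (intro sum.cong refl, auto)
  have A: "(\<Sum>i\<in>M. of_int (k i) * (c i * t powi k i)) = (\<Sum>j\<in>k ` M. (of_int j * d j) * t powi j)" for t
    using g[of "\<lambda>j. of_int j * t powi j"] by (simp add: mult_ac)
  have B: "(\<Sum>i\<in>M. c i * t powi k i) = (\<Sum>j\<in>k ` M. d j * t powi j)" for t
    using g[of "\<lambda>j. t powi j"] by (simp add: mult_ac)
  have C: "(\<Sum>i\<in>M. c i) = (\<Sum>j\<in>k ` M. d j)" using g[of "\<lambda>_. 1"] by simp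
  show ?thesis
  proof
    assume "\<forall>t. t \<noteq> 0 \<longrightarrow> (\<Sum>i\<in>M. of_int (k i) * (c i * t powi k i)) = 0"
    then have "of_int j * d j = 0" if "j \<in> k ` M" for j
      using powi_independent[of "k ` M" "\<lambda>j. of_int j * d j"] M that unfolding A by blast
    then have "d j = 0" if "j \<in> k ` M" "j \<noteq> 0" for j using that by fastforce
    then have "d j * t powi j = d j" if "j \<in> k ` M" for j t using that by (cases "j = 0") auto
    then show "\<forall>t. t \<noteq> 0 \<longrightarrow> (\<Sum>i\<in>M. c i * t powi k i) = (\<Sum>i\<in>M. c i)"
      unfolding B C by (intro allI impI sum.cong refl) simp
  next
    assume const: "\<forall>t. t \<noteq> 0 \<longrightarrow> (\<Sum>i\<in>M. c i * t powi k i) = (\<Sum>i\<in>M. c i)"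
    let ?e = "\<lambda>j. (if j \<in> k ` M then d j else 0) - (if j = 0 then (\<Sum>i\<in>M. c i) else 0)"
    have "(\<Sum>j\<in>insert 0 (k ` M). ?e j * t powi j) = 0" if "t \<noteq> 0" for t
    proof -
      have "(\<Sum>j\<in>insert 0 (k ` M). ?e j * t powi j) =
        (\<Sum>j\<in>insert 0 (k ` M). (if j \<in> k ` M then d j * t powi j else 0)) -
        (\<Sum>j\<in>insert 0 (k ` M). (if j = 0 then (\<Sum>i\<in>M. c i) else 0))"
        unfolding sum_subtractf[symmetric] by (intro sum.cong) auto
      also have "(\<Sum>j\<in>insert 0 (k ` M). (if j \<in> k ` M then d j * t powi j else 0)) = (\<Sum>j\<in>k ` M. d j * t powi j)"
        using M by (intro sum.mono_neutral_cong_right) auto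
      also have "(\<Sum>j\<in>insert 0 (k ` M). (if j = 0 then (\<Sum>i\<in>M. c i) else 0)) = (\<Sum>i\<in>M. c i)"
        using M by simp
      finally show ?thesis using const that unfolding B by simp
    qed
    then have e: "?e j = 0" if "j \<in> k ` M" for j
      using powi_independent[of "insert 0 (k ` M)" ?e j] M that by blast
    have "of_int j * d j = 0" if "j \<in> k ` M" for j using e[OF that] that by (cases "j = 0") auto
    then show "\<forall>t. t \<noteq> 0 \<longrightarrow> (\<Sum>i\<in>M. of_int (k i) * (c i * t powi k i)) = 0"
      unfolding A by (intro allI impI sum.neutral ballI) simp
  qed
qed

locale eval_L = gpoly_eval "\<lambda>a::int. a" s for s :: "'l::field_char_0" +
  assumes s_eq: "s = 1"
begin

lemma sg_eq: "sg v = 1"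
  unfolding sg_def by (cases v) (simp_all add: s_eq)

lemma tw_nz: "tw p v = nz (p v)"
  by (cases v) (simp_all add: tw_def sg_eq)

lemma ev_Var: "ev (Var v) p = nz (p v)"
  by (simp add: ev_def Var_def pmon_def tw_nz)

lemma pmon_pair:
  assumes "a \<noteq> b" "t \<noteq> 0"
  shows "pmon (\<lambda>a. a) \<mu> (tw (p(a := t, b := t))) =
    pmon (\<lambda>a. a) \<mu> (tw (p(a := 1, b := 1))) * t powi (lookup \<mu> a + lookup \<mu> b)"
proof -
  let ?r = "\<lambda>v. if v = a \<or> v = b then t else 1"
  have "tw (p(a := t, b := t)) = (\<lambda>v. tw (p(a := 1, b := 1)) v * ?r v)"
    using assms by (auto simp: fun_eq_iff tw_nz)
  moreover have "pmon (\<lambda>a. a) \<mu> ?r = t powi (lookup \<mu> a + lookup \<mu> b)"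
  proof -
    have "pmon (\<lambda>a. a) \<mu> ?r = (\<Prod>v\<in>{a, b} \<union> keys \<mu>. ?r v powi lookup \<mu> v)"
      by (rule pmon_superset) auto
    also have "\<dots> = (\<Prod>v\<in>{a, b}. ?r v powi lookup \<mu> v)"
      by (rule prod.mono_neutral_right) auto
    finally show ?thesis using assms by (simp add: power_int_add)
  qed
  ultimately show ?thesis by (simp only: pmon_mult)
qed

text \<open>Lying in the ideal of \<open>x\<^sub>i - y\<^sub>j\<close> means vanishing where the two
  coordinates agree. There the Euler operator multiplies the part of degree k in the common value t
  by k, so its vanishing says that \<open>f\<close> does not depend on t.\<close>

lemma supersym_iff:
  assumes f: "f \<in> gpoly_in m n" and ij: "i < m" "j < n"
  shows "Var (Inl i) * partial_deriv (Inl i) f + Var (Inr j) * partial_deriv (Inr j) f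
       \<in> PIdl\<^bsub>laurent_ring m n\<^esub> (Var (Inl i) - Var (Inr j)) \<longleftrightarrow>
    (\<forall>p q. nz (p (Inl i)) = nz (p (Inr j)) \<longrightarrow> nz (q (Inl i)) = nz (q (Inr j)) \<longrightarrow>
     (\<forall>v. v \<noteq> Inl i \<longrightarrow> v \<noteq> Inr j \<longrightarrow> nz (p v) = nz (q v)) \<longrightarrow> ev f p = ev f q)"
    (is "?\<theta> \<in> ?P \<longleftrightarrow> ?sym")
proof -
  let ?a = "Inl i :: nat + nat" and ?b = "Inr j :: nat + nat"
  let ?pt = "\<lambda>p t. p(?a := t, ?b := t :: 'l)"
  let ?k = "\<lambda>\<mu>. lookup \<mu> ?a + lookup \<mu> ?b :: int"
  define c where "c = (\<lambda>p \<mu>. of_int (lookup f \<mu>) * pmon (\<lambda>a. a) \<mu> (tw (?pt p 1)))"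
  have f_t: "ev f (?pt p t) = (\<Sum>\<mu>\<in>keys f. c p \<mu> * t powi ?k \<mu>)" if "t \<noteq> 0" for p t
    unfolding ev_def lin_def c_def using pmon_pair[of ?a ?b t _ p] that by (simp add: mult_ac)
  have \<theta>_sum: "?\<theta> = (\<Sum>\<mu>\<in>keys f. Poly_Mapping.single \<mu> (?k \<mu> * lookup f \<mu>))"
    unfolding Var_partial_deriv sum.distrib[symmetric] single_add[symmetric] by (simp add: distrib_right)
  have \<theta>_t: "ev ?\<theta> (?pt p t) = (\<Sum>\<mu>\<in>keys f. of_int (?k \<mu>) * (c p \<mu> * t powi ?k \<mu>))" if "t \<noteq> 0" for p t
    unfolding \<theta>_sum ev_def lin_sum lin_single c_def using pmon_pair[of ?a ?b t _ p] that by (simp add: mult_ac)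
  have key: "(\<forall>t. t \<noteq> 0 \<longrightarrow> ev ?\<theta> (?pt p t) = 0) \<longleftrightarrow> (\<forall>t. t \<noteq> 0 \<longrightarrow> ev f (?pt p t) = ev f (?pt p 1))" for p
  proof -
    have "ev f (?pt p 1) = (\<Sum>\<mu>\<in>keys f. c p \<mu>)" using f_t[of 1 p] by simp
    then show ?thesis
      using euler_constant_iff[of "keys f" ?k "c p"] f_t[of _ p] \<theta>_t[of _ p] by simp
  qed
  have loc: "ev g p = ev g q" if "\<And>v. nz (p v) = nz (q v)" for g p q
  proof -
    have "tw p = tw q" using that by (simp add: fun_eq_iff tw_nz)
    then show ?thesis by (simp add: ev_def)
  qed
  have \<theta>_in: "?\<theta> \<in> gpoly_in m n"
  proof -
    have "Poly_Mapping.single \<mu> z \<in> gpoly_in m n" if "\<mu> \<in> keys f" for \<mu> and z :: int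
      using f that by (auto simp: gpoly_in_def)
    then show ?thesis unfolding \<theta>_sum by (intro is_subring_sum[OF is_subring_gpoly_in])
  qed
  show ?thesis
  proof
    assume "?\<theta> \<in> ?P"
    then obtain x where x: "?\<theta> = x * (Var ?a - Var ?b)"
      by (auto simp: cgenideal_def laurent_ring_def ring_of_type_algebra_def)
    have "ev ?\<theta> (?pt p t) = 0" if "t \<noteq> 0" for p t
      unfolding x by (simp add: ev_mult ev_diff ev_Var)
    then have const: "ev f (?pt p t) = ev f (?pt p 1)" if "t \<noteq> 0" for p t using key that by blast
    show ?sym
    proof (intro allI impI)
      fix p q :: "nat + nat \<Rightarrow> 'l"
      assume h: "nz (p ?a) = nz (p ?b)" "nz (q ?a) = nz (q ?b)" "\<forall>v. v \<noteq> ?a \<longrightarrow> v \<noteq> ?b \<longrightarrow> nz (p v) = nz (q v)"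
      have "ev f p = ev f (?pt p (nz (p ?a)))" by (rule loc) (use h in auto)
      also have "\<dots> = ev f (?pt p (nz (q ?a)))" using const[of "nz (p ?a)" p] const[of "nz (q ?a)" p] by simp
      also have "\<dots> = ev f q" by (rule loc) (use h in auto)
      finally show "ev f p = ev f q" .
    qed
  next
    assume sym: ?sym
    have "ev f (?pt p t) = ev f (?pt p 1)" if "t \<noteq> 0" for p t
      by (rule sym[rule_format]) auto
    then have z: "ev ?\<theta> (?pt p t) = 0" if "t \<noteq> 0" for p t using key that by blast
    have z': "ev ?\<theta> p = 0" if "nz (p ?a) = nz (p ?b)" for p
    proof -
      have "ev ?\<theta> p = ev ?\<theta> (?pt p (nz (p ?a)))" by (rule loc) (use that in auto)
      then show ?thesis using z[of "nz (p ?a)" p] by simp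
    qed
    \<comment> \<open>The division takes place over the integers, so \<open>Bset_ev\<close> turns
      the quotient into an integral Laurent polynomial in the same variables, as membership in the
      principal ideal requires.\<close>
    have "\<exists>b\<in>Bset \<int> (range (\<lambda>a::int. a)) (vars m n). \<forall>p. ev ?\<theta> p = (\<Prod>(v,w)\<in>{(?a, ?b)}. nz (p v) - nz (p w)) * b p"
      by (rule Bset_divide[OF is_subring_Ints ex_range finite_vars ev_Bset[OF \<theta>_in], of _ "{?a}" "{?b}"])
         (use z' ij in auto)
    then obtain b where b: "b \<in> Bset \<int> (range (\<lambda>a::int. a)) (vars m n)" "\<And>p. ev ?\<theta> p = (nz (p ?a) - nz (p ?b)) * b p"
      by auto
    obtain x where x: "x \<in> gpoly_in m n" "ev x = b" using Bset_ev[OF b(1)] by blast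
    have "ev ?\<theta> = ev (x * (Var ?a - Var ?b))"
      by (simp add: fun_eq_iff b(2) ev_mult ev_diff ev_Var x(2))
    then have "?\<theta> = x * (Var ?a - Var ?b)" by (rule ev_inj)
    then show "?\<theta> \<in> ?P" using x(1)
      by (auto simp: cgenideal_def laurent_ring_def ring_of_type_algebra_def)
  qed
qed

end

lemma int_ring_type_algebra: "\<Z> = (ring_of_type_algebra :: int ring)"
  by (simp add: ring_of_type_algebra_def)

lemma supersym_polys_prime_intersections:
  fixes \<iota> :: "'k::comm_ring_1 \<Rightarrow> 'l::field_char_0"
  assumes \<iota>: "\<iota> 1 = 1" "\<And>x y. \<iota> (x - y) = \<iota> x - \<iota> y" "\<And>x y. \<iota> (x * y) = \<iota> x * \<iota> y" "inj \<iota>"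
    and K: "noeth (UNIV :: 'k set)"
    and zb: "\<And>Y :: 'k set. finite Y \<Longrightarrow> \<exists>D. finite D \<and> (\<forall>x\<in>Y. \<exists>z. x = (\<Sum>e\<in>D. of_int (z e) * e)) \<and> zindep D"
    and Q: "Q = supersym_polys m n \<otimes>\<^sub>\<int> (ring_of_type_algebra :: 'k ring)"
  shows "acc_radical_ideals Q \<and> (\<forall>I. radical_ideal I Q \<longrightarrow>
      (\<exists>\<P>. finite_prime_intersection Q I \<P>) \<and> finite_prime_intersection Q I (minimal_primes Q I))"
proof -
  interpret exponent_embedding int by (rule exponent_embedding_int)
  interpret eval_S "- 1 :: 'l" by unfold_locales simp_all
  show ?thesis
  proof (rule tensor_prime_intersections[OF \<iota> K zb refl, where m = m and n = n])
    have "{f \<in> W_invariants m n. m > 0 \<and> n > 0 \<longrightarrow> degree (subst_t f) = 0} = {f \<in> W_invariants m n. ssym m n (ev f)}"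
      by (intro Collect_cong conj_cong refl supersym_iff)
    then show "Q = ring_on {f \<in> W_invariants m n. ssym m n (ev f)} \<otimes>\<^sub>\<int> ring_of_type_algebra"
      by (simp only: Q supersym_polys_def)
  qed
qed

lemma supersym_laurent_prime_intersections:
  fixes \<iota> :: "'k::comm_ring_1 \<Rightarrow> 'l::field_char_0"
  assumes \<iota>: "\<iota> 1 = 1" "\<And>x y. \<iota> (x - y) = \<iota> x - \<iota> y" "\<And>x y. \<iota> (x * y) = \<iota> x * \<iota> y" "inj \<iota>"
    and K: "noeth (UNIV :: 'k set)"
    and zb: "\<And>Y :: 'k set. finite Y \<Longrightarrow> \<exists>D. finite D \<and> (\<forall>x\<in>Y. \<exists>z. x = (\<Sum>e\<in>D. of_int (z e) * e)) \<and> zindep D"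
    and Q: "Q = supersym_laurent m n \<otimes>\<^sub>\<int> (ring_of_type_algebra :: 'k ring)"
  shows "acc_radical_ideals Q \<and> (\<forall>I. radical_ideal I Q \<longrightarrow>
      (\<exists>\<P>. finite_prime_intersection Q I \<P>) \<and> finite_prime_intersection Q I (minimal_primes Q I))"
proof -
  interpret exponent_embedding "\<lambda>a::int. a" by (rule exponent_embedding_id)
  interpret eval_L "1 :: 'l" by unfold_locales simp_all
  show ?thesis
  proof (rule tensor_prime_intersections[OF \<iota> K zb refl, where m = m and n = n])
    have "{f \<in> W_invariants m n. \<forall>i<m. \<forall>j<n.
       Var (Inl i) * partial_deriv (Inl i) f + Var (Inr j) * partial_deriv (Inr j) f
       \<in> PIdl\<^bsub>laurent_ring m n\<^esub> (Var (Inl i) - Var (Inr j))} = {f \<in> W_invariants m n. ssym m n (ev f)}"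
    proof (intro Collect_cong conj_cong refl)
      fix f :: zlaurent assume "f \<in> W_invariants m n"
      then have f: "f \<in> gpoly_in m n" by (simp add: W_invariants_iff)
      show "(\<forall>i<m. \<forall>j<n. Var (Inl i) * partial_deriv (Inl i) f + Var (Inr j) * partial_deriv (Inr j) f
          \<in> PIdl\<^bsub>laurent_ring m n\<^esub> (Var (Inl i) - Var (Inr j))) \<longleftrightarrow> ssym m n (ev f)"
        unfolding ssym_def by (intro all_cong supersym_iff[OF f])
    qed
    then show "Q = ring_on {f \<in> W_invariants m n. ssym m n (ev f)} \<otimes>\<^sub>\<int> ring_of_type_algebra"
      by (simp only: Q supersym_laurent_def)
  qed
qed

theorem theorem5p6:
  fixes m n :: nat
  shows
   "(let A = supersym_polys m n \<otimes>\<^sub>\<int> \<Z>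
      in acc_radical_ideals A \<and>
      (\<forall>I. radical_ideal I A \<longrightarrow>
        (\<exists>\<P>. finite_prime_intersection A I \<P>) \<and>
        finite_prime_intersection A I (minimal_primes A I))) \<and>
    (let A = supersym_polys m n \<otimes>\<^sub>\<int> (ring_of_type_algebra :: ('k::field_char_0) ring)
      in acc_radical_ideals A \<and>
      (\<forall>I. radical_ideal I A \<longrightarrow>
        (\<exists>\<P>. finite_prime_intersection A I \<P>) \<and>
        finite_prime_intersection A I (minimal_primes A I))) \<and>
    (let A = supersym_laurent m n \<otimes>\<^sub>\<int> \<Z>
      in acc_radical_ideals A \<and>
      (\<forall>I. radical_ideal I A \<longrightarrow>
        (\<exists>\<P>. finite_prime_intersection A I \<P>) \<and>
        finite_prime_intersection A I (minimal_primes A I))) \<and>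
    (let A = supersym_laurent m n \<otimes>\<^sub>\<int> (ring_of_type_algebra :: ('k::field_char_0) ring)
      in acc_radical_ideals A \<and>
      (\<forall>I. radical_ideal I A \<longrightarrow>
        (\<exists>\<P>. finite_prime_intersection A I \<P>) \<and>
        finite_prime_intersection A I (minimal_primes A I)))"
proof -
  \<comment> \<open>For K = Z the functions take rational values; a field K serves as its own field
    of values.\<close>
  have inj_int: "inj (of_int :: int \<Rightarrow> rat)" by (simp add: inj_def)
  have inj_id: "inj (\<lambda>x::'k. x)" by simp
  note int = of_int_1 of_int_diff of_int_mult inj_int noeth_int zbasis_int
  note field = refl refl refl inj_id noeth_field zbasis_field
  show ?thesis
    unfolding Let_def int_ring_type_algebra
    by (intro conjI[OF _ conjI[OF _ conjI]]
        supersym_polys_prime_intersections[OF int refl] supersym_laurent_prime_intersections[OF int refl]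
        supersym_polys_prime_intersections[OF field refl] supersym_laurent_prime_intersections[OF field refl])
qed

end
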